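(* Fix $k\ge1$, $g\ge0$, $p\ge1$. Suppose we are given, for each color $i\in\{1,\dots,k\}$, polygons numbered $j=1,\dots,m_i$ with $n_{ij}\ge 2$ sides, and equally many circles of color $i$ with lengths $l_{ij}>0$; all polygons and all circles are considered distinguishable. Let $m=\sum_i m_i$ and $d=4g-4+m+2p$. Let $P(n_{ij})$ be the number of $k$-constellations of genus $g$ with $p$ faces composed of exactly these polygons, and let $Q(l_{ij})$ be the volume of the space of circle constellations of genus $g$ with $p$ faces composed of exactly these circles. Then $P$ is a polynomial in the variables $n_{ij}$ of degree $d$, $Q$ is a homogeneous polynomial in the variables $l_{ij}$ of degree $d$, and $Q$ is obtained by taking the top-degree homogeneous part of $P$ and substituting $l_{ij}$ for $n_{ij}$. In particular $Q(n_{ij})$ gives the asymptotics of $P(n_{ij})$ as the $n_{ij}$ tend to infinity.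
   Context: A $k$-constellation is a connected colored oriented graph consisting of oriented polygons, each with at least 2 sides, colored in colors $1,\dots,k$, such that no two polygons of the same color share a common vertex. It has a natural embedding into a compact oriented surface (unique up to homeomorphism) such that: (i) cutting the surface along the graph gives a union of open discs; (ii) every polygon bounds one such disc and is oriented counterclockwise with respect to it; (iii) the cyclic order of the polygons meeting at each vertex coincides with the increasing order of colors. The genus is that of this surface; the faces are the discs not bounded by a polygon. A circle constellation is defined analogously: an oriented graph with nonnegative edge lengths obtained by gluing at finitely many points oriented colored circles of given lengths, no two circles of the same color sharing a point, with the analogous natural embedding, genus and faces. The space of circle constellations of genus $g$ with $p$ faces glued from given circles carries the following volume measure: on the locus where no three circles share a point, the lengths of all but one of the arcs into which each circle is cut by its gluing points form local coordinates $\lambda_1,\dots,\lambda_d$, and the measure is $|d\lambda_1\wedge\dots\wedge d\lambda_d|$; the remaining locus has measure $0$.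
   Formalization: Constellations are counted with weight 1/|Aut| (unweighted, a 2-gon and a b-gon with g=0, p=2 give no polynomial); d≥0 is required (excluding only a lone polygon or no pieces with g=0, p=1); if fewer than two colors occur, P=Q=0 replaces "degree d". *)

theory Defs
  imports
    "HOL-Analysis.Analysis"
    "HOL-Library.Poly_Mapping"
    "HOL-Library.Real_Mod"
    "HOL-Library.Landau_Symbols"
    "HOL-Combinatorics.Orbits"
begin

section \<open>Real polynomials in several variables\<close>

type_synonym 'v mpoly = "('v \<Rightarrow>\<^sub>0 nat) \<Rightarrow>\<^sub>0 real"

definition mpoly_eval :: "('v \<Rightarrow> real) \<Rightarrow> 'v mpoly \<Rightarrow> real" where
  "mpoly_eval x P =
     (\<Sum>M\<in>Poly_Mapping.keys P. Poly_Mapping.lookup P M *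
        (\<Prod>v\<in>Poly_Mapping.keys M. x v ^ Poly_Mapping.lookup M v))"

definition mpoly_vars :: "'v mpoly \<Rightarrow> 'v set" where
  "mpoly_vars P = (\<Union>M\<in>Poly_Mapping.keys P. Poly_Mapping.keys M)"

definition monom_degree :: "('v \<Rightarrow>\<^sub>0 nat) \<Rightarrow> nat" where
  "monom_degree M = (\<Sum>v\<in>Poly_Mapping.keys M. Poly_Mapping.lookup M v)"

text \<open>The zero polynomial is given degree 0.\<close>

definition total_degree :: "'v mpoly \<Rightarrow> nat" where
  "total_degree P = Max (insert 0 (monom_degree ` Poly_Mapping.keys P))"

definition homogeneous_of_degree :: "nat \<Rightarrow> 'v mpoly \<Rightarrow> bool" where
  "homogeneous_of_degree e P \<longleftrightarrow> (\<forall>M\<in>Poly_Mapping.keys P. monom_degree M = e)"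

definition top_degree_part :: "'v mpoly \<Rightarrow> 'v mpoly" where
  "top_degree_part P =
     (\<Sum>M\<in>{M \<in> Poly_Mapping.keys P. monom_degree M = total_degree P}.
        Poly_Mapping.single M (Poly_Mapping.lookup P M))"


section \<open>Gluings of coloured polygons and circles\<close>

text \<open>
  A piece \<open>(i, j)\<close> is the polygon or circle of colour \<open>i\<close> with number \<open>j\<close>.
  A point of the disjoint union of the pieces is a pair \<open>(c, t)\<close>: for a polygon with \<open>n c\<close> sides
  its corners are \<open>t < n c\<close>, for a circle of length \<open>l c\<close> the position \<open>t\<close> ranges over \<open>[0, l c)\<close>;
  in both cases the orientation is that of increasing \<open>t\<close>.
  A gluing is an equivalence relation on the set of points.
\<close>

type_synonym piece = "nat \<times> nat"
type_synonym 'a gluing = "((piece \<times> 'a) \<times> (piece \<times> 'a)) set"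

definition pieces :: "nat \<Rightarrow> (nat \<Rightarrow> nat) \<Rightarrow> piece set" where
  "pieces k m = (SIGMA i:{1..k}. {1..m i})"

definition colour :: "piece \<times> 'a \<Rightarrow> nat" where
  "colour x = fst (fst x)"

text \<open>
  No vertex lies on two pieces of the same colour, and no piece passes twice through a vertex.
\<close>

definition properly_coloured :: "'a gluing \<Rightarrow> bool" where
  "properly_coloured R \<longleftrightarrow> (\<forall>(x, y)\<in>R. colour x = colour y \<longrightarrow> x = y)"

text \<open>Every piece is connected, so connectedness can be tested on the incidence of pieces.\<close>

definition connected_gluing :: "piece set \<Rightarrow> 'a gluing \<Rightarrow> bool" where
  "connected_gluing I R \<longleftrightarrow>
     I \<noteq> {} \<and> (\<forall>a\<in>I. \<forall>b\<in>I. (a, b) \<in> ((\<lambda>(x, y). (fst x, fst y)) ` R)\<^sup>*)"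

definition cyclic_next :: "('b \<Rightarrow> 'c::linorder) \<Rightarrow> 'b set \<Rightarrow> 'b \<Rightarrow> 'b" where
  "cyclic_next f A x = arg_min_on f (if \<exists>y\<in>A. f x < f y then {y\<in>A. f x < f y} else A)"

text \<open>
  Let the finite set \<open>D\<close> of points cut the pieces into edges; an edge is named by its initial point.
  A polygonal disc lies to the left of its edges, so each edge has exactly one of the faces (the
  discs not bounded by a polygon) to its right. Around a vertex the half-edges are, in
  counterclockwise order, the outgoing and the incoming edge of the first colour present, then the
  outgoing and the incoming edge of the next colour, and so on. Hence the boundary of the face to
  the right of an edge continues, at the end of that edge, along the outgoing edge of the
  cyclically next colour. A circle without points of \<open>D\<close> bounds one face.
\<close>

definition edge_end :: "(piece \<times> 'a::linorder) set \<Rightarrow> piece \<times> 'a \<Rightarrow> piece \<times> 'a" where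
  "edge_end D x = cyclic_next snd {y\<in>D. fst y = fst x} x"

definition face_step ::
    "(piece \<times> 'a::linorder) set \<Rightarrow> 'a gluing \<Rightarrow> piece \<times> 'a \<Rightarrow> piece \<times> 'a" where
  "face_step D R x = cyclic_next colour (R `` {edge_end D x}) (edge_end D x)"

definition num_faces :: "piece set \<Rightarrow> (piece \<times> 'a::linorder) set \<Rightarrow> 'a gluing \<Rightarrow> nat" where
  "num_faces I D R = card (orbit (face_step D R) ` D) + card (I - fst ` D)"

text \<open>
  Euler's formula for the surface: the discs are the \<open>card I\<close> polygonal ones and the faces. A circle
  without points of \<open>D\<close> contributes 0 to the number of vertices minus the number of edges.
\<close>

definition has_genus :: "piece set \<Rightarrow> (piece \<times> 'a::linorder) set \<Rightarrow> 'a gluing \<Rightarrow> nat \<Rightarrow> bool" where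
  "has_genus I D R g \<longleftrightarrow>
     int (card (D // R)) - int (card D) + int (card I + num_faces I D R) = 2 - 2 * int g"


section \<open>Constellations\<close>

definition corners :: "piece set \<Rightarrow> (piece \<Rightarrow> nat) \<Rightarrow> (piece \<times> nat) set" where
  "corners I n = (SIGMA c:I. {..<n c})"

definition constellations ::
    "piece set \<Rightarrow> (piece \<Rightarrow> nat) \<Rightarrow> nat \<Rightarrow> nat \<Rightarrow> nat gluing set" where
  "constellations I n g p =
     {R. equiv (corners I n) R \<and> properly_coloured R \<and> connected_gluing I R \<and>
         has_genus I (corners I n) R g \<and> num_faces I (corners I n) R = p}"

text \<open>
  An isomorphism respecting the numbering of the polygons and their orientations rotates every
  polygon.
\<close>

definition rotate_corner :: "(piece \<Rightarrow> nat) \<Rightarrow> (piece \<Rightarrow> nat) \<Rightarrow> piece \<times> nat \<Rightarrow> piece \<times> nat" where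
  "rotate_corner n s = (\<lambda>(c, t). (c, (t + s c) mod n c))"

definition rotate_constellation ::
    "(piece \<Rightarrow> nat) \<Rightarrow> (piece \<Rightarrow> nat) \<Rightarrow> nat gluing \<Rightarrow> nat gluing" where
  "rotate_constellation n s R = map_prod (rotate_corner n s) (rotate_corner n s) ` R"

definition iso_class :: "(piece \<Rightarrow> nat) \<Rightarrow> nat gluing \<Rightarrow> nat gluing set" where
  "iso_class n R = range (\<lambda>s. rotate_constellation n s R)"

definition automorphisms :: "piece set \<Rightarrow> (piece \<Rightarrow> nat) \<Rightarrow> nat gluing \<Rightarrow> (piece \<Rightarrow> nat) set" where
  "automorphisms I n R = {s \<in> (\<Pi>\<^sub>E c\<in>I. {..<n c}). rotate_constellation n s R = R}"

text \<open>
  Isomorphism classes are counted with the weight \<open>1 / |Aut|\<close>. Although the polygons are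
  distinguishable, non-trivial automorphisms exist: two polygons with \<open>a\<close> and \<open>b\<close> sides glued at two
  vertices give \<open>(a - 1) * (b - 1) / 2\<close> with weights, while for \<open>a\<close>, \<open>b\<close> even the unweighted number
  is \<open>((a - 1) * (b - 1) + 1) / 2\<close>, so that the latter is not a polynomial.
\<close>

definition num_constellations :: "piece set \<Rightarrow> (piece \<Rightarrow> nat) \<Rightarrow> nat \<Rightarrow> nat \<Rightarrow> real" where
  "num_constellations I n g p =
     (\<Sum>X\<in>iso_class n ` constellations I n g p.
        1 / real (card (automorphisms I n (SOME R. R \<in> X))))"


section \<open>Circle constellations\<close>

definition circle_points :: "piece set \<Rightarrow> (piece \<Rightarrow> real) \<Rightarrow> (piece \<times> real) set" where
  "circle_points I l = (SIGMA c:I. {0..<l c})"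

definition gluing_points :: "'a gluing \<Rightarrow> (piece \<times> 'a) set" where
  "gluing_points R = {x. \<exists>y. y \<noteq> x \<and> (x, y) \<in> R}"

definition circle_constellations ::
    "piece set \<Rightarrow> (piece \<Rightarrow> real) \<Rightarrow> nat \<Rightarrow> nat \<Rightarrow> real gluing set" where
  "circle_constellations I l g p =
     {R. equiv (circle_points I l) R \<and> finite (gluing_points R) \<and>
         properly_coloured R \<and> connected_gluing I R \<and>
         (let D = gluing_points R; R' = R \<inter> D \<times> D
          in has_genus I D R' g \<and> num_faces I D R' = p)}"

definition rotate_point :: "(piece \<Rightarrow> real) \<Rightarrow> (piece \<Rightarrow> real) \<Rightarrow> piece \<times> real \<Rightarrow> piece \<times> real" where
  "rotate_point l s = (\<lambda>(c, t). (c, (t + s c) rmod l c))"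

definition circle_iso_class :: "(piece \<Rightarrow> real) \<Rightarrow> real gluing \<Rightarrow> real gluing set" where
  "circle_iso_class l R = range (\<lambda>s. map_prod (rotate_point l s) (rotate_point l s) ` R)"

definition circle_space ::
    "piece set \<Rightarrow> (piece \<Rightarrow> real) \<Rightarrow> nat \<Rightarrow> nat \<Rightarrow> real gluing set set" where
  "circle_space I l g p = circle_iso_class l ` circle_constellations I l g p"

text \<open>
  Charts of the locus where no three circles share a point. In the chart \<open>(r, S)\<close> the circle \<open>c\<close> is
  cut into \<open>r c\<close> arcs, numbered along the orientation from an arbitrarily chosen first one, and \<open>S\<close>
  matches their initial points in pairs. The coordinates are the lengths of all arcs but the last
  one of each circle.
\<close>

definition charts :: "piece set \<Rightarrow> ((piece \<Rightarrow> nat) \<times> nat gluing) set" where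
  "charts I =
     {(r, S). r \<in> (\<Pi>\<^sub>E c\<in>I. {1..}) \<and> equiv (corners I r) S \<and>
              (\<forall>x\<in>corners I r. card (S `` {x}) = 2)}"

definition arc_coords :: "piece set \<Rightarrow> (piece \<Rightarrow> nat) \<Rightarrow> (piece \<times> nat) set" where
  "arc_coords I r = (SIGMA c:I. {..<r c - 1})"

definition chart_domain ::
    "piece set \<Rightarrow> (piece \<Rightarrow> real) \<Rightarrow> (piece \<Rightarrow> nat) \<Rightarrow> (piece \<times> nat \<Rightarrow> real) set" where
  "chart_domain I l r =
     {a \<in> (\<Pi>\<^sub>E x\<in>arc_coords I r. {0<..}). \<forall>c\<in>I. (\<Sum>t<r c - 1. a (c, t)) < l c}"

definition arc_start :: "(piece \<times> nat \<Rightarrow> real) \<Rightarrow> piece \<times> nat \<Rightarrow> piece \<times> real" where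
  "arc_start a = (\<lambda>(c, t). (c, \<Sum>u<t. a (c, u)))"

definition chart_map ::
    "piece set \<Rightarrow> (piece \<Rightarrow> real) \<Rightarrow> nat gluing \<Rightarrow> (piece \<times> nat \<Rightarrow> real) \<Rightarrow> real gluing set" where
  "chart_map I l S a =
     circle_iso_class l (Id_on (circle_points I l) \<union> map_prod (arc_start a) (arc_start a) ` S)"

definition chart_fibre ::
    "piece set \<Rightarrow> (piece \<Rightarrow> real) \<Rightarrow> real gluing set \<Rightarrow>
     ((piece \<Rightarrow> nat) \<times> nat gluing \<times> (piece \<times> nat \<Rightarrow> real)) set" where
  "chart_fibre I l \<xi> =
     {(r, S, a). (r, S) \<in> charts I \<and> a \<in> chart_domain I l r \<and> chart_map I l S a = \<xi>}"

text \<open>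
  The volume of a set of isomorphism classes. The transition maps between charts permute the arc
  lengths of every circle cyclically, hence preserve Lebesgue measure; each class \<open>\<xi>\<close> is attained at
  the finitely many elements of \<open>chart_fibre I l \<xi>\<close>. Summing the Lebesgue measures of all charts,
  each point being weighted by the inverse number of its occurrences, therefore gives the measure
  that is Lebesgue measure in every chart and for which the locus not covered by charts is null.
\<close>

definition circle_volume :: "piece set \<Rightarrow> (piece \<Rightarrow> real) \<Rightarrow> real gluing set set \<Rightarrow> ennreal" where
  "circle_volume I l A =
     (\<integral>\<^sup>+ (r, S).
        (\<integral>\<^sup>+ a. (if a \<in> chart_domain I l r \<and> chart_map I l S a \<in> A
                then 1 / of_nat (card (chart_fibre I l (chart_map I l S a))) else 0)
         \<partial>PiM (arc_coords I r) (\<lambda>_. lborel))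
      \<partial>count_space (charts I))"

definition all_to_infinity :: "piece set \<Rightarrow> (piece \<Rightarrow> nat) filter" where
  "all_to_infinity I = (INF c\<in>I. filtercomap (\<lambda>n. n c) at_top)"

end

theory Submission
  imports
    Defs
    "HOL-Computational_Algebra.Polynomial"
    "HOL-Real_Asymp.Real_Asymp"
begin

text \<open>
  Only the points at which a piece is glued matter: a constellation, and likewise a circle
  constellation, is a choice of \<open>r c\<close> gluing points on every piece \<open>c\<close> together with a gluing pattern
  (a core) of these points without trivial classes. Points with a trivial class can be
  removed without changing genus and number of faces, so with \<open>A r\<close> the number of cores and after
  division by the group of rotations, the constellations are counted by
  \<open>P n = (\<Sum>r. A r * (\<Prod>c. (n c choose r c) / n c))\<close>. Euler's formula bounds \<open>\<Sum>c. r c\<close> by \<open>d + card I\<close>,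
  with equality iff all vertices are double points. For circles only these generic cores
  contribute. A chart is a product of open simplices, and almost every class is attained at exactly
  \<open>\<Prod>c. r c\<close> points of charts, so the volume is the sum of \<open>A r * (\<Prod>c. l c ^ (r c - 1) / fact (r c))\<close>
  over the generic \<open>r\<close>; this is the top degree part of \<open>P\<close>.

  The degree is attained because generic cores exist: a tree of pieces has one face and genus 0,
  and additional double points, each of which changes the number of cycles of the face permutation
  by one, add faces and handles. For the asymptotics, where the \<open>n c\<close> tend to infinity independently,
  one moreover needs that every non-generic core can be resolved into a generic one with at least as
  many gluing points on every piece, so that its contribution is dominated.
\<close>

section \<open>Cyclic successors\<close>

text \<open>The weights 1/|Aut| and the chart multiplicities are matching corrections. Orbit
  counting turns the weighted sum into the number of gluings over the product of the
  \<open>n c\<close>, and \<open>(x choose r) / x\<close> is a polynomial with leading term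
  \<open>x ^ (r - 1) / fact r\<close>. For circles a simplex has volume
  \<open>l ^ (r - 1) / fact (r - 1)\<close>, and the free choice of a first arc divides it by
  \<open>r\<close>. So leading terms and volumes agree summand by summand, and \<open>A r\<close>
  never has to be computed. Topology enters only through the face permutation, a product of the
  successors along pieces and around vertices: each modification of a gluing multiplies it by
  transpositions, which split or merge one cycle. Positions matter only up to cyclic order, so maps
  between point sets may have one wrap-around per piece. In independent limits a smaller degree does
  not make a term negligible: \<open>x ^ 2\<close> is not small against \<open>x * y * z\<close>
  when \<open>x\<close> grows faster than \<open>y * z\<close>. If only one colour occurs, nothing
  can be glued, and the single possible surface would need \<open>d = -1\<close>.\<close>

lemma cyclic_next_eq_iff:
  assumes "finite A" "inj_on f A" "x \<in> A"
  shows "cyclic_next f A x = y \<longleftrightarrow>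
    y \<in> A \<and> (if f x < f y then \<forall>z\<in>A. \<not> (f x < f z \<and> f z < f y)
             else \<forall>z\<in>A. f z \<le> f x \<and> f y \<le> f z)"
proof -
  define B where "B = (if \<exists>y\<in>A. f x < f y then {y\<in>A. f x < f y} else A)"
  define u where "u = cyclic_next f A x"
  have B: "finite B" "B \<noteq> {}" "B \<subseteq> A"
    using assms by (auto simp: B_def)
  have u: "u \<in> B" "\<And>z. z \<in> B \<Longrightarrow> f u \<le> f z"
    using arg_min_if_finite[OF B(1,2), of f] unfolding u_def cyclic_next_def B_def[symmetric]
    by (auto simp: not_less)
  \<comment> \<open>The else branch is the wrap-around: \<open>x\<close> has the largest value and
    \<open>u\<close> the smallest. It also covers a singleton \<open>A\<close>, where
    \<open>u = x\<close>.\<close>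
  have *: "u \<in> A \<and> (if f x < f u then \<forall>z\<in>A. \<not> (f x < f z \<and> f z < f u)
             else \<forall>z\<in>A. f z \<le> f x \<and> f u \<le> f z)"
    using u unfolding B_def by (force split: if_splits)
  show ?thesis
  proof
    show "cyclic_next f A x = y \<Longrightarrow> y \<in> A \<and> (if f x < f y then \<forall>z\<in>A. \<not> (f x < f z \<and> f z < f y)
             else \<forall>z\<in>A. f z \<le> f x \<and> f y \<le> f z)"
      using * unfolding u_def by blast
  next
    assume y: "y \<in> A \<and> (if f x < f y then \<forall>z\<in>A. \<not> (f x < f z \<and> f z < f y)
             else \<forall>z\<in>A. f z \<le> f x \<and> f y \<le> f z)"
    have "f u = f y"
      using y * assms(3) by (smt (verit) linorder_not_less order_antisym)
    with y * assms(2) show "cyclic_next f A x = y"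
      by (auto simp: u_def inj_on_def)
  qed
qed

lemma cyclic_next_in:
  assumes "finite A" "inj_on f A" "x \<in> A"
  shows "cyclic_next f A x \<in> A"
  using cyclic_next_eq_iff[OF assms] by blast

lemma cyclic_next_singleton [simp]: "cyclic_next f {x} x = x"
  by (subst cyclic_next_eq_iff) auto

text \<open>If two points share the successor \<open>u\<close>, then either the smaller one has the
  other strictly between itself and \<open>u\<close>, or both are maximal; in a mixed case
  \<open>u\<close> would be minimal and yet exceed one of them.\<close>

lemma bij_betw_cyclic_next:
  assumes "finite A" "inj_on f A"
  shows "bij_betw (cyclic_next f A) A A"
proof -
  have "inj_on (cyclic_next f A) A"
  proof (rule inj_onI)
    fix x y assume xy: "x \<in> A" "y \<in> A" "cyclic_next f A x = cyclic_next f A y"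
    define u where "u = cyclic_next f A y"
    have x: "u \<in> A \<and> (if f x < f u then \<forall>z\<in>A. \<not> (f x < f z \<and> f z < f u)
             else \<forall>z\<in>A. f z \<le> f x \<and> f u \<le> f z)"
      unfolding u_def by (rule iffD1[OF cyclic_next_eq_iff[OF assms xy(1)] xy(3)])
    have y: "u \<in> A \<and> (if f y < f u then \<forall>z\<in>A. \<not> (f y < f z \<and> f z < f u)
             else \<forall>z\<in>A. f z \<le> f y \<and> f u \<le> f z)"
      unfolding u_def by (rule iffD1[OF cyclic_next_eq_iff[OF assms xy(2)] refl])
    have "f x = f y"
      using x y xy by (smt (verit) linorder_not_less order_antisym order_le_less_trans not_less_iff_gr_or_eq)
    with assms(2) xy show "x = y" by (auto simp: inj_on_def)
  qed
  moreover have "cyclic_next f A ` A \<subseteq> A"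
    using cyclic_next_in[OF assms] by blast
  ultimately show ?thesis
    using assms(1) by (auto simp: bij_betw_def endo_inj_surj)
qed

text \<open>
  \<open>h\<close> respects the cyclic orders if it is increasing on an initial segment (the points outside
  \<open>W\<close>) and on the complementary final segment, and moves the latter before the former.
\<close>

lemma cyclic_next_image:
  assumes "finite A" "inj_on f A" "inj_on f' (h ` A)" "inj_on h A" "x \<in> A"
    and same: "\<And>x y. x \<in> A \<Longrightarrow> y \<in> A \<Longrightarrow> x \<in> W \<longleftrightarrow> y \<in> W \<Longrightarrow> f' (h x) < f' (h y) \<longleftrightarrow> f x < f y"
    and diff: "\<And>x y. x \<in> A \<Longrightarrow> y \<in> A \<Longrightarrow> x \<notin> W \<Longrightarrow> y \<in> W \<Longrightarrow> f x < f y \<and> f' (h y) < f' (h x)"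
  shows "cyclic_next f' (h ` A) (h x) = h (cyclic_next f A x)"
proof -
  define y where "y = cyclic_next f A x"
  have y: "y \<in> A \<and> (if f x < f y then \<forall>z\<in>A. \<not> (f x < f z \<and> f z < f y)
             else \<forall>z\<in>A. f z \<le> f x \<and> f y \<le> f z)"
    unfolding y_def by (rule iffD1[OF cyclic_next_eq_iff[OF assms(1,2,5)] refl])
  have lt: "f' (h a) < f' (h b) \<longleftrightarrow> (if a \<in> W \<longleftrightarrow> b \<in> W then f a < f b else a \<in> W)"
    if "a \<in> A" "b \<in> A" for a b
    using same[of a b] diff[of a b] diff[of b a] that by (auto dest: order_less_asym)
  have le: "f' (h a) \<le> f' (h b) \<longleftrightarrow> (if a \<in> W \<longleftrightarrow> b \<in> W then f a \<le> f b else a \<in> W)"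
    if "a \<in> A" "b \<in> A" for a b
    using lt[of b a] that by (auto simp flip: linorder_not_less)
  have lt': "f a < f b" if "a \<in> A" "b \<in> A" "a \<notin> W" "b \<in> W" for a b
    using diff that by auto
  have "h y \<in> h ` A \<and> (if f' (h x) < f' (h y) then \<forall>z\<in>h ` A. \<not> (f' (h x) < f' z \<and> f' z < f' (h y))
             else \<forall>z\<in>h ` A. f' z \<le> f' (h x) \<and> f' (h y) \<le> f' z)"
    using y \<open>x \<in> A\<close> lt'[of x y] lt'[of y x]
    by (cases "x \<in> W"; cases "y \<in> W"; cases "f x < f y")
       (auto simp: lt le not_less dest: lt' order_less_le_trans order_le_less_trans order_less_asym,
        (smt (verit, best) lt' not_less_iff_gr_or_eq order_less_le_trans order_le_less_trans leD leI)+)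
  then show ?thesis
    using assms by (subst cyclic_next_eq_iff) (auto simp: y_def)
qed

text \<open>A cycle is short-circuited at \<open>z\<close>. This serves twice: deleting a point from
  a piece changes \<open>edge_end\<close>, and detaching a point from a vertex changes
  \<open>node_next\<close>.\<close>

lemma cyclic_next_remove:
  assumes "finite A" "inj_on f A" "x \<in> A" "x \<noteq> z" "z \<in> A"
  shows "cyclic_next f (A - {z}) x =
    (if cyclic_next f A x = z then cyclic_next f A z else cyclic_next f A x)"
proof -
  define y where "y = cyclic_next f A x"
  define w where "w = cyclic_next f A z"
  have y: "y \<in> A \<and> (if f x < f y then \<forall>z\<in>A. \<not> (f x < f z \<and> f z < f y)
             else \<forall>z\<in>A. f z \<le> f x \<and> f y \<le> f z)"
    unfolding y_def by (rule iffD1[OF cyclic_next_eq_iff[OF assms(1,2,3)] refl])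
  have w: "w \<in> A \<and> (if f z < f w then \<forall>x\<in>A. \<not> (f z < f x \<and> f x < f w)
             else \<forall>x\<in>A. f x \<le> f z \<and> f w \<le> f x)"
    unfolding w_def by (rule iffD1[OF cyclic_next_eq_iff[OF assms(1,2,5)] refl])
  have ne: "f x \<noteq> f z" using assms by (auto dest: inj_onD)
  have inj: "\<And>u v. u \<in> A \<Longrightarrow> v \<in> A \<Longrightarrow> f u = f v \<Longrightarrow> u = v" using assms by (auto dest: inj_onD)
  have i: "inj_on f (A - {z})" using assms(2) by (auto simp: inj_on_def)
  show ?thesis
  proof (cases "y = z")
    case True
    have "w \<noteq> z"
      using w ne assms(3) by (auto split: if_splits)
    then have "cyclic_next f (A - {z}) x = w"
      using True y w ne i assms inj
      by (subst cyclic_next_eq_iff) (auto split: if_splits,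
        (smt (verit, best) not_less_iff_gr_or_eq order_less_le_trans order_le_less_trans leD leI)+)
    with True show ?thesis by (simp add: y_def w_def)
  next
    case False
    then have "cyclic_next f (A - {z}) x = y"
      using y i assms by (subst cyclic_next_eq_iff) (auto split: if_splits)
    with False show ?thesis by (simp add: y_def)
  qed
qed

section \<open>Orbits of permutations\<close>

lemma orbit_closed:
  assumes "x \<in> A" "\<And>y. y \<in> A \<Longrightarrow> f y \<in> A"
  shows "orbit f x \<subseteq> A"
proof
  fix y assume "y \<in> orbit f x"
  then show "y \<in> A" by induction (use assms in auto)
qed

text \<open>Face steps are controlled only on the carrier, while \<open>orbit\<close> refers to a
  function on the whole type; so functions that agree on an invariant set have to be exchanged
  explicitly.\<close>

lemma orbit_eq_of_eq_on:
  assumes "x \<in> A" "\<And>y. y \<in> A \<Longrightarrow> f y \<in> A" "\<And>y. y \<in> A \<Longrightarrow> f y = g y"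
  shows "orbit f x = orbit g x"
proof (intro equalityI subsetI)
  fix y assume "y \<in> orbit f x"
  then have "y \<in> A \<and> y \<in> orbit g x"
  proof induction
    case base
    have "g x \<in> orbit g x" by (rule orbit.base)
    then show ?case using assms by simp
  next
    case (step y)
    then have "g y \<in> orbit g x" by (blast intro: orbit.step)
    then show ?case using step assms by simp
  qed
  then show "y \<in> orbit g x" ..
next
  fix y assume "y \<in> orbit g x"
  then have "y \<in> A \<and> y \<in> orbit f x"
  proof induction
    case base
    have "f x \<in> orbit f x" by (rule orbit.base)
    then show ?case using assms by metis
  next
    case (step y)
    then have "f y \<in> orbit f x" by (blast intro: orbit.step)
    then show ?case using step assms by metis
  qed
  then show "y \<in> orbit f x" ..
qed

text \<open>Makes a bijection of \<open>D\<close> into a permutation that is the identity outside,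
  the form in which the library's facts on orbits apply.\<close>

lemma perm_restrict_permutes:
  assumes "bij_betw f D D"
  shows "perm_restrict f D permutes D"
proof -
  have "bij_betw (perm_restrict f D) D D"
    using assms by (rule bij_betw_cong[THEN iffD1, rotated]) (simp add: perm_restrict_def)
  then show ?thesis
    by (rule bij_imp_permutes) (simp add: perm_restrict_def)
qed

context
  fixes f :: "'a \<Rightarrow> 'a" and D
  assumes finite_D: "finite D" and bij_f: "bij_betw f D D"
begin

lemma bij_closed: "x \<in> D \<Longrightarrow> f x \<in> D"
  using bij_f by (auto simp: bij_betw_def)

lemma orbit_subset_carrier: "x \<in> D \<Longrightarrow> orbit f x \<subseteq> D"
  by (rule orbit_closed) (auto intro: bij_closed)

lemma orbit_perm_restrict: "x \<in> D \<Longrightarrow> orbit f x = orbit (perm_restrict f D) x"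
  by (rule orbit_eq_of_eq_on[where A = D]) (auto intro: bij_closed simp: perm_restrict_def)

lemma orbit_self: "x \<in> D \<Longrightarrow> x \<in> orbit f x"
  using perm_restrict_permutes[OF bij_f] finite_D
  by (auto simp: orbit_perm_restrict permutation_permutes intro!: permutation_self_in_orbit)

lemma orbit_eq: "x \<in> D \<Longrightarrow> y \<in> orbit f x \<Longrightarrow> orbit f y = orbit f x"
proof -
  assume x: "x \<in> D" and y: "y \<in> orbit f x"
  have yD: "y \<in> D" using orbit_subset_carrier[OF x] y by auto
  have "x \<in> orbit f y"
    using orbit_swap[OF orbit_self[OF x] y] .
  then show ?thesis
    using y by (blast intro: orbit_trans)
qed

end

section \<open>Cycles of a permutation multiplied by a transposition\<close>

lemma bij_betw_transpose_comp:
  assumes "bij_betw f D D" "a \<in> D" "b \<in> D" "\<And>x. x \<in> D \<Longrightarrow> g x = Transposition.transpose a b (f x)"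
  shows "bij_betw g D D"
proof -
  have "bij_betw (Transposition.transpose a b) D D"
    using assms by (metis permutes_imp_bij permutes_swap_id)
  from bij_betw_trans[OF assms(1) this] show ?thesis
    by (rule bij_betw_cong[THEN iffD1, rotated]) (simp add: assms(4))
qed

text \<open>Iterating \<open>g\<close> from \<open>a\<close> follows \<open>f\<close> until
  \<open>f\<close> is about to return to \<open>a\<close>; there the transposition diverts to
  \<open>b\<close>. Before that neither \<open>a\<close> nor \<open>b\<close> is met again, so the
  transposition has no effect.\<close>

lemma orbit_transpose_merge:
  assumes D: "finite D" "bij_betw f D D" "a \<in> D" "b \<in> D" "b \<notin> orbit f a"
    and g: "\<And>x. x \<in> D \<Longrightarrow> g x = Transposition.transpose a b (f x)"
  shows "orbit f a \<subseteq> orbit g a" "b \<in> orbit g a"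
proof -
  \<comment> \<open>\<open>j\<close> is the length of the cycle of \<open>f\<close> through
    \<open>a\<close>.\<close>
  define j where "j = funpow_dist1 f a a"
  have aa: "a \<in> orbit f a" using orbit_self[OF D(1-3)] .
  have j: "(f ^^ j) a = a" "0 < j"
    using funpow_dist1_prop[OF aa] by (auto simp: j_def)
  have less: "(f ^^ i) a \<noteq> a" if "0 < i" "i < j" for i
    using funpow_dist1_least[of i f a a] that by (simp add: j_def)
  have inD: "(f ^^ i) a \<in> D" for i
    by (induction i) (use D bij_closed[OF D(1,2)] in auto)
  have nb: "(f ^^ i) a \<noteq> b" for i
    using D(5) aa funpow_in_orbit[of a f a i] by auto
  have eq: "(g ^^ i) a = (f ^^ i) a" if "i < j" for i
    using that
  proof (induction i)
    case (Suc i)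
    then have "(g ^^ Suc i) a = Transposition.transpose a b ((f ^^ Suc i) a)"
      using g[OF inD[of i]] by simp
    also have "\<dots> = (f ^^ Suc i) a"
      using less[of "Suc i"] nb[of "Suc i"] Suc.prems by (intro transpose_apply_other) auto
    finally show ?case .
  qed simp
  obtain j' where j': "j = Suc j'" using j by (cases j) auto
  have gj: "(g ^^ j) a = b"
    using eq[of j'] g[OF inD[of j']] j j' by simp
  then show b: "b \<in> orbit g a"
    using j unfolding orbit_altdef by blast
  show "orbit f a \<subseteq> orbit g a"
  proof
    fix y assume "y \<in> orbit f a"
    then obtain i where i: "i < j" "y = (f ^^ i) a"
      using orbit_conv_funpow_dist1[OF aa] by (auto simp: j_def)
    show "y \<in> orbit g a"
    proof (cases "i = 0")
      case False
      then show ?thesis using i eq[of i] unfolding orbit_altdef by (metis (mono_tags, lifting) mem_Collect_eq neq0_conv)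
    next
      case True
      have "bij_betw g D D" using bij_betw_transpose_comp[OF D(2-4) g] .
      then have "a \<in> orbit g a" using orbit_self[OF D(1) _ D(3)] by blast
      then show ?thesis using True i by simp
    qed
  qed
qed

text \<open>The cycles through \<open>a\<close> and \<open>b\<close> fuse into \<open>U\<close>.
  Every other cycle avoids both points and hence is the same for \<open>f\<close> and
  \<open>g\<close>.\<close>

lemma card_orbits_transpose_merge:
  assumes D: "finite D" "bij_betw f D D" "a \<in> D" "b \<in> D" "b \<notin> orbit f a"
    and g: "\<And>x. x \<in> D \<Longrightarrow> g x = Transposition.transpose a b (f x)"
  shows "card (orbit f ` D) = card (orbit g ` D) + 1"
proof -
  note bg = bij_betw_transpose_comp[OF D(2-4) g]
  define U where "U = orbit f a \<union> orbit f b"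
  have self: "x \<in> orbit f x" if "x \<in> D" for x using orbit_self[OF D(1,2) that] .
  have ab: "a \<notin> orbit f b"
    using orbit_eq[OF D(1,2,4), of a] self[OF D(4)] D(5) by auto
  have 1: "orbit f a \<subseteq> orbit g a" "b \<in> orbit g a"
    using orbit_transpose_merge[OF D g] by auto
  have 2: "orbit f b \<subseteq> orbit g b"
    using orbit_transpose_merge(1)[OF D(1,2,4,3) ab, of g] g by (simp add: transpose_commute)
  have gb: "orbit g b = orbit g a"
    using orbit_eq[OF D(1) bg D(3) 1(2)] .
  have step: "f x \<in> orbit f y" if "x \<in> orbit f y" for x y using that by (rule orbit.step)
  have closed: "g x \<in> U" if "x \<in> U" for x
  proof -
    have "x \<in> D" using that orbit_subset_carrier[OF D(1,2)] D(3,4) by (auto simp: U_def)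
    moreover have "f x \<in> U" "a \<in> U" "b \<in> U" using that step self D by (auto simp: U_def)
    ultimately show ?thesis using g by (auto simp: Transposition.transpose_def)
  qed
  have Uga: "orbit g a = U"
  proof
    show "orbit g a \<subseteq> U" using closed self D by (intro orbit_closed) (auto simp: U_def)
  qed (use 1 2 gb in \<open>auto simp: U_def\<close>)
  have inU: "orbit g x = U" if "x \<in> U" for x
    using orbit_eq[OF D(1) bg D(3), of x] that Uga by simp
  have outU: "orbit g x = orbit f x" if "x \<in> D" "x \<notin> U" for x
  proof (rule orbit_eq_of_eq_on[where A = "orbit f x", symmetric])
    fix y assume y: "y \<in> orbit f x"
    then show "f y \<in> orbit f x" by (rule step)
    have "y \<in> D" using y that orbit_subset_carrier[OF D(1,2)] by auto
    have "f y \<in> orbit f x" using y by (rule step)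
    moreover have "a \<notin> orbit f x" "b \<notin> orbit f x"
      using that(2) orbit_eq[OF D(1,2) that(1), of a] orbit_eq[OF D(1,2) that(1), of b] self[OF that(1)]
      unfolding U_def by blast+
    ultimately have "f y \<noteq> a" "f y \<noteq> b" by auto
    then show "f y = g y" using g[OF \<open>y \<in> D\<close>] by simp
  qed (use that self in auto)
  let ?O = "orbit f ` D"
  have neq: "orbit f a \<noteq> orbit f b" using D(5) self D by auto
  have O: "orbit g ` D = insert U (?O - {orbit f a, orbit f b})"
  proof (intro equalityI subsetI)
    fix X assume "X \<in> orbit g ` D"
    then obtain x where x: "x \<in> D" "X = orbit g x" by auto
    show "X \<in> insert U (?O - {orbit f a, orbit f b})"
    proof (cases "x \<in> U")
      case False
      then have "orbit f x \<noteq> orbit f a" "orbit f x \<noteq> orbit f b"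
        using self x by (auto simp: U_def)
      then show ?thesis using x False outU by auto
    qed (use inU x in auto)
  next
    fix X assume "X \<in> insert U (?O - {orbit f a, orbit f b})"
    then consider "X = U" | x where "x \<in> D" "X = orbit f x" "X \<noteq> orbit f a" "X \<noteq> orbit f b"
      by auto
    then show "X \<in> orbit g ` D"
    proof cases
      case 1
      then show ?thesis using Uga D by auto
    next
      case 2
      then have "x \<notin> U" using orbit_eq[OF D(1-3)] orbit_eq[OF D(1,2,4)] unfolding U_def by blast
      then show ?thesis using outU[of x] 2 by (metis imageI)
    qed
  qed
  have "U \<notin> ?O - {orbit f a, orbit f b}"
  proof
    assume "U \<in> ?O - {orbit f a, orbit f b}"
    then obtain x where "x \<in> D" "U = orbit f x" "U \<noteq> orbit f a" by auto
    moreover have "a \<in> U" using self D by (auto simp: U_def)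
    ultimately show False using orbit_eq[OF D(1,2), of x a] by auto
  qed
  then have "card (orbit g ` D) = Suc (card (?O - {orbit f a, orbit f b}))"
    unfolding O using D(1) by (subst card_insert_disjoint) auto
  also have "card (?O - {orbit f a, orbit f b}) = card ?O - 2"
    using neq D by (subst card_Diff_subset) auto
  also have "card ?O \<ge> card {orbit f a, orbit f b}"
    using D by (intro card_mono) auto
  then have "card ?O \<ge> 2" using neq by simp
  ultimately show ?thesis by simp
qed

text \<open>\<open>g\<close> follows \<open>f\<close> from \<open>a\<close> until \<open>f\<close>
  would hit \<open>b\<close> for the first time, after \<open>j\<close> steps, and is then sent back
  to \<open>a\<close>. So the orbit of \<open>g\<close> stays among \<open>a\<close> and the next
  \<open>j - 1\<close> iterates, none of which is \<open>b\<close>.\<close>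

lemma orbit_transpose_split:
  assumes D: "finite D" "bij_betw f D D" "a \<in> D" "b \<in> orbit f a" "a \<noteq> b"
    and g: "\<And>x. x \<in> D \<Longrightarrow> g x = Transposition.transpose a b (f x)"
  shows "b \<notin> orbit g a"
proof -
  define j where "j = funpow_dist1 f a b"
  have j: "(f ^^ j) a = b" "0 < j"
    using funpow_dist1_prop[OF D(4)] by (auto simp: j_def)
  have less: "(f ^^ i) a \<noteq> b" if "i < j" for i
    using funpow_dist1_least[of i f a b] that D(5) by (cases "i = 0") (auto simp: j_def)
  have inD: "(f ^^ i) a \<in> D" for i
    by (induction i) (use D bij_closed[OF D(1,2)] in auto)
  have na: "(f ^^ i) a \<noteq> a" if "0 < i" "i < j" for i
  proof
    assume "(f ^^ i) a = a"
    moreover have "(f ^^ ((j - i) + i)) a = (f ^^ (j - i)) ((f ^^ i) a)"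
      by (simp only: funpow_add comp_apply)
    ultimately have "(f ^^ (j - i)) a = b" using j that by simp
    with less[of "j - i"] that show False by simp
  qed
  have "orbit g a \<subseteq> (\<lambda>i. (f ^^ i) a) ` {..<j}"
  proof (rule orbit_closed)
    show "a \<in> (\<lambda>i. (f ^^ i) a) ` {..<j}" using j by (intro image_eqI[of _ _ 0]) auto
    fix y assume "y \<in> (\<lambda>i. (f ^^ i) a) ` {..<j}"
    then obtain i where i: "y = (f ^^ i) a" "i < j" by auto
    have gy: "g y = Transposition.transpose a b ((f ^^ Suc i) a)" using g[OF inD[of i]] i by simp
    show "g y \<in> (\<lambda>i. (f ^^ i) a) ` {..<j}"
    proof (cases "Suc i = j")
      case True
      then have "g y = a" using gy j by simp
      then show ?thesis using j by (intro image_eqI[of _ _ 0]) auto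
    next
      case False
      then have "g y = (f ^^ Suc i) a"
        using gy less[of "Suc i"] na[of "Suc i"] i by (metis Suc_lessI transpose_apply_other zero_less_Suc)
      then show ?thesis using i False by (intro image_eqI[of _ _ "Suc i"]) auto
    qed
  qed
  then show ?thesis using less by force
qed

text \<open>A transposition is an involution, so \<open>f\<close> arises from \<open>g\<close> by
  the same transposition, and splitting is merging read backwards.\<close>

lemma card_orbits_transpose_split:
  assumes D: "finite D" "bij_betw f D D" "a \<in> D" "b \<in> D" "b \<in> orbit f a" "a \<noteq> b"
    and g: "\<And>x. x \<in> D \<Longrightarrow> g x = Transposition.transpose a b (f x)"
  shows "card (orbit g ` D) = card (orbit f ` D) + 1"
proof (rule card_orbits_transpose_merge)
  show "bij_betw g D D" using bij_betw_transpose_comp[OF D(2-4) g] .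
  show "b \<notin> orbit g a" using orbit_transpose_split[OF D(1-3,5,6) g] .
qed (use D g in auto)

lemma orbit_image:
  assumes "x \<in> D" "\<And>y. y \<in> D \<Longrightarrow> f y \<in> D" "\<And>y. y \<in> D \<Longrightarrow> g (h y) = h (f y)"
  shows "orbit g (h x) = h ` orbit f x"
proof (intro equalityI subsetI)
  fix y assume "y \<in> orbit g (h x)"
  then show "y \<in> h ` orbit f x"
  proof induction
    case base
    then show ?case using assms by (auto intro!: imageI orbit.base)
  next
    case (step y)
    then obtain z where "z \<in> orbit f x" "y = h z" by auto
    moreover have "z \<in> D" using calculation(1) by induction (use assms in auto)
    ultimately show ?case using assms by (auto intro!: imageI orbit.step)
  qed
next
  fix y assume "y \<in> h ` orbit f x"
  then obtain z where z: "z \<in> orbit f x" "y = h z" by auto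
  from z(1) have "z \<in> D \<and> h z \<in> orbit g (h x)"
  proof induction
    case base
    then show ?case using assms orbit.base[of g "h x"] by simp
  next
    case (step y)
    then show ?case using assms orbit.step[of "h y" g "h x"] by simp
  qed
  with z show "y \<in> orbit g (h x)" by simp
qed

text \<open>\<open>h\<close> conjugates the two maps, but only on \<open>D\<close>; since all orbits
  lie in \<open>D\<close>, injectivity there suffices to keep their images distinct.\<close>

lemma card_orbits_image:
  assumes "inj_on h D" "\<And>y. y \<in> D \<Longrightarrow> f y \<in> D" "\<And>y. y \<in> D \<Longrightarrow> g (h y) = h (f y)"
  shows "card (orbit g ` (h ` D)) = card (orbit f ` D)"
proof -
  have "orbit g ` (h ` D) = (`) h ` (orbit f ` D)"
    using orbit_image[where D = D and f = f and g = g and h = h] assms(2,3) by (auto simp: image_image)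
  moreover have "inj_on ((`) h) (orbit f ` D)"
    using orbit_closed[of _ D f] assms
    by (intro inj_on_subset[OF inj_on_image_Pow[OF assms(1)]]) blast
  ultimately show ?thesis by (simp add: card_image)
qed

section \<open>Edges, nodes and faces of a gluing\<close>

declare split_paired_All [simp del] split_paired_Ex [simp del]

text \<open>Collects the local conditions under which the face step is a permutation of
  \<open>D\<close>; connectedness, genus and number of faces are imposed separately.\<close>

definition coloured_gluing :: "(piece \<times> 'a) set \<Rightarrow> 'a gluing \<Rightarrow> bool" where
  "coloured_gluing D R \<longleftrightarrow> finite D \<and> equiv D R \<and> properly_coloured R"

text \<open>The rotation about a vertex. With it the face step becomes a product of two
  permutations, \<open>node_next R\<close> after \<open>edge_end D\<close>, and changes of the
  points and of the gluing can be treated separately.\<close>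

definition node_next :: "'a gluing \<Rightarrow> piece \<times> 'a \<Rightarrow> piece \<times> 'a" where
  "node_next R x = cyclic_next colour (R `` {x}) x"

lemma face_step_node_next: "face_step D R x = node_next R (edge_end D x)"
  by (simp add: face_step_def node_next_def)

lemma gluing_equivD:
  assumes "equiv D R"
  shows "R \<subseteq> D \<times> D" "\<And>x. x \<in> D \<Longrightarrow> (x, x) \<in> R" "\<And>x y. (x, y) \<in> R \<Longrightarrow> (y, x) \<in> R"
    "\<And>x y z. (x, y) \<in> R \<Longrightarrow> (y, z) \<in> R \<Longrightarrow> (x, z) \<in> R"
  using assms by (auto simp: equiv_def refl_on_def dest: symD transD)

lemma inj_on_snd_piece [simp]: "inj_on snd {y \<in> D. fst y = c}"
  by (auto simp: inj_on_def prod_eq_iff)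

lemma edge_end_in:
  assumes "finite D" "x \<in> D"
  shows "edge_end D x \<in> D" "fst (edge_end D x) = fst x"
  using cyclic_next_in[of "{y \<in> D. fst y = fst x}" snd x] assms
  unfolding edge_end_def by auto

lemma edge_end_bij:
  assumes "finite D"
  shows "bij_betw (edge_end D) D D"
proof -
  have "inj_on (edge_end D) D"
  proof (rule inj_onI)
    fix x y assume xy: "x \<in> D" "y \<in> D" "edge_end D x = edge_end D y"
    have "fst x = fst y"
      using edge_end_in(2)[OF assms] xy by metis
    moreover have "inj_on (cyclic_next snd {y \<in> D. fst y = fst x}) {y \<in> D. fst y = fst x}"
      using bij_betw_cyclic_next[of "{y \<in> D. fst y = fst x}" snd] assms
      by (auto simp: bij_betw_def)
    ultimately show "x = y"
      using xy by (auto simp: edge_end_def dest: inj_onD)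
  qed
  then show ?thesis
    using assms edge_end_in(1)[OF assms] by (intro bij_betw_imageI endo_inj_surj) blast+
qed

lemma edge_end_remove:
  assumes "finite D" "x \<in> D" "z \<in> D" "x \<noteq> z"
  shows "edge_end (D - {z}) x = (if edge_end D x = z then edge_end D z else edge_end D x)"
proof (cases "fst x = fst z")
  case True
  have "{y \<in> D - {z}. fst y = fst x} = {y \<in> D. fst y = fst x} - {z}" by auto
  then show ?thesis
    using cyclic_next_remove[of "{y \<in> D. fst y = fst x}" snd x z] assms True
    unfolding edge_end_def by simp
next
  case False
  then have "{y \<in> D - {z}. fst y = fst x} = {y \<in> D. fst y = fst x}" by auto
  moreover have "edge_end D x \<noteq> z" using edge_end_in[OF assms(1,2)] False by auto
  ultimately show ?thesis by (simp add: edge_end_def)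
qed

text \<open>An edge is a loop exactly when its point is the only one on its piece. Removing such a
  point leaves an uncut piece, which \<open>num_faces\<close> counts in a separate summand.\<close>

lemma edge_end_eq_self_iff:
  assumes "finite D" "z \<in> D"
  shows "edge_end D z = z \<longleftrightarrow> (\<forall>y\<in>D. fst y = fst z \<longrightarrow> y = z)"
proof -
  have "edge_end D z = z \<longleftrightarrow> (\<forall>y\<in>D. fst y = fst z \<longrightarrow> snd y \<le> snd z \<and> snd z \<le> snd y)"
    using assms cyclic_next_eq_iff[of "{y \<in> D. fst y = fst z}" snd z z] unfolding edge_end_def
    by (simp add: Ball_def imp_conjL)
  also have "\<dots> \<longleftrightarrow> (\<forall>y\<in>D. fst y = fst z \<longrightarrow> y = z)"
    by (intro ball_cong refl) (metis order_antisym order_refl prod_eqI)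
  finally show ?thesis .
qed

text \<open>All points of a class are related to each other, so proper colouring makes
  \<open>colour\<close> injective on it. This is what the cyclic successor by colour
  requires.\<close>

lemma class_props:
  assumes "coloured_gluing D R"
  shows "finite (R `` {x})" "inj_on colour (R `` {x})" "x \<in> D \<Longrightarrow> x \<in> R `` {x}" "R `` {x} \<subseteq> D"
proof -
  have e: "equiv D R" and fin: "finite D" and p: "properly_coloured R"
    using assms by (auto simp: coloured_gluing_def)
  have sub: "R \<subseteq> D \<times> D" using gluing_equivD(1)[OF e] .
  then show "R `` {x} \<subseteq> D" by auto
  then show "finite (R `` {x})" using fin finite_subset by blast
  show "inj_on colour (R `` {x})"
  proof (rule inj_onI)
    fix y z assume "y \<in> R `` {x}" "z \<in> R `` {x}" "colour y = colour z"
    moreover have "(y, z) \<in> R"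
      using calculation e by (meson Image_singleton_iff equivE symE transE)
    ultimately show "y = z" using p by (auto simp: properly_coloured_def)
  qed
  show "x \<in> D \<Longrightarrow> x \<in> R `` {x}" using gluing_equivD(2)[OF e] by blast
qed

lemma node_next_in:
  assumes "coloured_gluing D R" "x \<in> D"
  shows "(x, node_next R x) \<in> R" "node_next R x \<in> D"
  using cyclic_next_in[OF class_props(1-3)[OF assms(1), of x]] class_props(4)[OF assms(1), of x] assms(2)
  unfolding node_next_def by auto

lemma node_next_bij:
  assumes "coloured_gluing D R"
  shows "bij_betw (node_next R) D D"
proof -
  have e: "equiv D R" and fin: "finite D"
    using assms by (auto simp: coloured_gluing_def)
  have "inj_on (node_next R) D"
  proof (rule inj_onI)
    fix x y assume xy: "x \<in> D" "y \<in> D" "node_next R x = node_next R y"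
    then have "(x, y) \<in> R"
      using node_next_in[OF assms] e by (metis equivE symE transE)
    then have cl: "R `` {x} = R `` {y}" using e by (simp add: equiv_class_eq)
    have "inj_on (cyclic_next colour (R `` {x})) (R `` {x})"
      using bij_betw_cyclic_next[OF class_props(1,2)[OF assms, of x]] by (auto simp: bij_betw_def)
    then show "x = y"
      using xy cl class_props(3)[OF assms] by (metis inj_onD node_next_def)
  qed
  then show ?thesis
    using fin node_next_in(2)[OF assms] by (intro bij_betw_imageI endo_inj_surj) blast+
qed

lemma face_step_bij:
  assumes "coloured_gluing D R"
  shows "bij_betw (face_step D R) D D"
proof -
  have "bij_betw (node_next R \<circ> edge_end D) D D"
    using assms by (intro bij_betw_trans[OF edge_end_bij node_next_bij]) (auto simp: coloured_gluing_def)
  then show ?thesis by (simp add: comp_def face_step_node_next[abs_def])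
qed

lemma card_orbits_fixed_point:
  assumes "finite D" "bij_betw q D D" "z \<in> D" "q z = z"
  shows "card (orbit q ` D) = card (orbit q ` (D - {z})) + 1"
proof -
  have z: "orbit q z = {z}" using assms by (simp add: orbit_eq_singleton_iff)
  have "{z} \<notin> orbit q ` (D - {z})"
  proof
    assume "{z} \<in> orbit q ` (D - {z})"
    then obtain x where "x \<in> D" "x \<noteq> z" "orbit q x = {z}" by auto
    with orbit_self[OF assms(1,2), of x] show False by auto
  qed
  moreover have "orbit q ` D = insert {z} (orbit q ` (D - {z}))" using z assms(3) by (auto simp: image_iff)
  ultimately show ?thesis using assms(1) by simp
qed

section \<open>Deleting points with a trivial class\<close>

lemma coloured_gluing_remove:
  assumes "coloured_gluing D R" "z \<in> D" "R `` {z} = {z}"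
  shows "coloured_gluing (D - {z}) (R - {(z, z)})"
    and "x \<noteq> z \<Longrightarrow> (R - {(z, z)}) `` {x} = R `` {x}"
proof -
  have e: "equiv D R" and fin: "finite D" and p: "properly_coloured R"
    using assms by (auto simp: coloured_gluing_def)
  have zz: "(z, y) \<in> R \<longleftrightarrow> y = z" "(y, z) \<in> R \<longleftrightarrow> y = z" for y
    using assms(3) gluing_equivD(3)[OF e] by blast+
  have "equiv (D - {z}) (R - {(z, z)})"
  proof (intro equivI refl_onI symI transI)
    show "R - {(z, z)} \<subseteq> (D - {z}) \<times> (D - {z})"
      using gluing_equivD(1)[OF e] zz by blast
    show "(x, x) \<in> R - {(z, z)}" if "x \<in> D - {z}" for x
      using gluing_equivD(2)[OF e] that by blast
    show "(y, x) \<in> R - {(z, z)}" if "(x, y) \<in> R - {(z, z)}" for x y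
      using gluing_equivD(3)[OF e] that by blast
    show "(x, v) \<in> R - {(z, z)}" if "(x, y) \<in> R - {(z, z)}" "(y, v) \<in> R - {(z, z)}" for x y v
      using gluing_equivD(4)[OF e] that zz by blast
  qed
  then show "coloured_gluing (D - {z}) (R - {(z, z)})"
    using fin p by (auto simp: coloured_gluing_def properly_coloured_def)
  show "x \<noteq> z \<Longrightarrow> (R - {(z, z)}) `` {x} = R `` {x}" by auto
qed

text \<open>If \<open>z\<close> is alone on its piece, it is a fixed point of the face step, and the
  lost cycle reappears as an uncut piece. Otherwise the face merely passes through \<open>z\<close>,
  and the cycle survives without it.\<close>

lemma num_faces_remove:
  assumes R: "coloured_gluing D R" and I: "finite I" "fst ` D \<subseteq> I" and z: "z \<in> D" "R `` {z} = {z}"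
  shows "num_faces I (D - {z}) (R - {(z, z)}) = num_faces I D R"
proof -
  define D' where "D' = D - {z}"
  define R' where "R' = R - {(z, z)}"
  let ?f = "face_step D R" and ?f' = "face_step D' R'"
  have fin: "finite D" "finite D'" using R by (auto simp: coloured_gluing_def D'_def)
  have R': "coloured_gluing D' R'" "\<And>x. x \<noteq> z \<Longrightarrow> R' `` {x} = R `` {x}"
    using coloured_gluing_remove[OF R z] by (auto simp: D'_def R'_def)
  have nz: "node_next R z = z" by (simp add: node_next_def z)
  have nn: "node_next R' x = node_next R x" if "x \<noteq> z" for x
    using R'(2)[OF that] by (simp add: node_next_def)
  have nnz: "node_next R x = z \<longleftrightarrow> x = z" if "x \<in> D" for x
    using node_next_bij[OF R] nz z(1) that by (metis bij_betw_inv_into_left)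
  have ee: "edge_end D' x = (if edge_end D x = z then edge_end D z else edge_end D x)" if "x \<in> D'" for x
    using edge_end_remove[OF fin(1), of x z] that z by (auto simp: D'_def)
  have eD: "edge_end D x \<in> D" if "x \<in> D" for x using edge_end_in[OF fin(1) that] by simp
  note bf = face_step_bij[OF R]
  have bf': "bij_betw ?f' D' D'" using face_step_bij[OF R'(1)] .
  have f'D: "?f' x \<in> D'" if "x \<in> D'" for x using bf' that by (auto simp: bij_betw_def)
  show ?thesis
  proof (cases "edge_end D z = z")
    case True
    have eq: "?f' x = ?f x" if "x \<in> D'" for x
    proof -
      have "edge_end D x \<noteq> z"
        using True edge_end_bij[OF fin(1)] that z(1) by (auto simp: D'_def bij_betw_def dest: inj_onD)
      then show ?thesis using ee[OF that] nn by (simp add: face_step_node_next)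
    qed
    have "card (orbit ?f ` D) = card (orbit ?f ` D') + 1"
      using card_orbits_fixed_point[OF fin(1) bf z(1)] True nz by (simp add: face_step_node_next D'_def)
    moreover have "orbit ?f ` D' = orbit ?f' ` D'"
    proof (rule image_cong[OF refl])
      fix x assume x: "x \<in> D'"
      show "orbit ?f x = orbit ?f' x"
        by (rule orbit_eq_of_eq_on[OF x, symmetric]) (erule f'D, erule eq)
    qed
    moreover have "card (I - fst ` D') = card (I - fst ` D) + 1"
    proof -
      have "fst z \<notin> fst ` D'"
        using True edge_end_eq_self_iff[OF fin(1) z(1)] by (auto simp: D'_def image_iff prod_eq_iff)
      then have "I - fst ` D' = insert (fst z) (I - fst ` D)"
      proof -
        have "fst ` D = insert (fst z) (fst ` D')" using z(1) unfolding D'_def by blast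
        moreover have "fst z \<in> I" using I(2) z(1) by blast
        moreover have "I - A = insert c (I - insert c A)" if "c \<notin> A" "c \<in> I" for A c using that by auto
        ultimately show ?thesis using \<open>fst z \<notin> fst ` D'\<close> by metis
      qed
      moreover have "fst z \<notin> I - fst ` D" using z(1) by auto
      ultimately show ?thesis using I(1) by simp
    qed
    ultimately show ?thesis by (simp add: num_faces_def D'_def R'_def)
  next
    case False
    then have fz: "?f z \<noteq> z" "?f z \<in> D"
      using nnz[OF eD[OF z(1)]] bf z by (auto simp: face_step_node_next bij_betw_def)
    \<comment> \<open>The transposition makes \<open>z\<close> a fixed point and short-circuits its
      cycle. As \<open>z\<close> and its image lie on one cycle, this gains a cycle, which is lost
      again when the fixed point \<open>z\<close> is dropped.\<close>
    define q where "q = Transposition.transpose z (?f z) \<circ> ?f"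
    have qf': "q x = ?f' x" if "x \<in> D'" for x
    proof (cases "edge_end D x = z")
      case True
      then show ?thesis using ee[OF that] nn[OF False] nz
        by (simp add: q_def face_step_node_next)
    next
      case ne: False
      have "x \<in> D" "x \<noteq> z" using that by (auto simp: D'_def)
      then have "?f x \<noteq> z" "?f x \<noteq> ?f z"
        using nnz[OF eD[of x]] ne inj_onD[OF bij_betw_imp_inj_on[OF bf], of x z] z(1)
        unfolding face_step_node_next by blast+
      then show ?thesis using ee[OF that] nn[OF ne] ne
        by (simp add: q_def face_step_node_next)
    qed
    have qb: "bij_betw q D D"
      using bij_betw_transpose_comp[OF bf z(1) fz(2), of q] by (simp add: q_def)
    have "card (orbit q ` D) = card (orbit ?f ` D) + 1"
      using fz z(1) by (intro card_orbits_transpose_split[OF fin(1) bf z(1) fz(2)]) (auto simp: q_def intro: orbit.base)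
    moreover have "card (orbit q ` D) = card (orbit q ` D') + 1"
      using card_orbits_fixed_point[OF fin(1) qb z(1)] by (simp add: q_def D'_def)
    moreover have "orbit q ` D' = orbit ?f' ` D'"
    proof (rule image_cong[OF refl])
      fix x assume x: "x \<in> D'"
      show "orbit q x = orbit ?f' x"
        by (rule orbit_eq_of_eq_on[OF x, symmetric]) (erule f'D, erule qf'[symmetric])
    qed
    moreover have "fst ` D' = fst ` D"
    proof -
      obtain y where "y \<in> D" "fst y = fst z" "y \<noteq> z"
        using False edge_end_eq_self_iff[OF fin(1) z(1)] by metis
      then have "y \<in> D'" "fst z = fst y" unfolding D'_def by auto
      then have "fst z \<in> fst ` D'" by blast
      moreover have "fst ` D = insert (fst z) (fst ` D')" using z(1) unfolding D'_def by blast
      ultimately show ?thesis by (simp add: insert_absorb)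
    qed
    ultimately show ?thesis by (simp add: num_faces_def D'_def R'_def)
  qed
qed

lemma quotient_remove:
  assumes R: "coloured_gluing D R" and z: "z \<in> D" "R `` {z} = {z}"
  shows "card (D // R) = card ((D - {z}) // (R - {(z, z)})) + 1"
proof -
  have "D // R = insert {z} ((D - {z}) // (R - {(z, z)}))"
  proof -
    have "D // R = insert (R `` {z}) ((\<lambda>x. R `` {x}) ` (D - {z}))"
      using z(1) by (auto simp: quotient_def)
    also have "(\<lambda>x. R `` {x}) ` (D - {z}) = (\<lambda>x. (R - {(z, z)}) `` {x}) ` (D - {z})"
      using coloured_gluing_remove(2)[OF R z] by (intro image_cong) auto
    finally show ?thesis using z(2) by (simp add: quotient_def UNION_singleton_eq_range)
  qed
  moreover have "{z} \<notin> (D - {z}) // (R - {(z, z)})"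
    using in_quotient_imp_subset[of "D - {z}" "R - {(z, z)}" "{z}"] coloured_gluing_remove(1)[OF R z]
    by (auto simp: coloured_gluing_def)
  moreover have "finite ((D - {z}) // (R - {(z, z)}))"
    using coloured_gluing_remove(1)[OF R z] by (auto simp: coloured_gluing_def intro!: finite_quotient gluing_equivD(1))
  ultimately show ?thesis by simp
qed

lemma gluing_points_iff:
  assumes "equiv D R" "x \<in> D"
  shows "x \<in> gluing_points R \<longleftrightarrow> R `` {x} \<noteq> {x}"
  using gluing_equivD(2)[OF assms] unfolding gluing_points_def by blast

text \<open>Trivial points are deleted one by one. Each deletion lowers the numbers of vertices and
  edges by one and keeps the faces, so Euler's formula is unaffected.\<close>

lemma num_faces_core:
  assumes "coloured_gluing D R" and "finite I" "fst ` D \<subseteq> I"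
  defines "G \<equiv> gluing_points R"
  shows "num_faces I D R = num_faces I G (R \<inter> G \<times> G)"
    and "has_genus I D R g \<longleftrightarrow> has_genus I G (R \<inter> G \<times> G) g"
proof -
  have "num_faces I D R = num_faces I G (R \<inter> G \<times> G) \<and>
     (has_genus I D R g \<longleftrightarrow> has_genus I G (R \<inter> G \<times> G) g)"
    using assms(1-3) unfolding G_def
  proof (induction "card D" arbitrary: D R)
    case 0
    then have "D = {}" "R = {}" by (auto simp: coloured_gluing_def equiv_def refl_on_def)
    then show ?case by (simp add: gluing_points_def)
  next
    case (Suc k)
    note R = Suc.prems(1)
    have e: "equiv D R" and fin: "finite D" using R by (auto simp: coloured_gluing_def)
    have sub: "R \<subseteq> D \<times> D" using gluing_equivD(1)[OF e] .
    show ?case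
    proof (cases "\<exists>z\<in>D. R `` {z} = {z}")
      case True
      then obtain z where z: "z \<in> D" "R `` {z} = {z}" by auto
      let ?D = "D - {z}" and ?R = "R - {(z, z)}"
      have gp: "gluing_points ?R = gluing_points R" unfolding gluing_points_def by blast
      have "z \<notin> gluing_points R" using gluing_points_iff[OF e z(1)] z by simp
      then have "?R \<inter> gluing_points R \<times> gluing_points R = R \<inter> gluing_points R \<times> gluing_points R"
        by auto
      moreover have "k = card ?D" using Suc.hyps fin z by simp
      moreover have "num_faces I ?D ?R = num_faces I D R"
        using num_faces_remove[OF R Suc.prems(2,3) z] .
      moreover have "has_genus I ?D ?R g = has_genus I D R g"
        using calculation(3) quotient_remove[OF R z] fin z Suc.hyps(2) unfolding has_genus_def by simp
      moreover have "fst ` ?D \<subseteq> I" using Suc.prems by auto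
      ultimately show ?thesis
        using Suc.hyps(1)[of ?D ?R] coloured_gluing_remove(1)[OF R z] Suc.prems(2) gp by simp
    next
      case False
      then have "gluing_points R = D"
        using gluing_points_iff[OF e] sub unfolding gluing_points_def by blast
      then show ?thesis using sub by (simp add: Int_absorb2)
    qed
  qed
  then show "num_faces I D R = num_faces I G (R \<inter> G \<times> G)"
    and "has_genus I D R g \<longleftrightarrow> has_genus I G (R \<inter> G \<times> G) g" by auto
qed

section \<open>Transport along maps that preserve the cyclic orders\<close>

lemma relation_image_class:
  assumes "inj_on h D" "R \<subseteq> D \<times> D" "x \<in> D"
  shows "(map_prod h h ` R) `` {h x} = h ` (R `` {x})"
proof (intro equalityI subsetI)
  fix y assume "y \<in> (map_prod h h ` R) `` {h x}"
  then obtain a b where ab: "(a, b) \<in> R" "h x = h a" "y = h b" by auto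
  then have "x = a" using assms inj_onD[OF assms(1), of x a] by blast
  then show "y \<in> h ` (R `` {x})" using ab by blast
qed auto

lemma equiv_image:
  assumes "inj_on h D" "equiv D R"
  shows "equiv (h ` D) (map_prod h h ` R)"
proof -
  have sub: "R \<subseteq> D \<times> D" using gluing_equivD(1)[OF assms(2)] .
  show ?thesis
  proof (intro equivI refl_onI symI transI)
    fix x y z assume "(x, y) \<in> map_prod h h ` R" "(y, z) \<in> map_prod h h ` R"
    then obtain a b c d where *: "(a, b) \<in> R" "(c, d) \<in> R" "x = h a" "y = h b" "y = h c" "z = h d" by auto
    then have "b = c" using assms sub by (auto dest: inj_onD)
    then have "(a, d) \<in> R" using * assms by (meson equivE transE)
    then show "(x, z) \<in> map_prod h h ` R" using * by auto
  next
    fix x y assume "(x, y) \<in> map_prod h h ` R"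
    then obtain a b where *: "(a, b) \<in> R" "x = h a" "y = h b" by auto
    then have "(b, a) \<in> R" using assms by (meson equivE symE)
    then show "(y, x) \<in> map_prod h h ` R" using * by auto
  next
    fix x assume "x \<in> h ` D"
    then show "(x, x) \<in> map_prod h h ` R" using assms by (force simp: equiv_def refl_on_def)
  qed (use sub in auto)
qed

lemma properly_coloured_image:
  assumes "inj_on h D" "R \<subseteq> D \<times> D" "\<And>x. x \<in> D \<Longrightarrow> fst (h x) = fst x"
  shows "properly_coloured (map_prod h h ` R) \<longleftrightarrow> properly_coloured R"
proof -
  have col: "colour (h x) = colour x" if "x \<in> D" for x using assms(3)[OF that] by (simp add: colour_def)
  have eq: "h x = h y \<longleftrightarrow> x = y" if "x \<in> D" "y \<in> D" for x y using inj_on_eq_iff[OF assms(1) that] .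
  have "properly_coloured (map_prod h h ` R) \<longleftrightarrow> (\<forall>(x, y)\<in>R. colour (h x) = colour (h y) \<longrightarrow> h x = h y)"
    by (simp add: properly_coloured_def case_prod_beta)
  also have "\<dots> \<longleftrightarrow> properly_coloured R"
    unfolding properly_coloured_def
  proof (rule ball_cong[OF refl])
    fix u assume "u \<in> R"
    then obtain x y where "u = (x, y)" "x \<in> D" "y \<in> D" using assms(2) by blast
    then show "(case u of (x, y) \<Rightarrow> colour (h x) = colour (h y) \<longrightarrow> h x = h y) =
        (case u of (x, y) \<Rightarrow> colour x = colour y \<longrightarrow> x = y)"
      using col eq by simp
  qed
  finally show ?thesis .
qed

text \<open>A rotation of a piece is increasing apart from the points of \<open>W\<close>, which
  pass the origin and come first afterwards. The condition is imposed on each piece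
  separately.\<close>

definition cyclic_shift ::
    "(piece \<times> 'a::linorder) set \<Rightarrow> (piece \<times> 'a) set \<Rightarrow> (piece \<times> 'a \<Rightarrow> piece \<times> 'b::linorder) \<Rightarrow> bool" where
  "cyclic_shift W D h \<longleftrightarrow> (\<forall>x\<in>D. \<forall>y\<in>D. fst x = fst y \<longrightarrow>
     ((x \<in> W \<longleftrightarrow> y \<in> W) \<longrightarrow> (snd (h x) < snd (h y) \<longleftrightarrow> snd x < snd y)) \<and>
     (x \<notin> W \<and> y \<in> W \<longrightarrow> snd x < snd y \<and> snd (h y) < snd (h x)))"

text \<open>General enough for all changes of coordinates below: rotations of polygons and circles,
  enumerations of gluing points, and the passage from natural to real positions.\<close>

definition cyclic_embedding :: "(piece \<times> 'a::linorder) set \<Rightarrow> (piece \<times> 'a \<Rightarrow> piece \<times> 'b::linorder) \<Rightarrow> bool" where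
  "cyclic_embedding D h \<longleftrightarrow> inj_on h D \<and> (\<forall>x\<in>D. fst (h x) = fst x) \<and>
     (\<exists>W. cyclic_shift W D h)"

text \<open>\<open>h\<close> commutes with \<open>edge_end\<close> because it preserves the cyclic
  order on pieces, and with \<open>node_next\<close> because it preserves colours; so it conjugates
  the face permutations.\<close>

lemma faces_image:
  assumes R: "coloured_gluing D R" and h: "cyclic_embedding D h"
  shows "num_faces I (h ` D) (map_prod h h ` R) = num_faces I D R"
    and "has_genus I (h ` D) (map_prod h h ` R) g \<longleftrightarrow> has_genus I D R g"
proof -
  have e: "equiv D R" and fin: "finite D" using R by (auto simp: coloured_gluing_def)
  have sub: "R \<subseteq> D \<times> D" using gluing_equivD(1)[OF e] .
  have inj: "inj_on h D" and fst: "\<And>x. x \<in> D \<Longrightarrow> fst (h x) = fst x"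
    using h by (auto simp: cyclic_embedding_def)
  obtain W where "cyclic_shift W D h"
    using h by (auto simp: cyclic_embedding_def)
  note W0 = this[unfolded cyclic_shift_def, rule_format]
  have W: "snd (h x) < snd (h y) \<longleftrightarrow> snd x < snd y" if "x \<in> D" "y \<in> D" "fst x = fst y" "x \<in> W \<longleftrightarrow> y \<in> W" for x y
    using W0[OF that(1-3)] that(4) by blast
  have W': "snd x < snd y \<and> snd (h y) < snd (h x)" if "x \<in> D" "y \<in> D" "fst x = fst y" "x \<notin> W" "y \<in> W" for x y
    using W0[OF that(1-3)] that(4,5) by blast
  have ee: "edge_end (h ` D) (h x) = h (edge_end D x)" if x: "x \<in> D" for x
  proof -
    let ?A = "{y \<in> D. fst y = fst x}"
    have "fst (h y) = fst (h x) \<longleftrightarrow> fst y = fst x" if "y \<in> D" for y using fst[OF that] fst[OF x] by simp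
    then have A: "{y \<in> h ` D. fst y = fst (h x)} = h ` ?A" by blast
    have "cyclic_next snd (h ` ?A) (h x) = h (cyclic_next snd ?A x)"
    proof (rule cyclic_next_image[where W = W])
      show "inj_on snd (h ` ?A)" using inj_on_snd_piece[of "h ` D" "fst (h x)"] A by simp
      show "inj_on h ?A" using inj by (rule inj_on_subset) auto
    qed (use fin x W W' in auto)
    then show ?thesis unfolding edge_end_def A .
  qed
  have nn: "node_next (map_prod h h ` R) (h x) = h (node_next R x)" if x: "x \<in> D" for x
    unfolding node_next_def relation_image_class[OF inj sub x]
  proof (rule cyclic_next_image[where W = "{}"])
    note cl = class_props[OF R, of x]
    show "finite (R `` {x})" "inj_on colour (R `` {x})" "x \<in> R `` {x}" using cl x by auto
    have col: "colour (h y) = colour y" if "y \<in> R `` {x}" for y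
      using fst[OF subsetD[OF cl(4) that]] by (simp add: colour_def)
    show "inj_on colour (h ` (R `` {x}))" 
    proof (rule inj_on_imageI)
      have "(colour \<circ> h) y = colour y" if "y \<in> R `` {x}" for y using col[OF that] by simp
      then show "inj_on (colour \<circ> h) (R `` {x})" using cl(2) inj_on_cong by blast
    qed
    show "inj_on h (R `` {x})" using inj cl(4) by (rule inj_on_subset)
    show "colour (h y) < colour (h z) \<longleftrightarrow> colour y < colour z"
      if "y \<in> R `` {x}" "z \<in> R `` {x}" for y z using that col by simp
  qed auto
  have "card (orbit (face_step (h ` D) (map_prod h h ` R)) ` (h ` D)) = card (orbit (face_step D R) ` D)"
  proof (rule card_orbits_image[OF inj])
    fix y assume y: "y \<in> D"
    then show "face_step D R y \<in> D" using face_step_bij[OF R] by (auto simp: bij_betw_def)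
    show "face_step (h ` D) (map_prod h h ` R) (h y) = h (face_step D R y)"
      using y ee nn edge_end_in[OF fin y] by (simp add: face_step_node_next)
  qed
  moreover have "fst ` h ` D = fst ` D" using fst by (simp add: image_image cong: image_cong)
  ultimately show nf: "num_faces I (h ` D) (map_prod h h ` R) = num_faces I D R"
    by (simp add: num_faces_def)
  have "(h ` D) // (map_prod h h ` R) = (`) h ` (D // R)"
    using relation_image_class[OF inj sub]
    by (simp add: quotient_def UNION_singleton_eq_range image_image cong: image_cong)
  moreover have "inj_on ((`) h) (D // R)"
    using in_quotient_imp_subset[OF e] by (intro inj_on_subset[OF inj_on_image_Pow[OF inj]]) blast
  ultimately show "has_genus I (h ` D) (map_prod h h ` R) g \<longleftrightarrow> has_genus I D R g"
    using nf inj by (simp add: has_genus_def card_image)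
qed

section \<open>Gluings and their cores\<close>

lemma connected_gluing_mono_aux:
  assumes "\<And>x y. x \<noteq> y \<Longrightarrow> (x, y) \<in> R \<Longrightarrow> (x, y) \<in> R'"
  shows "((\<lambda>(x, y). (fst x, fst y)) ` R)\<^sup>* \<subseteq> ((\<lambda>(x, y). (fst x, fst y)) ` R')\<^sup>*"
proof (rule rtrancl_subset_rtrancl, rule subsetI)
  fix u assume "u \<in> (\<lambda>(x, y). (fst x, fst y)) ` R"
  then obtain x y where u: "(x, y) \<in> R" "u = (fst x, fst y)" by auto
  show "u \<in> ((\<lambda>(x, y). (fst x, fst y)) ` R')\<^sup>*"
  proof (cases "x = y")
    case False
    then have "(x, y) \<in> R'" using assms u by blast
    then have "(fst x, fst y) \<in> (\<lambda>(x, y). (fst x, fst y)) ` R'" by (intro image_eqI[of _ _ "(x, y)"]) simp_all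
    then show ?thesis using u by blast
  qed (use u in simp)
qed

text \<open>A pair \<open>(x, x)\<close> contributes only a loop at a piece, which the reflexive
  closure contains anyway. So adding or deleting trivial classes does not affect
  connectedness.\<close>

lemma connected_gluing_cong:
  assumes "\<And>x y. x \<noteq> y \<Longrightarrow> (x, y) \<in> R \<longleftrightarrow> (x, y) \<in> R'"
  shows "connected_gluing I R \<longleftrightarrow> connected_gluing I R'"
proof -
  have "((\<lambda>(x, y). (fst x, fst y)) ` R)\<^sup>* = ((\<lambda>(x, y). (fst x, fst y)) ` R')\<^sup>*"
    using assms by (intro equalityI connected_gluing_mono_aux) blast+
  then show ?thesis by (simp add: connected_gluing_def)
qed

lemma gluing_pointsI: "(x, y) \<in> R \<Longrightarrow> x \<noteq> y \<Longrightarrow> x \<in> gluing_points R"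
  unfolding gluing_points_def by (metis (mono_tags, lifting) mem_Collect_eq)

lemma gluing_pointsE:
  assumes "x \<in> gluing_points R"
  obtains y where "(x, y) \<in> R" "x \<noteq> y"
proof -
  from assms obtain y where "y \<noteq> x \<and> (x, y) \<in> R" unfolding gluing_points_def by (elim CollectE exE)
  then show ?thesis using that[of y] by metis
qed

lemma Ball_case_prod: "(\<forall>(x, y)\<in>A. Q x y) \<longleftrightarrow> (\<forall>x y. (x, y) \<in> A \<longrightarrow> Q x y)"
  by fastforce

lemma properly_coloured_iff:
  "properly_coloured R \<longleftrightarrow> (\<forall>x y. (x, y) \<in> R \<longrightarrow> colour x = colour y \<longrightarrow> x = y)"
  unfolding properly_coloured_def by (rule Ball_case_prod)

lemma properly_coloured_cong:
  assumes "\<And>x y. x \<noteq> y \<Longrightarrow> (x, y) \<in> R \<longleftrightarrow> (x, y) \<in> R'"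
  shows "properly_coloured R \<longleftrightarrow> properly_coloured R'"
  unfolding properly_coloured_iff using assms by metis

lemma gluing_points_cong:
  assumes "\<And>x y. x \<noteq> y \<Longrightarrow> (x, y) \<in> R \<longleftrightarrow> (x, y) \<in> R'"
  shows "gluing_points R = gluing_points R'"
  using assms by (intro equalityI subsetI) (metis gluing_pointsE gluing_pointsI)+

lemma connected_gluing_image:
  assumes "R \<subseteq> D \<times> D" "\<And>x. x \<in> D \<Longrightarrow> fst (h x) = fst x"
  shows "connected_gluing I (map_prod h h ` R) \<longleftrightarrow> connected_gluing I R"
proof -
  have "(\<lambda>(x, y). (fst x, fst y)) ` map_prod h h ` R = (\<lambda>(x, y). (fst x, fst y)) ` R"
    unfolding image_image using assms by (intro image_cong) (auto simp: case_prod_beta)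
  then show ?thesis by (simp add: connected_gluing_def)
qed

lemma gluing_points_image:
  assumes "inj_on h D" "R \<subseteq> D \<times> D"
  shows "gluing_points (map_prod h h ` R) = h ` gluing_points R"
proof (intro equalityI subsetI)
  fix x assume "x \<in> gluing_points (map_prod h h ` R)"
  then obtain y where y: "y \<noteq> x" "(x, y) \<in> map_prod h h ` R" by (metis gluing_pointsE)
  then obtain a b where "(a, b) \<in> R" "x = h a" "y = h b" by (elim imageE) (metis map_prod_simp prod.collapse prod.inject)
  moreover from this y have "a \<noteq> b" by blast
  ultimately show "x \<in> h ` gluing_points R" using gluing_pointsI[of a b R] by blast
next
  fix x assume "x \<in> h ` gluing_points R"
  then obtain a where a: "x = h a" "a \<in> gluing_points R" by blast
  then obtain b where ab: "(a, b) \<in> R" "a \<noteq> b" using gluing_pointsE by metis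
  then have "h b \<noteq> h a" using assms(2) inj_onD[OF assms(1), of b a] by blast
  moreover have "(h a, h b) \<in> map_prod h h ` R" using ab by force
  ultimately show "x \<in> gluing_points (map_prod h h ` R)" using a(1) by (metis gluing_pointsI)
qed

definition core :: "piece set \<Rightarrow> (piece \<times> 'a::linorder) set \<Rightarrow> 'a gluing \<Rightarrow> nat \<Rightarrow> nat \<Rightarrow> bool" where
  "core I D R g p \<longleftrightarrow> coloured_gluing D R \<and> fst ` D \<subseteq> I \<and> connected_gluing I R \<and>
     has_genus I D R g \<and> num_faces I D R = p \<and> gluing_points R = D"

lemma core_image:
  assumes "finite D" "equiv D R" "cyclic_embedding D h"
  shows "core I (h ` D) (map_prod h h ` R) g p \<longleftrightarrow> core I D R g p"
proof -
  have sub: "R \<subseteq> D \<times> D" using gluing_equivD[OF assms(2)] by blast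
  have inj: "inj_on h D" and fst: "\<And>x. x \<in> D \<Longrightarrow> fst (h x) = fst x"
    using assms by (auto simp: cyclic_embedding_def)
  have pc: "properly_coloured (map_prod h h ` R) \<longleftrightarrow> properly_coloured R"
    using properly_coloured_image[OF inj sub fst] .
  have fd: "fst ` h ` D = fst ` D" using fst by (simp add: image_image cong: image_cong)
  have gp: "gluing_points (map_prod h h ` R) = h ` D \<longleftrightarrow> gluing_points R = D"
    unfolding gluing_points_image[OF inj sub]
  proof (rule inj_on_image_eq_iff[OF inj])
    show "gluing_points R \<subseteq> D" using sub unfolding gluing_points_def by blast
  qed simp
  show ?thesis
  proof (cases "properly_coloured R")
    case True
    then have "coloured_gluing D R" "coloured_gluing (h ` D) (map_prod h h ` R)"
      using assms pc equiv_image[OF inj assms(2)] by (auto simp: coloured_gluing_def)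
    then show ?thesis
      unfolding core_def fd gp using connected_gluing_image[OF sub fst, where I = I] by (simp add: faces_image assms(3))
  next
    case False
    then show ?thesis using pc by (simp add: core_def coloured_gluing_def)
  qed
qed

lemma cyclic_embedding_subset: "cyclic_embedding D h \<Longrightarrow> D' \<subseteq> D \<Longrightarrow> cyclic_embedding D' h"
  unfolding cyclic_embedding_def cyclic_shift_def by (meson inj_on_subset subsetD)

text \<open>The common form of both kinds of constellations: \<open>X\<close> is the set of all
  corners or of all points of the circles. Everything topological is expressed by the core.\<close>

definition gluings :: "piece set \<Rightarrow> (piece \<times> 'a::linorder) set \<Rightarrow> nat \<Rightarrow> nat \<Rightarrow> 'a gluing set" where
  "gluings I X g p = {R. equiv X R \<and>
     core I (gluing_points R) (R \<inter> gluing_points R \<times> gluing_points R) g p}"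

text \<open>Every off-diagonal pair has both members in \<open>D\<close>, so passing to the core
  loses only diagonal pairs, and these are determined by \<open>X\<close>.\<close>

lemma core_restriction:
  assumes "equiv X R"
  defines "D \<equiv> gluing_points R"
  shows "D \<subseteq> X" "equiv D (R \<inter> D \<times> D)" "gluing_points (R \<inter> D \<times> D) = D"
    "R = Id_on X \<union> (R \<inter> D \<times> D)"
    "properly_coloured (R \<inter> D \<times> D) \<longleftrightarrow> properly_coloured R"
    "connected_gluing I (R \<inter> D \<times> D) \<longleftrightarrow> connected_gluing I R"
proof -
  note e = gluing_equivD[OF assms(1)]
  have off: "(x, y) \<in> R \<longleftrightarrow> (x, y) \<in> R \<inter> D \<times> D" if "x \<noteq> y" for x y
  proof -
    have *: "x \<in> D" if "(x, y) \<in> R" "x \<noteq> y" for x y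
      using that unfolding D_def by (rule gluing_pointsI)
    show ?thesis using *[of x y] *[of y x] that e(3)[of x y] by blast
  qed
  show DX: "D \<subseteq> X" using e(1) unfolding D_def gluing_points_def by blast
  show "equiv D (R \<inter> D \<times> D)"
  proof (intro equivI refl_onI symI transI)
    show "(x, x) \<in> R \<inter> D \<times> D" if "x \<in> D" for x using that DX e(2) by blast
    show "(y, x) \<in> R \<inter> D \<times> D" if "(x, y) \<in> R \<inter> D \<times> D" for x y using that e(3) by blast
    show "(x, z) \<in> R \<inter> D \<times> D" if "(x, y) \<in> R \<inter> D \<times> D" "(y, z) \<in> R \<inter> D \<times> D" for x y z
      using that e(4) by blast
  qed auto
  show "gluing_points (R \<inter> D \<times> D) = D" 
    using gluing_points_cong[of R "R \<inter> D \<times> D", OF off] by (simp add: D_def)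
  show "R = Id_on X \<union> (R \<inter> D \<times> D)"
  proof (intro equalityI subsetI)
    fix u assume "u \<in> R"
    then show "u \<in> Id_on X \<union> (R \<inter> D \<times> D)" using off[of "fst u" "snd u"] e(1)
      by (cases "fst u = snd u") (metis Id_onI SigmaD1 UnI1 prod.collapse subsetD, metis UnI2 prod.collapse)
  qed (use e(2) in \<open>auto simp: Id_on_def\<close>)
  show "properly_coloured (R \<inter> D \<times> D) \<longleftrightarrow> properly_coloured R"
    using properly_coloured_cong[OF off] by blast
  show "connected_gluing I (R \<inter> D \<times> D) \<longleftrightarrow> connected_gluing I R"
    using connected_gluing_cong[OF off] by blast
qed

lemma core_extension:
  assumes "equiv D R" "D \<subseteq> X" "gluing_points R = D"
  defines "G \<equiv> Id_on X \<union> R"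
  shows "equiv X G" "gluing_points G = D" "G \<inter> D \<times> D = R"
proof -
  note e = gluing_equivD[OF assms(1)]
  show "equiv X G"
  proof (intro equivI refl_onI symI transI)
    show "G \<subseteq> X \<times> X" using e(1) assms(2) by (auto simp: G_def)
    show "(x, x) \<in> G" if "x \<in> X" for x using that by (auto simp: G_def)
    show "(y, x) \<in> G" if "(x, y) \<in> G" for x y using that e(3) unfolding G_def by blast
    show "(x, z) \<in> G" if "(x, y) \<in> G" "(y, z) \<in> G" for x y z using that e(4) unfolding G_def by blast
  qed
  show "gluing_points G = D"
    using gluing_points_cong[of G R] assms(3) unfolding G_def by blast
  show "G \<inter> D \<times> D = R" using e(1,2) unfolding G_def by blast
qed

text \<open>For a fixed set of gluing points, restricting to it and adding the diagonal are inverse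
  to each other; this reduces counting gluings to counting cores.\<close>

lemma bij_betw_core_gluings:
  assumes "D \<subseteq> X"
  shows "bij_betw (\<lambda>R. Id_on X \<union> R) {R. core I D R g p} {G \<in> gluings I X g p. gluing_points G = D}"
proof (rule bij_betw_byWitness[where f' = "\<lambda>G. G \<inter> D \<times> D"])
  have *: "equiv D R" "gluing_points R = D" if "core I D R g p" for R
    using that by (auto simp: core_def coloured_gluing_def)
  show "\<forall>R\<in>{R. core I D R g p}. (Id_on X \<union> R) \<inter> D \<times> D = R"
    using core_extension(3)[OF _ assms] * by blast
  show "\<forall>G\<in>{G \<in> gluings I X g p. gluing_points G = D}. Id_on X \<union> G \<inter> D \<times> D = G"
    using core_restriction(4)[of X] unfolding gluings_def by blast
  show "(\<lambda>R. Id_on X \<union> R) ` {R. core I D R g p} \<subseteq> {G \<in> gluings I X g p. gluing_points G = D}"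
    using core_extension[OF _ assms] * unfolding gluings_def by auto
  show "(\<lambda>G. G \<inter> D \<times> D) ` {G \<in> gluings I X g p. gluing_points G = D} \<subseteq> {R. core I D R g p}"
    unfolding gluings_def by auto
qed

text \<open>For polygons, genus and faces are defined with all corners as vertices, in
  \<open>gluings\<close> with the gluing points only; the two agree because trivial points can be
  deleted.\<close>

lemma constellations_eq_gluings:
  assumes "finite I"
  shows "constellations I n g p = gluings I (corners I n) g p"
proof -
  have fin: "finite (corners I n)" and sub: "fst ` corners I n \<subseteq> I"
    using assms by (auto simp: corners_def)
  have "R \<in> constellations I n g p \<longleftrightarrow> R \<in> gluings I (corners I n) g p" if e: "equiv (corners I n) R" for R
  proof -
    let ?G = "gluing_points R"
    note cr = core_restriction[OF e]
    have G: "?G \<subseteq> corners I n" "finite ?G" "fst ` ?G \<subseteq> I"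
      using cr(1) fin sub finite_subset by blast+
    show ?thesis
    proof (cases "properly_coloured R")
      case True
      have "coloured_gluing (corners I n) R" using e fin True by (simp add: coloured_gluing_def)
      from num_faces_core[OF this assms sub] show ?thesis
        using e True cr(2,3,5,6) G unfolding constellations_def gluings_def core_def coloured_gluing_def by auto
    next
      case False
      then show ?thesis using cr(5) unfolding constellations_def gluings_def core_def coloured_gluing_def by auto
    qed
  qed
  moreover have "equiv (corners I n) R" if "R \<in> constellations I n g p \<or> R \<in> gluings I (corners I n) g p" for R
    using that by (auto simp: constellations_def gluings_def)
  ultimately show ?thesis by blast
qed

lemma circle_constellations_eq_gluings:
  "circle_constellations I l g p = gluings I (circle_points I l) g p"
proof -
  have sub: "fst ` circle_points I l \<subseteq> I" by (auto simp: circle_points_def)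
  have "R \<in> circle_constellations I l g p \<longleftrightarrow> R \<in> gluings I (circle_points I l) g p"
    if e: "equiv (circle_points I l) R" for R
  proof -
    note cr = core_restriction[OF e]
    have "fst ` gluing_points R \<subseteq> I" using cr(1) sub by blast
    then show ?thesis
      using e cr(2,3,5,6)
      unfolding circle_constellations_def gluings_def core_def coloured_gluing_def Let_def by auto
  qed
  moreover have "equiv (circle_points I l) R"
    if "R \<in> circle_constellations I l g p \<or> R \<in> gluings I (circle_points I l) g p" for R
    using that by (auto simp: circle_constellations_def gluings_def)
  ultimately show ?thesis by blast
qed

lemma gluings_image:
  assumes h: "cyclic_embedding X h" and X': "h ` X = X'" and R: "R \<in> gluings I X g p"
  shows "map_prod h h ` R \<in> gluings I X' g p"
proof -
  let ?D = "gluing_points R" and ?R = "map_prod h h ` R"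
  have inj: "inj_on h X" using h by (simp add: cyclic_embedding_def)
  have e: "equiv X R" and c: "core I ?D (R \<inter> ?D \<times> ?D) g p" using R by (auto simp: gluings_def)
  have sub: "R \<subseteq> X \<times> X" using gluing_equivD(1)[OF e] .
  note cr = core_restriction[OF e]
  have gp: "gluing_points ?R = h ` ?D" using gluing_points_image[OF inj sub] .
  have "?R \<inter> h ` ?D \<times> h ` ?D = map_prod h h ` (R \<inter> ?D \<times> ?D)"
  proof (intro equalityI subsetI)
    fix u assume "u \<in> ?R \<inter> h ` ?D \<times> h ` ?D"
    then obtain a b a' b' where *: "(a, b) \<in> R" "u = (h a, h b)" "a' \<in> ?D" "b' \<in> ?D" "h a = h a'" "h b = h b'"
      by auto
    then have "a = a'" "b = b'" using inj_onD[OF inj] sub cr(1) by blast+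
    then show "u \<in> map_prod h h ` (R \<inter> ?D \<times> ?D)" using * by auto
  qed auto
  moreover have "finite ?D" using c by (simp add: core_def coloured_gluing_def)
  then have "core I (h ` ?D) (map_prod h h ` (R \<inter> ?D \<times> ?D)) g p"
    using core_image[OF _ cr(2) cyclic_embedding_subset[OF h cr(1)]] c by blast
  ultimately show ?thesis
    using equiv_image[OF inj e] gp X' by (auto simp: gluings_def)
qed

text \<open>For surjectivity a relation on the image is pulled back along \<open>h\<close>; that the
  result is a core is the converse direction of \<open>core_image\<close>.\<close>

lemma bij_betw_core_image:
  assumes "finite C" "cyclic_embedding C h"
  shows "bij_betw ((`) (map_prod h h)) {S. core I C S g p} {R. core I (h ` C) R g p}"
proof -
  have inj: "inj_on h C" using assms by (simp add: cyclic_embedding_def)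
  then have inj2: "inj_on (map_prod h h) (C \<times> C)" by (intro map_prod_inj_on)
  have sub: "S \<subseteq> C \<times> C" "equiv C S" if "core I C S g p" for S
    using that gluing_equivD(1)[of C S] by (auto simp: core_def coloured_gluing_def)
  show ?thesis
    unfolding bij_betw_def
  proof (intro conjI equalityI subsetI)
    show "inj_on ((`) (map_prod h h)) {S. core I C S g p}"
      using sub(1) by (intro inj_on_subset[OF inj_on_image_Pow[OF inj2]]) blast
  next
    fix R assume "R \<in> (`) (map_prod h h) ` {S. core I C S g p}"
    then show "R \<in> {R. core I (h ` C) R g p}"
      using core_image[OF assms(1) _ assms(2)] sub(2) by auto
  next
    fix R assume R: "R \<in> {R. core I (h ` C) R g p}"
    then have eR: "equiv (h ` C) R" by (simp add: core_def coloured_gluing_def)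
    note e = gluing_equivD[OF eR]
    define S where "S = {(x, y). x \<in> C \<and> y \<in> C \<and> (h x, h y) \<in> R}"
    have SR: "map_prod h h ` S = R"
    proof (intro equalityI subsetI)
      fix u assume "u \<in> R"
      then obtain x y where "x \<in> C" "y \<in> C" "u = (h x, h y)" using e(1) by blast
      then show "u \<in> map_prod h h ` S" using \<open>u \<in> R\<close> by (force simp: S_def)
    qed (auto simp: S_def)
    have "equiv C S"
    proof (intro equivI refl_onI symI transI)
      show "S \<subseteq> C \<times> C" by (auto simp: S_def)
      show "(x, x) \<in> S" if "x \<in> C" for x using that e(2) by (auto simp: S_def)
      show "(y, x) \<in> S" if "(x, y) \<in> S" for x y using that e(3) by (auto simp: S_def)
      show "(x, z) \<in> S" if "(x, y) \<in> S" "(y, z) \<in> S" for x y z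
        using that e(4) unfolding S_def by blast
    qed
    then have "core I C S g p" using core_image[OF assms(1) _ assms(2), of S] R SR by simp
    then show "R \<in> (`) (map_prod h h) ` {S. core I C S g p}" using SR by blast
  qed
qed

section \<open>Standard position of a set of gluing points\<close>

definition arc_numbers :: "piece set \<Rightarrow> (piece \<times> 'a) set \<Rightarrow> piece \<Rightarrow> nat" where
  "arc_numbers I D = (\<lambda>c\<in>I. card {y \<in> D. fst y = c})"

definition enum_points :: "(piece \<times> 'a::linorder) set \<Rightarrow> piece \<times> nat \<Rightarrow> piece \<times> 'a" where
  "enum_points D x = (fst x, sorted_list_of_set (snd ` {y \<in> D. fst y = fst x}) ! snd x)"

lemma enum_points:
  assumes "finite D" "fst ` D \<subseteq> I"
  shows "enum_points D ` corners I (arc_numbers I D) = D"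
    and "cyclic_embedding (corners I (arc_numbers I D)) (enum_points D)"
    and "c \<in> I \<Longrightarrow> i < j \<Longrightarrow> j < arc_numbers I D c \<Longrightarrow> snd (enum_points D (c, i)) < snd (enum_points D (c, j))"
proof -
  let ?P = "\<lambda>c. snd ` {y \<in> D. fst y = c}"
  let ?L = "\<lambda>c. sorted_list_of_set (?P c)"
  let ?r = "arc_numbers I D"
  have fin: "finite (?P c)" for c using assms by auto
  have len: "length (?L c) = ?r c" if "c \<in> I" for c
    using that by (simp add: arc_numbers_def card_image)
  have less: "?L c ! i < ?L c ! j" if "c \<in> I" "i < j" "j < ?r c" for c i j
    using that len strict_sorted_list_of_set[of "?P c"] by (auto simp: sorted_wrt_iff_nth_less)
  then show "c \<in> I \<Longrightarrow> i < j \<Longrightarrow> j < ?r c \<Longrightarrow> snd (enum_points D (c, i)) < snd (enum_points D (c, j))"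
    by (simp add: enum_points_def)
  have less_iff: "?L c ! i < ?L c ! j \<longleftrightarrow> i < j" if "c \<in> I" "i < ?r c" "j < ?r c" for c i j
    using less[OF that(1), of i j] less[OF that(1), of j i] that
    by (cases i j rule: linorder_cases) (simp_all add: order_less_imp_not_less)
  have set: "(c, t) \<in> D \<longleftrightarrow> c \<in> I \<and> (\<exists>i<?r c. ?L c ! i = t)" for c t
  proof -
    have "(c, t) \<in> D \<longleftrightarrow> c \<in> I \<and> t \<in> set (?L c)"
    proof -
      have "t \<in> ?P c \<longleftrightarrow> (c, t) \<in> D" by force
      moreover have "c \<in> I" if "(c, t) \<in> D" using that assms(2) by (metis fst_conv imageI subsetD)
      ultimately show ?thesis using fin by auto
    qed
    also have "\<dots> \<longleftrightarrow> c \<in> I \<and> (\<exists>i<?r c. ?L c ! i = t)"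
      using len[of c] by (auto simp: in_set_conv_nth simp del: set_sorted_list_of_set)
    finally show ?thesis .
  qed
  show "enum_points D ` corners I ?r = D"
  proof (intro equalityI subsetI)
    fix x assume "x \<in> enum_points D ` corners I ?r"
    then obtain c i where "x = (c, ?L c ! i)" "c \<in> I" "i < ?r c" by (auto simp: corners_def enum_points_def)
    then show "x \<in> D" using set by auto
  next
    fix x assume "x \<in> D"
    then obtain i where "fst x \<in> I" "i < ?r (fst x)" "?L (fst x) ! i = snd x" using set[of "fst x" "snd x"] by auto
    then have "(fst x, i) \<in> corners I ?r" "x = enum_points D (fst x, i)"
      by (simp_all add: corners_def enum_points_def)
    then show "x \<in> enum_points D ` corners I ?r" by blast
  qed
  have 1: "snd (enum_points D x) < snd (enum_points D y) \<longleftrightarrow> snd x < snd y"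
    if "x \<in> corners I ?r" "y \<in> corners I ?r" "fst x = fst y" for x y
    using that less_iff[of "fst x" "snd x" "snd y"] by (auto simp: corners_def enum_points_def)
  have "inj_on (enum_points D) (corners I ?r)"
  proof (rule inj_onI)
    fix x y assume *: "x \<in> corners I ?r" "y \<in> corners I ?r" "enum_points D x = enum_points D y"
    then have f: "fst x = fst y" by (simp add: enum_points_def)
    then have "snd x = snd y" using 1[OF *(1,2)] 1[OF *(2,1)] *(3) f by simp
    with f show "x = y" by (rule prod_eqI)
  qed
  then show "cyclic_embedding (corners I ?r) (enum_points D)"
    unfolding cyclic_embedding_def cyclic_shift_def using 1
    by (intro conjI exI[of _ "{}"]) (auto simp: enum_points_def)
qed

definition cores :: "piece set \<Rightarrow> nat \<Rightarrow> nat \<Rightarrow> (piece \<Rightarrow> nat) \<Rightarrow> nat gluing set" where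
  "cores I g p r = {S. core I (corners I r) S g p}"

lemma finite_corners [simp]: "finite I \<Longrightarrow> finite (corners I r)"
  by (simp add: corners_def)

text \<open>Numbering the points of \<open>D\<close> in increasing order on each piece identifies
  cores on \<open>D\<close> with cores on standard corners, so their number depends on
  \<open>D\<close> only through its arc numbers.\<close>

lemma bij_betw_cores:
  assumes "finite I" "finite D" "fst ` D \<subseteq> I"
  shows "bij_betw ((`) (map_prod (enum_points D) (enum_points D))) (cores I g p (arc_numbers I D)) {R. core I D R g p}"
  using bij_betw_core_image[OF finite_corners[OF assms(1)] enum_points(2)[OF assms(2,3)], of I g p]
  unfolding enum_points(1)[OF assms(2,3)] cores_def .

lemma finite_core: "finite D \<Longrightarrow> finite {R. core I D R g p}"
  by (rule finite_subset[of _ "Pow (D \<times> D)"])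
     (auto simp: core_def coloured_gluing_def dest: gluing_equivD(1))

lemma card_gluings:
  assumes "finite I" "finite X" "fst ` X \<subseteq> I"
  shows "card (gluings I X g p) = (\<Sum>D\<in>Pow X. card (cores I g p (arc_numbers I D)))"
proof -
  have U: "gluings I X g p = (\<Union>D\<in>Pow X. {G \<in> gluings I X g p. gluing_points G = D})"
    using core_restriction(1)[of X] unfolding gluings_def by blast
  have b: "card (cores I g p (arc_numbers I D)) = card {G \<in> gluings I X g p. gluing_points G = D} \<and>
     finite {G \<in> gluings I X g p. gluing_points G = D}" if "D \<in> Pow X" for D
  proof -
    have D: "finite D" "fst ` D \<subseteq> I" "D \<subseteq> X" using that assms finite_subset by blast+
    note b1 = bij_betw_cores[OF assms(1) D(1,2), of g p] and b2 = bij_betw_core_gluings[OF D(3), of I g p]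
    show ?thesis
      using bij_betw_same_card[OF b1] bij_betw_same_card[OF b2] finite_core[OF D(1), of I g p]
        bij_betw_finite[OF b2] by simp
  qed
  show ?thesis
    by (subst U, subst card_UN_disjoint) (use assms(2) b in auto)
qed

section \<open>Counting constellations\<close>

lemma corners_iff: "x \<in> corners I n \<longleftrightarrow> fst x \<in> I \<and> snd x < n (fst x)"
  by (cases x) (simp add: corners_def)

lemma rotate_corner_simp: "rotate_corner n s x = (fst x, (snd x + s (fst x)) mod n (fst x))"
  by (cases x) (simp add: rotate_corner_def)

lemma rotate_corner_embedding:
  assumes "finite I" "\<And>c. c \<in> I \<Longrightarrow> 0 < n c"
  shows "cyclic_embedding (corners I n) (rotate_corner n s)"
    and "rotate_corner n s ` corners I n = corners I n"
proof -
  \<comment> \<open>\<open>W\<close> collects the corners that the rotation carries past the last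
    corner, so that \<open>n (fst x)\<close> has to be subtracted from their new position.\<close>
  define W where "W = {x. n (fst x) \<le> snd x + s (fst x) mod n (fst x)}"
  have val: "snd (rotate_corner n s x) =
      (if x \<in> W then snd x + s (fst x) mod n (fst x) - n (fst x) else snd x + s (fst x) mod n (fst x))"
    if "x \<in> corners I n" for x
  proof -
    have *: "snd x < n (fst x)" "s (fst x) mod n (fst x) < n (fst x)"
      using that assms(2)[of "fst x"] by (auto simp: corners_iff)
    have "(snd x + s (fst x)) mod n (fst x) = (snd x + s (fst x) mod n (fst x)) mod n (fst x)"
      by (simp add: mod_add_right_eq)
    also have "\<dots> = (if x \<in> W then snd x + s (fst x) mod n (fst x) - n (fst x) else snd x + s (fst x) mod n (fst x))"
    proof (cases "x \<in> W")
      case True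
      then have "(snd x + s (fst x) mod n (fst x)) mod n (fst x) = (snd x + s (fst x) mod n (fst x) - n (fst x)) mod n (fst x)"
        unfolding W_def by (intro le_mod_geq) simp
      also have "\<dots> = snd x + s (fst x) mod n (fst x) - n (fst x)" using * by (intro mod_less) linarith
      finally show ?thesis using True by simp
    next
      case False
      then show ?thesis by (simp add: W_def)
    qed
    finally show ?thesis by (simp add: rotate_corner_simp)
  qed
  have lt: "snd x < n (fst x)" if "x \<in> corners I n" for x using that by (simp add: corners_iff)
  have "inj_on (rotate_corner n s) (corners I n)"
  proof (rule inj_onI)
    fix x y assume *: "x \<in> corners I n" "y \<in> corners I n" "rotate_corner n s x = rotate_corner n s y"
    then have f: "fst x = fst y" by (simp add: rotate_corner_simp)
    moreover have "snd x = snd y"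
      using val[OF *(1)] val[OF *(2)] *(3) f lt[OF *(1)] lt[OF *(2)] by (auto simp: W_def split: if_splits)
    ultimately show "x = y" by (rule prod_eqI)
  qed
  moreover have "cyclic_shift W (corners I n) (rotate_corner n s)"
    unfolding cyclic_shift_def
  proof (intro ballI impI conjI)
    fix x y assume *: "x \<in> corners I n" "y \<in> corners I n" "fst x = fst y"
    show "snd (rotate_corner n s x) < snd (rotate_corner n s y) \<longleftrightarrow> snd x < snd y" if "x \<in> W \<longleftrightarrow> y \<in> W"
      using that val[OF *(1)] val[OF *(2)] *(3) by (auto simp: W_def)
    assume xy: "x \<notin> W \<and> y \<in> W"
    then show "snd x < snd y" using *(3) by (auto simp: W_def)
    show "snd (rotate_corner n s y) < snd (rotate_corner n s x)"
      using xy val[OF *(1)] val[OF *(2)] *(3) lt[OF *(2)] by (auto simp: W_def)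
  qed
  ultimately show "cyclic_embedding (corners I n) (rotate_corner n s)"
    unfolding cyclic_embedding_def by (auto simp: rotate_corner_simp)
  have "rotate_corner n s ` corners I n \<subseteq> corners I n"
    using assms(2) by (auto simp: corners_iff rotate_corner_simp)
  then show "rotate_corner n s ` corners I n = corners I n"
    using assms(1) \<open>inj_on (rotate_corner n s) (corners I n)\<close> by (simp add: endo_inj_surj)
qed

lemma map_prod_image_cong:
  assumes "R \<subseteq> X \<times> X" "\<And>x. x \<in> X \<Longrightarrow> h x = h' x"
  shows "map_prod h h ` R = map_prod h' h' ` R"
  using assms by (intro image_cong refl) (auto simp: map_prod_def)

text \<open>\<open>iso_class\<close> uses arbitrary shifts and \<open>automorphisms\<close> only
  reduced ones; this lets the two be compared.\<close>

lemma rotate_constellation_cong: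
  assumes "R \<subseteq> corners I n \<times> corners I n" "\<And>c. c \<in> I \<Longrightarrow> s c mod n c = t c mod n c"
  shows "rotate_constellation n s R = rotate_constellation n t R"
  unfolding rotate_constellation_def
proof (rule map_prod_image_cong[OF assms(1)])
  fix x assume "x \<in> corners I n"
  then have "s (fst x) mod n (fst x) = t (fst x) mod n (fst x)" using assms(2) by (simp add: corners_iff)
  then show "rotate_corner n s x = rotate_corner n t x"
    by (metis mod_add_right_eq rotate_corner_simp)
qed

lemma rotate_constellation_add:
  assumes "R \<subseteq> corners I n \<times> corners I n"
  shows "rotate_constellation n t (rotate_constellation n s R) = rotate_constellation n (\<lambda>c. s c + t c) R"
proof -
  have "rotate_corner n t (rotate_corner n s x) = rotate_corner n (\<lambda>c. s c + t c) x" for x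
    by (simp add: rotate_corner_simp mod_add_left_eq add.assoc)
  then show ?thesis
    unfolding rotate_constellation_def image_image by (intro image_cong refl) (simp add: map_prod_def case_prod_beta)
qed

lemma rotate_constellation_zero:
  assumes "R \<subseteq> corners I n \<times> corners I n"  "\<And>c. c \<in> I \<Longrightarrow> s c mod n c = 0"
  shows "rotate_constellation n s R = R"
proof -
  have "rotate_constellation n s R = map_prod (\<lambda>x. x) (\<lambda>x. x) ` R"
    unfolding rotate_constellation_def
  proof (rule map_prod_image_cong[OF assms(1)])
    fix x assume x: "x \<in> corners I n"
    then have "(snd x + s (fst x)) mod n (fst x) = (snd x + 0) mod n (fst x)"
      using assms(2)[of "fst x"] by (metis corners_iff mod_0 mod_add_right_eq)
    then show "rotate_corner n s x = x" using x by (simp add: rotate_corner_simp corners_iff)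
  qed
  then show ?thesis by (simp add: map_prod_def case_prod_beta)
qed

text \<open>Orbit counting for the product of the rotation groups, represented by the reduced shifts
  \<open>K\<close>: an orbit \<open>X\<close> has stabilizers of size
  \<open>card K / card X\<close>, hence weight \<open>card X / card K\<close>, and the orbits
  partition the gluings.\<close>

lemma num_constellations_eq:
  assumes "finite I" and n: "\<And>c. c \<in> I \<Longrightarrow> 0 < n c"
  shows "num_constellations I n g p = real (card (constellations I n g p)) / (\<Prod>c\<in>I. real (n c))"
proof -
  define C where "C = constellations I n g p"
  define K where "K = (\<Pi>\<^sub>E c\<in>I. {..<n c})"
  let ?rot = "rotate_constellation n"
  define red where "red s = (\<lambda>c\<in>I. s c mod n c)" for s :: "piece \<Rightarrow> nat"
  have redK: "red s \<in> K" for s using n by (auto simp: red_def K_def)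
  have finK: "finite K" using assms(1) by (simp add: K_def finite_PiE)
  have cardK: "real (card K) = (\<Prod>c\<in>I. real (n c))" using assms(1) by (simp add: K_def card_PiE)
  have Kpos: "card K > 0" using cardK n by (metis of_nat_0_less_iff prod_pos)
  have CX: "R \<subseteq> corners I n \<times> corners I n" if "R \<in> C" for R
    using that unfolding C_def constellations_def by (auto dest: gluing_equivD(1))
  have rotred: "?rot (red s) R = ?rot s R" if "R \<in> C" for s R
    using CX[OF that] by (rule rotate_constellation_cong) (simp add: red_def)
  have finC: "finite C"
    using CX assms(1) by (intro finite_subset[of C "Pow (corners I n \<times> corners I n)"]) auto
  have rotC: "?rot s R \<in> C" if "R \<in> C" for s R
  proof -
    note emb = rotate_corner_embedding[OF assms(1), of n s, OF n]
    show ?thesis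
      using gluings_image[OF emb(1,2)] that
      unfolding C_def constellations_eq_gluings[OF assms(1)] rotate_constellation_def by simp
  qed
  have add: "?rot t (?rot s R) = ?rot (\<lambda>c. s c + t c) R" if "R \<in> C" for s t R
    using rotate_constellation_add[OF CX[OF that]] .
  have isoK: "iso_class n R = (\<lambda>s. ?rot s R) ` K" if "R \<in> C" for R
  proof -
    have "?rot s R \<in> (\<lambda>s. ?rot s R) ` K" for s
      using rotred[OF that, of s] redK[of s] by (intro image_eqI[of _ _ "red s"]) simp_all
    then show ?thesis unfolding iso_class_def by blast
  qed
  have self: "R \<in> iso_class n R" if "R \<in> C" for R
  proof -
    have "?rot (\<lambda>_. 0) R = R" using CX[OF that] by (rule rotate_constellation_zero) simp
    then show ?thesis unfolding iso_class_def by (metis rangeI)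
  qed
  have isoC: "iso_class n R \<subseteq> C" if "R \<in> C" for R
    unfolding iso_class_def using rotC[OF that] by auto
  \<comment> \<open>An inverse shift modulo \<open>n c\<close>. It is not reduced: its value is
    \<open>n c\<close> where \<open>t c\<close> is divisible by \<open>n c\<close>.\<close>
  define neg where "neg t = (\<lambda>c. n c - t c mod n c)" for t :: "piece \<Rightarrow> nat"
  have neg: "(t c + neg t c) mod n c = 0" if "c \<in> I" for t c
  proof -
    have "(t c + neg t c) mod n c = (t c mod n c + neg t c) mod n c" by (simp add: mod_add_left_eq)
    also have "t c mod n c + neg t c = n c" using n[OF that] by (simp add: neg_def less_imp_le)
    finally show ?thesis by simp
  qed
  have rot_neg: "?rot (neg t) (?rot t R) = R" if "R \<in> C" for t R
    unfolding add[OF that] using CX[OF that] by (rule rotate_constellation_zero) (simp add: neg)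
  have iso_eq: "iso_class n R' = iso_class n R" if R: "R \<in> C" and R': "R' \<in> iso_class n R" for R R'
  proof -
    obtain t where t: "R' = ?rot t R" using R' by (auto simp: iso_class_def)
    have sub: "iso_class n (?rot t R) \<subseteq> iso_class n R" if "R \<in> C" for t R
      unfolding iso_class_def using add[OF that] by auto
    have "iso_class n R \<subseteq> iso_class n R'"
      using sub[OF rotC[OF R], of "neg t" t] rot_neg[OF R, of t] t by simp
    then show ?thesis using sub[OF R, of t] t by blast
  qed
  have stab: "card {s \<in> K. ?rot s R = R'} = card (automorphisms I n R)"
    if R: "R \<in> C" and R': "R' \<in> iso_class n R" for R R'
  proof -
    obtain t where t: "R' = ?rot t R" using R' by (auto simp: iso_class_def)
    have aut: "automorphisms I n R = {s \<in> K. ?rot s R = R}" by (simp add: automorphisms_def K_def)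
    have KE: "red (\<lambda>c. red (\<lambda>c. s c + u c) c + v c) = s" if "s \<in> K" "\<And>c. c \<in> I \<Longrightarrow> (u c + v c) mod n c = 0" for s u v
    proof
      fix c
      show "red (\<lambda>c. red (\<lambda>c. s c + u c) c + v c) c = s c"
      proof (cases "c \<in> I")
        case True
        then have "red (\<lambda>c. red (\<lambda>c. s c + u c) c + v c) c = (s c + (u c + v c)) mod n c"
          by (simp add: red_def mod_add_left_eq add.assoc)
        also have "\<dots> = (s c + (u c + v c) mod n c) mod n c" by (simp add: mod_add_right_eq)
        also have "\<dots> = s c" using that(2)[OF True] PiE_mem[OF that(1)[unfolded K_def] True] by simp
        finally show ?thesis .
      qed (use that(1) in \<open>auto simp: red_def K_def\<close>)
    qed
    \<comment> \<open>The shifts carrying \<open>R\<close> to \<open>R'\<close> form the translate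
      by \<open>t\<close> of the stabilizer of \<open>R\<close>.\<close>
    have "bij_betw (\<lambda>s. red (\<lambda>c. s c + t c)) {s \<in> K. ?rot s R = R} {s \<in> K. ?rot s R = R'}"
    proof (rule bij_betw_byWitness[where f' = "\<lambda>s. red (\<lambda>c. s c + neg t c)"])
      show "\<forall>s\<in>{s \<in> K. ?rot s R = R}. red (\<lambda>c. red (\<lambda>c. s c + t c) c + neg t c) = s"
        using KE neg by auto
      show "\<forall>s\<in>{s \<in> K. ?rot s R = R'}. red (\<lambda>c. red (\<lambda>c. s c + neg t c) c + t c) = s"
        using KE[where u = "neg t" and v = t] neg by (auto simp: add.commute)
      show "(\<lambda>s. red (\<lambda>c. s c + t c)) ` {s \<in> K. ?rot s R = R} \<subseteq> {s \<in> K. ?rot s R = R'}"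
        using redK rotred[OF R] add[OF R, of t, symmetric] t by auto
      show "(\<lambda>s. red (\<lambda>c. s c + neg t c)) ` {s \<in> K. ?rot s R = R'} \<subseteq> {s \<in> K. ?rot s R = R}"
        using redK rotred[OF R] add[OF R, of "neg t", symmetric] t rot_neg[OF R, of t] by auto
    qed
    then show ?thesis using aut bij_betw_same_card by force
  qed
  have weight: "1 / real (card (automorphisms I n (SOME R. R \<in> X))) = real (card X) / real (card K)"
    if X: "X \<in> iso_class n ` C" for X
  proof -
    obtain R0 where R0: "R0 \<in> C" "X = iso_class n R0" using X by auto
    \<comment> \<open>The definition picks an arbitrary representative; any choice generates the
      same class \<open>X\<close>.\<close>
    define R where "R = (SOME R. R \<in> X)"
    have "R \<in> X" unfolding R_def using self[OF R0(1)] R0(2) by (metis someI_ex)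
    then have R: "R \<in> C" "X = iso_class n R" using isoC[OF R0(1)] R0 iso_eq[OF R0(1)] by auto
    have "card K = (\<Sum>s\<in>K. 1)" by simp
    also have "\<dots> = (\<Sum>R'\<in>(\<lambda>s. ?rot s R) ` K. \<Sum>s\<in>{s \<in> K. ?rot s R = R'}. 1)"
      by (rule sum.image_gen[OF finK])
    also have "\<dots> = (\<Sum>R'\<in>X. card (automorphisms I n R))"
      unfolding R(2) isoK[OF R(1), symmetric] using stab[OF R(1)] by (intro sum.cong refl) simp
    finally have "card K = card X * card (automorphisms I n R)" by simp
    then show ?thesis using Kpos unfolding R_def[symmetric] by (auto simp: field_simps simp flip: of_nat_mult)
  qed
  have "real (card C) = real (card (\<Union>X\<in>iso_class n ` C. X))"
  proof -
    have "C = (\<Union>X\<in>iso_class n ` C. X)" using self isoC by blast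
    then show ?thesis by simp
  qed
  also have "\<dots> = (\<Sum>X\<in>iso_class n ` C. real (card X))"
  proof (subst card_UN_disjoint)
    show "\<forall>X\<in>iso_class n ` C. finite X" using finC isoC finite_subset by blast
    show "\<forall>X\<in>iso_class n ` C. \<forall>Y\<in>iso_class n ` C. X \<noteq> Y \<longrightarrow> X \<inter> Y = {}"
      using iso_eq by blast
  qed (use finC in auto)
  finally have "real (card C) / real (card K) = (\<Sum>X\<in>iso_class n ` C. real (card X) / real (card K))"
    by (simp add: sum_divide_distrib)
  also have "\<dots> = num_constellations I n g p"
    unfolding num_constellations_def C_def[symmetric] using weight by (intro sum.cong refl) simp
  finally show ?thesis by (simp add: cardK C_def)
qed

section \<open>Counting by sets of gluing points\<close>

lemma arc_numbers_fibre: "card {y \<in> D. fst y = c} = card {t. (c, t) \<in> D}"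
proof -
  have "{y \<in> D. fst y = c} = Pair c ` {t. (c, t) \<in> D}" by force
  then show ?thesis by (simp add: card_image inj_on_def)
qed

lemma card_point_sets:
  assumes "finite I" "r \<in> extensional I"
  shows "card {D \<in> Pow (corners I n). arc_numbers I D = r} = (\<Prod>c\<in>I. n c choose r c)"
proof -
  let ?F = "\<Pi>\<^sub>E c\<in>I. {T. T \<subseteq> {..<n c} \<and> card T = r c}"
  have "bij_betw (\<lambda>f. Sigma I f) ?F {D \<in> Pow (corners I n). arc_numbers I D = r}"
  proof (rule bij_betw_byWitness[where f' = "\<lambda>D. \<lambda>c\<in>I. {t. (c, t) \<in> D}"])
    show "\<forall>f\<in>?F. (\<lambda>c\<in>I. {t. (c, t) \<in> Sigma I f}) = f"
      by (auto simp: fun_eq_iff restrict_def PiE_def extensional_def)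
    show "\<forall>D\<in>{D \<in> Pow (corners I n). arc_numbers I D = r}. Sigma I (\<lambda>c\<in>I. {t. (c, t) \<in> D}) = D"
      by (auto simp: corners_def)
    show "(\<lambda>f. Sigma I f) ` ?F \<subseteq> {D \<in> Pow (corners I n). arc_numbers I D = r}"
    proof (rule image_subsetI)
      fix f assume f: "f \<in> ?F"
      have "arc_numbers I (Sigma I f) c = r c" for c
        using f assms(2) by (auto simp: arc_numbers_def arc_numbers_fibre PiE_def extensional_def Pi_def)
      moreover have "Sigma I f \<subseteq> corners I n" using f by (auto simp: corners_def)
      ultimately show "Sigma I f \<in> {D \<in> Pow (corners I n). arc_numbers I D = r}" by (auto simp: fun_eq_iff)
    qed
    show "(\<lambda>D. \<lambda>c\<in>I. {t. (c, t) \<in> D}) ` {D \<in> Pow (corners I n). arc_numbers I D = r} \<subseteq> ?F"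
      by (auto simp: corners_def arc_numbers_def arc_numbers_fibre)
  qed
  then have "card {D \<in> Pow (corners I n). arc_numbers I D = r} = card ?F"
    by (rule bij_betw_same_card[symmetric])
  also have "\<dots> = (\<Prod>c\<in>I. n c choose r c)"
    using assms(1) by (simp add: card_PiE n_subsets)
  finally show ?thesis .
qed

text \<open>Point sets are grouped by their arc numbers; each group consists of independent choices
  of \<open>r c\<close> corners among \<open>n c\<close>. The finite set \<open>F\<close> only has
  to contain all \<open>r\<close> that admit a core.\<close>

lemma card_constellations:
  assumes "finite I" "finite F" "F \<subseteq> extensional I"
    and F: "\<And>r. r \<in> extensional I \<Longrightarrow> cores I g p r \<noteq> {} \<Longrightarrow> r \<in> F"
  shows "card (constellations I n g p) = (\<Sum>r\<in>F. card (cores I g p r) * (\<Prod>c\<in>I. n c choose r c))"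
proof -
  let ?X = "corners I n" and ?a = "\<lambda>r. card (cores I g p r)"
  let ?S = "{D \<in> Pow ?X. arc_numbers I D \<in> F}"
  have "fst ` ?X \<subseteq> I" by (auto simp: corners_def)
  then have "card (constellations I n g p) = (\<Sum>D\<in>Pow ?X. ?a (arc_numbers I D))"
    unfolding constellations_eq_gluings[OF assms(1)] using assms(1) by (intro card_gluings) auto
  also have "\<dots> = (\<Sum>D\<in>?S. ?a (arc_numbers I D))"
  proof (rule sum.mono_neutral_right)
    show "\<forall>D\<in>Pow ?X - ?S. ?a (arc_numbers I D) = 0"
    proof
      fix D assume "D \<in> Pow ?X - ?S"
      moreover have "arc_numbers I D \<in> extensional I" by (simp add: arc_numbers_def)
      ultimately have "cores I g p (arc_numbers I D) = {}" using F by blast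
      then show "?a (arc_numbers I D) = 0" by simp
    qed
  qed (use assms(1) in auto)
  also have "\<dots> = (\<Sum>r\<in>F. \<Sum>D\<in>{D \<in> ?S. arc_numbers I D = r}. ?a (arc_numbers I D))"
    using assms by (intro sum.group[symmetric]) auto
  also have "\<dots> = (\<Sum>r\<in>F. ?a r * (\<Prod>c\<in>I. n c choose r c))"
  proof (rule sum.cong[OF refl])
    fix r assume r: "r \<in> F"
    then have "{D \<in> ?S. arc_numbers I D = r} = {D \<in> Pow ?X. arc_numbers I D = r}" by auto
    then show "(\<Sum>D\<in>{D \<in> ?S. arc_numbers I D = r}. ?a (arc_numbers I D)) = ?a r * (\<Prod>c\<in>I. n c choose r c)"
      using card_point_sets[OF assms(1), of r n] r assms(3) by auto
  qed
  finally show ?thesis .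
qed

section \<open>Euler's formula as a bound on the number of gluing points\<close>

lemma card_eq_sum_classes:
  assumes "finite D" "equiv D R"
  shows "card D = (\<Sum>C\<in>D // R. card C)"
proof -
  have "card (\<Union>(D // R)) = (\<Sum>C\<in>D // R. card C)"
    using assms finite_quotient[OF assms(1), of R] quotient_disj[OF assms(2)] gluing_equivD(1)[OF assms(2)]
    by (intro card_Union_disjoint) (auto simp: pairwise_def disjnt_def intro: finite_subset[OF in_quotient_imp_subset[OF assms(2)]])
  then show ?thesis using Union_quotient[OF assms(2)] by simp
qed

lemma core_class_card:
  assumes "core I D R g p" "x \<in> D"
  shows "2 \<le> card (R `` {x})"
proof -
  have cg: "coloured_gluing D R" and gp: "gluing_points R = D" using assms by (auto simp: core_def)
  obtain y where y: "(x, y) \<in> R" "x \<noteq> y" using gp assms(2) gluing_pointsE by blast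
  have "{x, y} \<subseteq> R `` {x}" using class_props(3)[OF cg assms(2)] y by auto
  then have "card {x, y} \<le> card (R `` {x})" using class_props(1)[OF cg] by (intro card_mono)
  then show ?thesis using y by simp
qed

text \<open>With \<open>V\<close> vertices Euler's formula reads
  \<open>card D - V = card I + p + 2 * g - 2\<close>, and the right side is half of
  \<open>d + card I\<close>. Hence \<open>card D\<close> falls short of \<open>d + card I\<close> by
  exactly the total excess of the class sizes over 2.\<close>

lemma core_card:
  assumes c: "core I D R g p" and d: "int d = 4 * int g - 4 + int (card I) + 2 * int p"
  shows "card D \<le> d + card I"
    and "card D = d + card I \<longleftrightarrow> (\<forall>x\<in>D. card (R `` {x}) = 2)"
proof -
  have e: "equiv D R" and fin: "finite D" and g: "has_genus I D R g" "num_faces I D R = p"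
    using c by (auto simp: core_def coloured_gluing_def)
  have fq: "finite (D // R)" using finite_quotient fin gluing_equivD(1)[OF e] by blast
  have eul: "int (card D) - int (card (D // R)) = int (card I) + int p + 2 * int g - 2"
    using g by (simp add: has_genus_def)
  have two: "2 \<le> card C" if "C \<in> D // R" for C
    using that core_class_card[OF c] by (auto simp: quotient_def)
  have sum: "card D = 2 * card (D // R) + (\<Sum>C\<in>D // R. card C - 2)"
  proof -
    have "card D = (\<Sum>C\<in>D // R. 2 + (card C - 2))"
      unfolding card_eq_sum_classes[OF fin e]
    proof (rule sum.cong[OF refl])
      show "card C = 2 + (card C - 2)" if "C \<in> D // R" for C using two[OF that] by simp
    qed
    then show ?thesis by (simp only: sum.distrib sum_constant) simp
  qed
  then show "card D \<le> d + card I" using eul d by linarith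
  have "card D = d + card I \<longleftrightarrow> (\<Sum>C\<in>D // R. card C - 2) = 0" using sum eul d by linarith
  also have "\<dots> \<longleftrightarrow> (\<forall>C\<in>D // R. card C - 2 = 0)" using fq by simp
  also have "\<dots> \<longleftrightarrow> (\<forall>C\<in>D // R. card C = 2)" using two by (intro ball_cong) fastforce+
  also have "\<dots> \<longleftrightarrow> (\<forall>x\<in>D. card (R `` {x}) = 2)" by (auto simp: quotient_def)
  finally show "card D = d + card I \<longleftrightarrow> (\<forall>x\<in>D. card (R `` {x}) = 2)" .
qed

lemma core_meets_pieces:
  assumes c: "core I D R g p" and ab: "a \<in> I" "b \<in> I" "a \<noteq> b"
  shows "\<exists>x\<in>D. fst x = a"
proof -
  have "(a, b) \<in> ((\<lambda>(x, y). (fst x, fst y)) ` R)\<^sup>*"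
    using c ab by (auto simp: core_def connected_gluing_def)
  then obtain y where "(a, y) \<in> (\<lambda>(x, y). (fst x, fst y)) ` R"
    using ab by (meson converse_rtranclE)
  then obtain u v where "(u, v) \<in> R" "fst u = a" by auto
  moreover have "R \<subseteq> D \<times> D" using c by (auto simp: core_def coloured_gluing_def dest: gluing_equivD(1))
  ultimately show ?thesis by blast
qed

lemma card_corners: "finite I \<Longrightarrow> card (corners I r) = (\<Sum>c\<in>I. r c)"
  by (simp add: corners_def)

text \<open>With at least two pieces, connectedness forces a gluing point on each of them, hence the
  lower bound; a single uncut piece would have \<open>r c = 0\<close>.\<close>

lemma cores_bounds:
  assumes "finite I" "S \<in> cores I g p r" "int d = 4 * int g - 4 + int (card I) + 2 * int p" "2 \<le> card I"
  shows "(\<Sum>c\<in>I. r c) \<le> d + card I" and "c \<in> I \<Longrightarrow> 1 \<le> r c" and "c \<in> I \<Longrightarrow> r c \<le> d + card I"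
    and "(\<Sum>c\<in>I. r c) = d + card I \<longleftrightarrow> (\<forall>x\<in>corners I r. card (S `` {x}) = 2)"
proof -
  have S: "core I (corners I r) S g p" using assms(2) by (simp add: cores_def)
  show 1: "(\<Sum>c\<in>I. r c) \<le> d + card I"
    and "(\<Sum>c\<in>I. r c) = d + card I \<longleftrightarrow> (\<forall>x\<in>corners I r. card (S `` {x}) = 2)"
    using core_card[OF S assms(3)] card_corners[OF assms(1), of r] by simp_all
  show "1 \<le> r c" if c: "c \<in> I"
  proof -
    have "I \<noteq> {c}" using assms(4) by auto
    then obtain b where "b \<in> I" "c \<noteq> b" using c by blast
    from core_meets_pieces[OF S c this] obtain x where "x \<in> corners I r" "fst x = c" by blast
    then show ?thesis by (auto simp: corners_iff)
  qed
  show "r c \<le> d + card I" if c: "c \<in> I"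
    using member_le_sum[OF c, of r] assms(1) 1 by auto
qed

section \<open>Existence of generic gluings\<close>

lemma cyclic_next_pair:
  assumes "f x \<noteq> f y"
  shows "cyclic_next f {x, y} x = y"
  using assms by (subst cyclic_next_eq_iff) auto

lemma exists_gap:
  fixes a :: real
  assumes "finite S"
  shows "\<exists>t>a. \<forall>s\<in>S. a < s \<longrightarrow> t < s"
proof -
  define b where "b = Min (insert (a + 1) {s \<in> S. a < s})"
  have "a < b" unfolding b_def using assms by (subst Min_gr_iff) auto
  moreover have "b \<le> s" if "s \<in> S" "a < s" for s unfolding b_def using assms that by (intro Min_le) auto
  ultimately show ?thesis by (intro exI[of _ "(a + b) / 2"]) force
qed

text \<open>Real positions leave room for a new point between any two old ones, so that no
  renumbering is necessary.\<close>

lemma insert_after: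
  fixes D :: "(piece \<times> real) set"
  assumes "finite D" "u \<in> D"
  obtains z where "z \<notin> D" "fst z = fst u" "edge_end (insert z D) u = z"
    "edge_end (insert z D) z = edge_end D u"
    "\<And>x. x \<in> D \<Longrightarrow> x \<noteq> u \<Longrightarrow> edge_end (insert z D) x = edge_end D x"
proof -
  obtain t where t: "snd u < t" "\<And>s. s \<in> snd ` D \<Longrightarrow> snd u < s \<Longrightarrow> t < s"
    using exists_gap[of "snd ` D" "snd u"] assms(1) by blast
  define z where "z = (fst u, t)"
  let ?D = "insert z D"
  have zD: "z \<notin> D" using t by (force simp: z_def)
  have zu: "z \<noteq> u" using zD assms(2) by blast
  have e1: "edge_end ?D u = z"
    unfolding edge_end_def
  proof (rule iffD2[OF cyclic_next_eq_iff])
    show "u \<in> {y \<in> ?D. fst y = fst u}" using assms by simp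
    show "inj_on snd {y \<in> ?D. fst y = fst u}" by (rule inj_on_snd_piece)
    have "\<not> (snd u < snd w \<and> snd w < snd z)" if "w \<in> ?D" for w
      using that t(2)[of "snd w"] by (auto simp: z_def)
    then show "z \<in> {y \<in> ?D. fst y = fst u} \<and>
      (if snd u < snd z then \<forall>w\<in>{y \<in> ?D. fst y = fst u}. \<not> (snd u < snd w \<and> snd w < snd z)
       else \<forall>w\<in>{y \<in> ?D. fst y = fst u}. snd w \<le> snd u \<and> snd z \<le> snd w)"
      using t(1) by (simp add: z_def)
  qed (use assms in auto)
  have D: "?D - {z} = D" using zD by simp
  have rem: "edge_end D x = (if edge_end ?D x = z then edge_end ?D z else edge_end ?D x)" if "x \<in> D" for x
  proof -
    have "x \<noteq> z" using that zD by blast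
    then show ?thesis using edge_end_remove[of ?D x z] assms(1) that unfolding D by simp
  qed
  have inj: "inj_on (edge_end ?D) ?D" using edge_end_bij[of ?D] assms(1) by (simp add: bij_betw_def)
  show ?thesis
  proof (rule that[OF zD _ e1])
    show "fst z = fst u" by (simp add: z_def)
    show "edge_end ?D z = edge_end D u" using rem[OF assms(2)] e1 by simp
    fix x assume x: "x \<in> D" "x \<noteq> u"
    then have "edge_end ?D x \<noteq> z" using inj_onD[OF inj, of x u] e1 assms(2) by auto
    then show "edge_end ?D x = edge_end D x" using rem[OF x(1)] by simp
  qed
qed

lemma insert_pair:
  fixes D :: "(piece \<times> real) set"
  assumes "finite D" "u \<in> D" "v \<in> D" "fst u \<noteq> fst v"
  obtains x y where "x \<notin> D" "y \<notin> D" "x \<noteq> y" "fst x = fst u" "fst y = fst v"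
    "edge_end (insert x (insert y D)) u = x" "edge_end (insert x (insert y D)) y = v"
    "edge_end (insert x (insert y D)) x = edge_end D u"
    "\<And>z. z \<in> D \<Longrightarrow> z \<noteq> u \<Longrightarrow> edge_end D z \<noteq> v \<Longrightarrow> edge_end (insert x (insert y D)) z = edge_end D z"
proof -
  obtain x where x: "x \<notin> D" "fst x = fst u" "edge_end (insert x D) u = x"
    "edge_end (insert x D) x = edge_end D u"
    "\<And>z. z \<in> D \<Longrightarrow> z \<noteq> u \<Longrightarrow> edge_end (insert x D) z = edge_end D z"
    using insert_after[OF assms(1,2)] by metis
  let ?D1 = "insert x D"
  have fin: "finite ?D1" using assms(1) by simp
  \<comment> \<open>\<open>y\<close> is to come right before \<open>v\<close>, so it is inserted
    right after the predecessor \<open>w\<close> of \<open>v\<close>. As \<open>u\<close> and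
    \<open>v\<close> lie on different pieces, the two insertions do not interfere.\<close>
  obtain w where w: "w \<in> ?D1" "edge_end ?D1 w = v"
    using bij_betw_imp_surj_on[OF edge_end_bij[OF fin]] assms(3) by (metis imageE insertI2)
  have fw: "fst w = fst v" using edge_end_in(2)[OF fin w(1)] w(2) by simp
  obtain y where y: "y \<notin> ?D1" "fst y = fst w" "edge_end (insert y ?D1) w = y"
    "edge_end (insert y ?D1) y = edge_end ?D1 w"
    "\<And>z. z \<in> ?D1 \<Longrightarrow> z \<noteq> w \<Longrightarrow> edge_end (insert y ?D1) z = edge_end ?D1 z"
    using insert_after[OF fin w(1)] by metis
  have eq: "insert y ?D1 = insert x (insert y D)" by (rule insert_commute)
  have uw: "u \<noteq> w" "x \<noteq> w" using fw assms(4) x(2) by auto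
  show ?thesis
  proof (rule that[of x y])
    show "edge_end (insert x (insert y D)) u = x"
      using y(5)[of u] x(3) assms(2) uw unfolding eq by simp
    show "edge_end (insert x (insert y D)) y = v" using y(4) w(2) unfolding eq by simp
    show "edge_end (insert x (insert y D)) x = edge_end D u"
      using y(5)[of x] x(4) uw unfolding eq by simp
    fix z assume z: "z \<in> D" "z \<noteq> u" "edge_end D z \<noteq> v"
    then have "z \<noteq> w" using x(5)[of z] w(2) by auto
    then show "edge_end (insert x (insert y D)) z = edge_end D z"
      using y(5)[of z] x(5)[of z] z unfolding eq by simp
  qed (use x y fw in auto)
qed

section \<open>Adding one double point\<close>

lemma coloured_gluing_insert:
  assumes "coloured_gluing D R" "z \<notin> D"
  shows "coloured_gluing (insert z D) (insert (z, z) R)"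
    and "w \<noteq> z \<Longrightarrow> insert (z, z) R `` {w} = R `` {w}" and "insert (z, z) R `` {z} = {z}"
proof -
  have e: "equiv D R" and fin: "finite D" and p: "properly_coloured R"
    using assms by (auto simp: coloured_gluing_def)
  note e' = gluing_equivD[OF e]
  have nz: "(z, y) \<notin> R" "(y, z) \<notin> R" for y using e'(1) assms(2) by blast+
  have "equiv (insert z D) (insert (z, z) R)"
  proof (intro equivI refl_onI symI transI)
    show "insert (z, z) R \<subseteq> insert z D \<times> insert z D" using e'(1) by blast
    show "(x, x) \<in> insert (z, z) R" if "x \<in> insert z D" for x using that e'(2) by blast
    show "(y, x) \<in> insert (z, z) R" if "(x, y) \<in> insert (z, z) R" for x y using that e'(3) by blast
    show "(x, v) \<in> insert (z, z) R" if "(x, y) \<in> insert (z, z) R" "(y, v) \<in> insert (z, z) R" for x y v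
      using that e'(4) nz by blast
  qed
  moreover have "properly_coloured (insert (z, z) R)"
    using p unfolding properly_coloured_iff by blast
  ultimately show "coloured_gluing (insert z D) (insert (z, z) R)"
    using fin by (simp add: coloured_gluing_def)
  show "w \<noteq> z \<Longrightarrow> insert (z, z) R `` {w} = R `` {w}" by auto
  show "insert (z, z) R `` {z} = {z}" using nz by auto
qed

lemma num_faces_insert:
  assumes R: "coloured_gluing D R" "z \<notin> D" and I: "finite I" "fst ` insert z D \<subseteq> I"
  shows "num_faces I (insert z D) (insert (z, z) R) = num_faces I D R"
proof -
  have "(z, z) \<notin> R" using R gluing_equivD(1)[of D R] by (auto simp: coloured_gluing_def)
  then have "insert z D - {z} = D" "insert (z, z) R - {(z, z)} = R" using R(2) by auto
  then show ?thesis
    using num_faces_remove[OF coloured_gluing_insert(1)[OF R] I, of z] coloured_gluing_insert(3)[OF R] by simp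
qed

context
  fixes D :: "(piece \<times> 'a::linorder) set" and R x y D2 R0 R2
  assumes R: "coloured_gluing D R" and xy: "x \<notin> D" "y \<notin> D" "colour x \<noteq> colour y"
  defines "D2 \<equiv> insert x (insert y D)"
    and "R0 \<equiv> insert (x, x) (insert (y, y) R)"
    and "R2 \<equiv> R \<union> {x, y} \<times> {x, y}"
begin

lemma add_pair_trivial:
  shows "coloured_gluing D2 R0" "w \<in> D \<Longrightarrow> R0 `` {w} = R `` {w}" "R0 `` {x} = {x}" "R0 `` {y} = {y}"
proof -
  have ne: "x \<noteq> y" using xy by auto
  note a = coloured_gluing_insert[OF R xy(2)]
  have "x \<notin> insert y D" using xy ne by auto
  note b = coloured_gluing_insert[OF a(1) this]
  show "coloured_gluing D2 R0" using b(1) by (simp add: D2_def R0_def)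
  show "R0 `` {x} = {x}" using b(3) by (simp add: R0_def)
  show "R0 `` {y} = {y}" using b(2)[of y] a(3) ne by (simp add: R0_def)
  show "R0 `` {w} = R `` {w}" if "w \<in> D"
  proof -
    have "w \<noteq> x" "w \<noteq> y" using that xy by auto
    then show ?thesis using b(2)[of w] a(2)[of w] by (simp add: R0_def)
  qed
qed

lemma add_pair_classes:
  shows "coloured_gluing D2 R2" "w \<in> D \<Longrightarrow> R2 `` {w} = R `` {w}" "R2 `` {x} = {x, y}" "R2 `` {y} = {x, y}"
proof -
  have e: "equiv D R" and fin: "finite D" and p: "properly_coloured R"
    using R by (auto simp: coloured_gluing_def)
  note e' = gluing_equivD[OF e]
  have n: "(x, w) \<notin> R" "(w, x) \<notin> R" "(y, w) \<notin> R" "(w, y) \<notin> R" for w using e'(1) xy by blast+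
  have "equiv D2 R2"
  proof (intro equivI refl_onI symI transI)
    show "R2 \<subseteq> D2 \<times> D2" using e'(1) unfolding R2_def D2_def by blast
    show "(a, a) \<in> R2" if "a \<in> D2" for a using that e'(2) unfolding R2_def D2_def by blast
    show "(b, a) \<in> R2" if "(a, b) \<in> R2" for a b using that e'(3) unfolding R2_def by blast
    show "(a, c) \<in> R2" if "(a, b) \<in> R2" "(b, c) \<in> R2" for a b c
      using that e'(4) n unfolding R2_def by blast
  qed
  moreover have "properly_coloured R2"
    unfolding properly_coloured_iff
  proof (intro allI impI)
    fix a b assume "(a, b) \<in> R2" "colour a = colour b"
    then show "a = b" using p[unfolded properly_coloured_iff] xy(3) unfolding R2_def by fastforce
  qed
  ultimately show "coloured_gluing D2 R2" using fin by (simp add: coloured_gluing_def D2_def)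
  show "R2 `` {x} = {x, y}" "R2 `` {y} = {x, y}" using n unfolding R2_def by auto
  show "w \<in> D \<Longrightarrow> R2 `` {w} = R `` {w}" using xy unfolding R2_def by auto
qed

lemma add_pair_node_next:
  shows "w \<in> D \<Longrightarrow> node_next R2 w = node_next R w" "node_next R2 x = y" "node_next R2 y = x"
    "w \<in> D \<Longrightarrow> node_next R0 w = node_next R w" "node_next R0 x = x" "node_next R0 y = y"
  using add_pair_trivial add_pair_classes cyclic_next_pair[of colour x y] cyclic_next_pair[of colour y x] xy(3)
  by (auto simp: node_next_def insert_commute)

text \<open>As trivial points \<open>x\<close> and \<open>y\<close> are fixed by the node successor,
  after the gluing they are exchanged; nothing else changes around the vertices, and the edges are
  the same in both cases.\<close>

lemma add_pair_face_step:
  assumes "w \<in> D2"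
  shows "face_step D2 R2 w = Transposition.transpose x y (face_step D2 R0 w)"
proof -
  have fin: "finite D2" using add_pair_trivial(1) by (simp add: coloured_gluing_def)
  have "edge_end D2 w \<in> D2" using edge_end_in[OF fin assms] by simp
  then consider "edge_end D2 w \<in> D" | "edge_end D2 w = x" | "edge_end D2 w = y" by (auto simp: D2_def)
  then show ?thesis
  proof cases
    case 1
    then have "node_next R (edge_end D2 w) \<in> D" using node_next_in[OF R] by simp
    then have "node_next R (edge_end D2 w) \<noteq> x" "node_next R (edge_end D2 w) \<noteq> y" using xy by auto
    then show ?thesis using 1 by (simp add: face_step_node_next add_pair_node_next)
  qed (simp_all add: face_step_node_next add_pair_node_next)
qed

text \<open>Inserting \<open>x\<close> and \<open>y\<close> as trivial points keeps the faces. The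
  gluing then multiplies the face permutation by a transposition, so it splits a face if
  \<open>x\<close> and \<open>y\<close> lie on the same one and merges two otherwise.\<close>

lemma add_pair_num_faces:
  assumes I: "finite I" "fst ` D2 \<subseteq> I"
  shows "y \<in> orbit (face_step D2 R0) x \<Longrightarrow> num_faces I D2 R2 = num_faces I D R + 1"
    and "y \<notin> orbit (face_step D2 R0) x \<Longrightarrow> num_faces I D R = num_faces I D2 R2 + 1"
proof -
  have ne: "x \<noteq> y" using xy by auto
  have fin: "finite D2" using add_pair_trivial(1) by (simp add: coloured_gluing_def)
  have "num_faces I D2 R0 = num_faces I (insert y D) (insert (y, y) R)"
    unfolding D2_def R0_def using coloured_gluing_insert(1)[OF R xy(2)] xy(1) ne I
    by (intro num_faces_insert) (auto simp: D2_def)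
  also have "\<dots> = num_faces I D R"
    using R xy I by (intro num_faces_insert) (auto simp: D2_def)
  finally have 0: "num_faces I D2 R0 = num_faces I D R" .
  have in2: "x \<in> D2" "y \<in> D2" by (auto simp: D2_def)
  note b = face_step_bij[OF add_pair_trivial(1)]
  show "num_faces I D2 R2 = num_faces I D R + 1" if "y \<in> orbit (face_step D2 R0) x"
    using card_orbits_transpose_split[OF fin b in2 that ne add_pair_face_step] 0 by (simp add: num_faces_def)
  show "num_faces I D R = num_faces I D2 R2 + 1" if "y \<notin> orbit (face_step D2 R0) x"
    using card_orbits_transpose_merge[OF fin b in2 that add_pair_face_step] 0 by (simp add: num_faces_def)
qed

lemma add_pair_card:
  shows "card D2 = card D + 2" "card (D2 // R2) = card (D // R) + 1"
proof -
  have ne: "x \<noteq> y" using xy by auto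
  have e: "equiv D R" and fin: "finite D" using R by (auto simp: coloured_gluing_def)
  show "card D2 = card D + 2" using fin xy ne by (simp add: D2_def)
  have "D2 // R2 = insert {x, y} ((\<lambda>w. R2 `` {w}) ` D)"
    using add_pair_classes(3,4) by (auto simp: quotient_def D2_def)
  also have "(\<lambda>w. R2 `` {w}) ` D = (\<lambda>w. R `` {w}) ` D" using add_pair_classes(2) by (intro image_cong) auto
  also have "\<dots> = D // R" by (auto simp: quotient_def)
  finally have *: "D2 // R2 = insert {x, y} (D // R)" .
  have "{x, y} \<notin> D // R" using in_quotient_imp_subset[OF e, of "{x, y}"] xy by blast
  moreover have "finite (D // R)" using finite_quotient[OF fin] gluing_equivD(1)[OF e] by blast
  ultimately show "card (D2 // R2) = card (D // R) + 1" using * by simp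
qed

end

text \<open>Numbers of vertices and faces are tracked instead of the genus, which is read off at the
  end. Connectedness is kept apart because the intermediate stages of the tree leave pieces
  unglued.\<close>

definition generic :: "piece set \<Rightarrow> (piece \<times> real) set \<Rightarrow> real gluing \<Rightarrow> nat \<Rightarrow> nat \<Rightarrow> bool" where
  "generic I D R V p \<longleftrightarrow> coloured_gluing D R \<and> fst ` D \<subseteq> I \<and> (\<forall>x\<in>D. card (R `` {x}) = 2) \<and>
     card (D // R) = V \<and> card D = 2 * V \<and> num_faces I D R = p"

lemma generic_add_pair:
  assumes gen: "generic I D R V p" and I: "finite I"
    and xy: "x \<notin> D" "y \<notin> D" "colour x \<noteq> colour y" "fst x \<in> I" "fst y \<in> I"
  defines "D2 \<equiv> insert x (insert y D)"
    and "R0 \<equiv> insert (x, x) (insert (y, y) R)"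
    and "R2 \<equiv> R \<union> {x, y} \<times> {x, y}"
  shows "y \<in> orbit (face_step D2 R0) x \<Longrightarrow> generic I D2 R2 (V + 1) (p + 1)"
    and "y \<notin> orbit (face_step D2 R0) x \<Longrightarrow> generic I D2 R2 (V + 1) (p - 1)"
proof -
  have R: "coloured_gluing D R" using gen by (simp add: generic_def)
  have sub: "fst ` D2 \<subseteq> I" using gen xy by (auto simp: generic_def D2_def)
  have two: "card (R2 `` {w}) = 2" if "w \<in> D2" for w
    using that gen xy(3) add_pair_classes(2-4)[OF R xy(1-3)] unfolding generic_def D2_def R2_def
    by (elim insertE) (auto simp: card_insert_if)
  note c = add_pair_card[OF R xy(1-3), folded D2_def R2_def]
  note f = add_pair_num_faces[OF R xy(1-3), of I, folded D2_def R2_def R0_def, OF I sub]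
  note g = add_pair_classes(1)[OF R xy(1-3), folded D2_def R2_def]
  show "y \<in> orbit (face_step D2 R0) x \<Longrightarrow> generic I D2 R2 (V + 1) (p + 1)"
    using f(1) gen c g sub two by (simp add: generic_def)
  show "generic I D2 R2 (V + 1) (p - 1)" if "y \<notin> orbit (face_step D2 R0) x"
  proof -
    have "num_faces I D2 R2 = p - 1" using f(2)[OF that] gen unfolding generic_def by linarith
    then show ?thesis using gen c g sub two by (simp add: generic_def)
  qed
qed

section \<open>Trees, additional faces and handles\<close>

lemma connected_gluing_mono:
  assumes "connected_gluing I R" "R \<subseteq> R'"
  shows "connected_gluing I R'"
proof -
  have "((\<lambda>(x, y). (fst x, fst y)) ` R)\<^sup>* \<subseteq> ((\<lambda>(x, y). (fst x, fst y)) ` R')\<^sup>*"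
    using assms(2) by (intro rtrancl_mono image_mono)
  then show ?thesis using assms(1) unfolding connected_gluing_def by blast
qed

lemma connected_gluing_insert:
  assumes "connected_gluing J R" "R \<subseteq> R'" "(x, y) \<in> R'" "(y, x) \<in> R'" "fst x = c" "fst y \<in> J"
  shows "connected_gluing (insert c J) R'"
proof -
  let ?Q = "((\<lambda>(x, y). (fst x, fst y)) ` R')\<^sup>*"
  have J: "(a, b) \<in> ?Q" if "a \<in> J" "b \<in> J" for a b
    using connected_gluing_mono[OF assms(1,2)] that unfolding connected_gluing_def by blast
  have "(c, fst y) \<in> ?Q" "(fst y, c) \<in> ?Q"
    using assms(3-5) by (force intro!: r_into_rtrancl simp: image_iff)+
  then have "(c, a) \<in> ?Q" "(a, c) \<in> ?Q" if "a \<in> J" for a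
    using J[OF that assms(6)] J[OF assms(6) that] by (meson rtrancl_trans)+
  then show ?thesis using J unfolding connected_gluing_def by blast
qed

text \<open>The new piece \<open>c\<close> carries only \<open>x\<close>, so \<open>x\<close> is
  alone on a face and \<open>y\<close> lies on another one; gluing merges the two. The position
  \<open>t\<close> is one that no point on any piece uses.\<close>

lemma tree_step:
  assumes I: "finite I" "J \<subseteq> I" "c \<in> I" "c \<notin> J" "c' \<in> J" "fst c \<noteq> fst c'"
    and gen: "generic I D R V p" "fst ` D \<subseteq> J" "connected_gluing J R"
  shows "\<exists>D R. generic I D R (V + 1) (p - 1) \<and> fst ` D \<subseteq> insert c J \<and> connected_gluing (insert c J) R"
proof -
  have R: "coloured_gluing D R" and fin: "finite D" using gen by (auto simp: generic_def coloured_gluing_def)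
  obtain t where t: "t \<notin> snd ` D" using ex_new_if_finite[OF infinite_UNIV_char_0, of "snd ` D"] fin by blast
  define x y :: "piece \<times> real" where "x = (c, 0)" and "y = (c', t)"
  have xy: "x \<notin> D" "y \<notin> D" "colour x \<noteq> colour y" "fst x \<in> I" "fst y \<in> I"
    using I gen(2) t by (force simp: x_def y_def colour_def image_iff)+
  let ?D2 = "insert x (insert y D)" and ?R0 = "insert (x, x) (insert (y, y) R)"
    and ?R2 = "R \<union> {x, y} \<times> {x, y}"
  have "fst z \<noteq> fst x" if "z \<in> insert y D" for z
    using that I gen(2) by (auto simp: x_def y_def)
  then have "edge_end ?D2 x = x" using edge_end_eq_self_iff[of ?D2 x] fin by auto
  then have "face_step ?D2 ?R0 x = x"
    using add_pair_node_next(5)[OF R xy(1-3)] by (simp add: face_step_node_next)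
  then have "orbit (face_step ?D2 ?R0) x = {x}" by (simp add: orbit_eq_singleton_iff)
  then have "y \<notin> orbit (face_step ?D2 ?R0) x" using xy by auto
  from generic_add_pair(2)[OF gen(1) I(1) xy this]
  have "generic I ?D2 ?R2 (V + 1) (p - 1)" .
  moreover have "fst ` ?D2 \<subseteq> insert c J" using gen(2) I by (auto simp: x_def y_def)
  moreover have "connected_gluing (insert c J) ?R2"
    using gen(3) I by (intro connected_gluing_insert[where x = x and y = y]) (auto simp: x_def y_def)
  ultimately show ?thesis by blast
qed

text \<open>Pieces outside \<open>J\<close> are uncut and count as one face each, which explains
  \<open>1 + card (I - J)\<close>. Starting from two pieces of different colours, every further
  piece can be attached to one of them, since its colour differs from at least one.\<close>

lemma tree_exists:
  assumes I: "finite I" "a \<in> I" "b \<in> I" "fst a \<noteq> fst b"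
  shows "\<exists>D R. generic I D R (card I - 1) 1 \<and> connected_gluing I R"
proof -
  define T where "T J \<longleftrightarrow> (\<exists>D R. generic I D R (card J - 1) (1 + card (I - J)) \<and> fst ` D \<subseteq> J \<and> connected_gluing J R)" for J
  have step: "T (insert c J)" if "T J" "J \<subseteq> I" "c \<in> I" "c \<notin> J" "c' \<in> J" "fst c \<noteq> fst c'" for c c' J
  proof -
    from that(1) obtain D R where "generic I D R (card J - 1) (1 + card (I - J))" "fst ` D \<subseteq> J" "connected_gluing J R"
      by (auto simp: T_def)
    from tree_step[OF I(1) that(2-6) this]
    have *: "\<exists>D R. generic I D R (card J - 1 + 1) (1 + card (I - J) - 1) \<and> fst ` D \<subseteq> insert c J \<and> connected_gluing (insert c J) R" .
    have fin: "finite J" "J \<noteq> {}" using that I finite_subset by blast+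
    have "card (insert c J) - 1 = card J - 1 + 1" using fin that by (simp add: card_gt_0_iff Suc_leI)
    moreover have "card (I - J) = card (I - insert c J) + 1"
      using that I(1) by (metis DiffI card_Suc_Diff1 finite_Diff Diff_insert Suc_eq_plus1)
    ultimately show ?thesis unfolding T_def using * by simp
  qed
  have "T {a}"
    unfolding T_def
  proof (intro exI[of _ "{}"] conjI)
    have "card I = 1 + card (I - {a})" using card_Suc_Diff1[OF I(1,2)] by linarith
    then show "generic I {} {} (card {a} - 1) (1 + card (I - {a}))"
      by (simp add: generic_def coloured_gluing_def properly_coloured_def num_faces_def equiv_def refl_on_def)
    show "connected_gluing {a} {}" by (simp add: connected_gluing_def)
  qed simp
  then have "T (insert b {a})" using I step[of "{a}" b a] by auto
  have "T (J \<union> {a, b})" if "finite J" "J \<subseteq> I" for J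
    using that
  proof (induction J rule: finite_induct)
    case (insert c J)
    show ?case
    proof (cases "c \<in> J \<union> {a, b}")
      case True
      then have "insert c J \<union> {a, b} = J \<union> {a, b}" by blast
      then show ?thesis using insert by simp
    next
      case False
      have "\<exists>c'\<in>{a, b}. fst c \<noteq> fst c'" using I(4) by auto
      then obtain c' where "c' \<in> {a, b}" "fst c \<noteq> fst c'" by blast
      then have "T (insert c (J \<union> {a, b}))" using insert I False step[of "J \<union> {a, b}" c c'] by auto
      then show ?thesis by (simp only: Un_insert_left)
    qed
  qed (use \<open>T (insert b {a})\<close> in \<open>simp add: insert_commute\<close>)
  from this[OF I(1) order_refl] have "T I" using I by (simp add: insert_absorb)
  then show ?thesis by (auto simp: T_def)
qed

lemma generic_partner:
  assumes "generic I D R V p" "u \<in> D"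
  obtains v where "v \<in> D" "colour u \<noteq> colour v" "node_next R u = v" "node_next R v = u"
proof -
  have R: "coloured_gluing D R" and two: "card (R `` {u}) = 2" using assms by (auto simp: generic_def)
  have u: "u \<in> R `` {u}" using class_props(3)[OF R assms(2)] .
  obtain a b where ab: "R `` {u} = {a, b}" "a \<noteq> b" using two by (meson card_2_iff)
  define v where "v = (if u = a then b else a)"
  have v: "R `` {u} = {u, v}" "u \<noteq> v" using ab u by (auto simp: v_def)
  have c: "colour u \<noteq> colour v" using class_props(2)[OF R, of u] v by (auto simp: inj_on_def)
  have uv: "(u, v) \<in> R" using v by auto
  have "R `` {v} = R `` {u}" using equiv_class_eq[OF _ uv] R by (auto simp: coloured_gluing_def)
  then have "node_next R v = u" using v c cyclic_next_pair[of colour v u] by (simp add: node_next_def insert_commute)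
  moreover have "node_next R u = v" using v c cyclic_next_pair[of colour u v] by (simp add: node_next_def)
  moreover have "v \<in> D" using v class_props(4)[OF R, of u] by auto
  ultimately show ?thesis using that c by blast
qed

text \<open>
  A new double point \<open>x = y\<close> right after \<open>u\<close> and right before \<open>v\<close> splits off a digon with the edges
  \<open>u\<close> and \<open>y\<close>.
\<close>

lemma add_digon:
  assumes gen: "generic I D R V p" and I: "finite I" and uv: "u \<in> D" "v \<in> D" "colour u \<noteq> colour v"
    "node_next R u = v" "node_next R v = u"
  obtains x y where "x \<notin> D" "y \<notin> D" "colour x \<noteq> colour y" "fst x = fst u" "fst y = fst v"
    "edge_end (insert x (insert y D)) u = x" "edge_end (insert x (insert y D)) y = v"
    "generic I (insert x (insert y D)) (R \<union> {x, y} \<times> {x, y}) (V + 1) (p + 1)"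
proof -
  have R: "coloured_gluing D R" and fin: "finite D" using gen by (auto simp: generic_def coloured_gluing_def)
  have "fst u \<noteq> fst v" using uv(3) by (auto simp: colour_def)
  from insert_pair[OF fin uv(1,2) this]
  obtain x y where xy: "x \<notin> D" "y \<notin> D" "x \<noteq> y" "fst x = fst u" "fst y = fst v"
    "edge_end (insert x (insert y D)) u = x" "edge_end (insert x (insert y D)) y = v" by metis
  have c: "colour x \<noteq> colour y" using uv(3) xy by (simp add: colour_def)
  let ?D2 = "insert x (insert y D)" and ?R0 = "insert (x, x) (insert (y, y) R)"
  note nn = add_pair_node_next[OF R xy(1,2) c]
  \<comment> \<open>With \<open>x\<close> and \<open>y\<close> still trivial, the face runs from
    \<open>y\<close> to \<open>v\<close>, across the vertex to \<open>u\<close>, and on to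
    \<open>x\<close>: both new points lie on one face, so gluing them splits it.\<close>
  have "face_step ?D2 ?R0 y = u" using xy nn(4)[OF uv(2)] uv by (simp add: face_step_node_next)
  moreover have "face_step ?D2 ?R0 u = x" using xy nn(5) by (simp add: face_step_node_next)
  ultimately have xo: "x \<in> orbit (face_step ?D2 ?R0) y" by (metis orbit.base orbit.step)
  have b: "finite ?D2" "bij_betw (face_step ?D2 ?R0) ?D2 ?D2"
    using fin face_step_bij[OF add_pair_trivial(1)[OF R xy(1,2) c]] by auto
  have "y \<in> orbit (face_step ?D2 ?R0) y" using orbit_self[OF b] by simp
  from orbit_swap[OF this xo] have "y \<in> orbit (face_step ?D2 ?R0) x" .
  moreover have "fst x \<in> I" "fst y \<in> I" using gen uv xy by (auto simp: generic_def)
  ultimately have "generic I ?D2 (R \<union> {x, y} \<times> {x, y}) (V + 1) (p + 1)"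
    using generic_add_pair(1)[OF gen I xy(1,2) c] by blast
  then show ?thesis using that xy c by blast
qed

lemma add_face:
  assumes gen: "generic I D R V p" and I: "finite I" "connected_gluing I R" and D: "D \<noteq> {}"
  shows "\<exists>D R. generic I D R (V + 1) (p + 1) \<and> connected_gluing I R \<and> D \<noteq> {}"
proof -
  obtain u where u: "u \<in> D" using D by blast
  obtain v where v: "v \<in> D" "colour u \<noteq> colour v" "node_next R u = v" "node_next R v = u"
    using generic_partner[OF gen u] by metis
  obtain x y where "generic I (insert x (insert y D)) (R \<union> {x, y} \<times> {x, y}) (V + 1) (p + 1)"
    using add_digon[OF gen I(1) u v] by metis
  moreover have "connected_gluing I (R \<union> {x, y} \<times> {x, y})"
    by (rule connected_gluing_mono[OF I(2)]) blast
  ultimately show ?thesis by blast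
qed

text \<open>A digon is split off first; then a point \<open>x'\<close> on its boundary is glued to a
  point \<open>y'\<close> outside it, which merges the digon with another face. Two more vertices
  and equally many faces amount to one more unit of genus.\<close>

lemma add_handle:
  assumes gen: "generic I D R V p" and I: "finite I" "connected_gluing I R" and D: "D \<noteq> {}"
  shows "\<exists>D R. generic I D R (V + 2) p \<and> connected_gluing I R \<and> D \<noteq> {}"
proof -
  obtain u where u: "u \<in> D" using D by blast
  obtain v where v: "v \<in> D" "colour u \<noteq> colour v" "node_next R u = v" "node_next R v = u"
    using generic_partner[OF gen u] by metis
  obtain x y where xy: "x \<notin> D" "y \<notin> D" "colour x \<noteq> colour y" "fst x = fst u" "fst y = fst v"
    "edge_end (insert x (insert y D)) u = x" "edge_end (insert x (insert y D)) y = v"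
    and gen2: "generic I (insert x (insert y D)) (R \<union> {x, y} \<times> {x, y}) (V + 1) (p + 1)"
    using add_digon[OF gen I(1) u v] by metis
  define D2 where "D2 = insert x (insert y D)"
  define R2 where "R2 = R \<union> {x, y} \<times> {x, y}"
  have R: "coloured_gluing D R" using gen by (simp add: generic_def)
  have R2: "coloured_gluing D2 R2" and fin2: "finite D2"
    using gen2 by (auto simp: generic_def coloured_gluing_def D2_def R2_def)
  have in2: "u \<in> D2" "y \<in> D2" "x \<in> D2" "v \<in> D2" using u v by (auto simp: D2_def)
  have nn2: "node_next R2 x = y" "node_next R2 v = u"
    using add_pair_node_next(1,2)[OF R xy(1-3)] v by (auto simp: R2_def)
  have "fst u \<noteq> fst y" using v xy by (auto simp: colour_def)
  from insert_pair[OF fin2 in2(1,2) this]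
  obtain x' y' where xy': "x' \<notin> D2" "y' \<notin> D2" "x' \<noteq> y'" "fst x' = fst u" "fst y' = fst y"
    "edge_end (insert x' (insert y' D2)) u = x'" "edge_end (insert x' (insert y' D2)) x' = edge_end D2 u"
    "\<And>z. z \<in> D2 \<Longrightarrow> z \<noteq> u \<Longrightarrow> edge_end D2 z \<noteq> y \<Longrightarrow> edge_end (insert x' (insert y' D2)) z = edge_end D2 z"
    by metis
  have c: "colour x' \<noteq> colour y'" using v xy' xy by (simp add: colour_def)
  let ?D4 = "insert x' (insert y' D2)" and ?R0 = "insert (x', x') (insert (y', y') R2)"
  have ne: "y \<noteq> u" "v \<noteq> y" using xy u v by auto
  have e: "edge_end ?D4 u = x'" "edge_end ?D4 x' = x" "edge_end ?D4 y = v"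
    using xy'(6,7) xy'(8)[OF in2(2) ne(1)] xy(6,7) ne(2) by (simp_all add: D2_def)
  note nn = add_pair_node_next[OF R2 xy'(1,2) c]
  \<comment> \<open>The digon, with \<open>x'\<close> inserted, is the closed cycle
    \<open>u\<close>, \<open>x'\<close>, \<open>y\<close>; the point \<open>y'\<close> is not on
    it.\<close>
  have f: "face_step ?D4 ?R0 u = x'" "face_step ?D4 ?R0 x' = y" "face_step ?D4 ?R0 y = u"
    using e nn(5) nn(4)[OF in2(3)] nn(4)[OF in2(4)] nn2 by (simp_all add: face_step_node_next)
  have "orbit (face_step ?D4 ?R0) x' \<subseteq> {x', y, u}" using f by (intro orbit_closed) auto
  moreover have "y' \<notin> {x', y, u}" using xy' in2 by auto
  ultimately have "y' \<notin> orbit (face_step ?D4 ?R0) x'" by blast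
  moreover have "fst x' \<in> I" "fst y' \<in> I" using gen u v xy xy' by (auto simp: generic_def)
  ultimately have "generic I ?D4 (R2 \<union> {x', y'} \<times> {x', y'}) (V + 1 + 1) (p + 1 - 1)"
    using generic_add_pair(2)[OF gen2[folded D2_def R2_def] I(1) xy'(1,2) c] by blast
  moreover have "connected_gluing I (R2 \<union> {x', y'} \<times> {x', y'})"
    unfolding R2_def by (rule connected_gluing_mono[OF I(2)]) blast
  ultimately show ?thesis by (intro exI[of _ ?D4] exI[of _ "R2 \<union> {x', y'} \<times> {x', y'}"]) simp
qed

text \<open>Here \<open>p\<close> counts the faces beyond the first. The tree contributes
  \<open>card I - 1\<close> vertices, each handle 2 and each further face 1. Nonemptiness of
  \<open>D\<close> is carried along because faces and handles are added at an existing
  vertex.\<close>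

lemma generic_exists:
  assumes I: "finite I" "a \<in> I" "b \<in> I" "fst a \<noteq> fst b"
  shows "\<exists>D R. generic I D R (card I - 1 + 2 * g + p) (1 + p) \<and> connected_gluing I R \<and> D \<noteq> {}"
proof (induction p)
  case 0
  show ?case
  proof (induction g)
    case 0
    obtain D R where DR: "generic I D R (card I - 1) 1" "connected_gluing I R" using tree_exists[OF I] by blast
    have "a \<noteq> b" using I by auto
    then have "card {a, b} \<le> card I" using I by (intro card_mono) auto
    then have "card D \<noteq> 0" using DR(1) \<open>a \<noteq> b\<close> by (auto simp: generic_def)
    then have "D \<noteq> {}" by auto
    then show ?case using DR by (intro exI[of _ D] exI[of _ R]) simp
  next
    case (Suc g)
    then obtain D R where "generic I D R (card I - 1 + 2 * g + 0) (1 + 0)" "connected_gluing I R" "D \<noteq> {}" by blast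
    from add_handle[OF this(1) I(1) this(2,3)] show ?case by (simp add: algebra_simps)
  qed
next
  case (Suc p)
  then obtain D R where "generic I D R (card I - 1 + 2 * g + p) (1 + p)" "connected_gluing I R" "D \<noteq> {}" by blast
  from add_face[OF this(1) I(1) this(2,3)] show ?case by simp
qed

text \<open>The condition on \<open>V\<close> is Euler's formula for a gluing with
  \<open>2 * V\<close> edges.\<close>

lemma generic_core:
  assumes "generic I D R V p" "connected_gluing I R" "int V = int (card I) + int p + 2 * int g - 2"
  shows "core I D R g p"
proof -
  have R: "coloured_gluing D R" using assms by (simp add: generic_def)
  then have e: "equiv D R" by (simp add: coloured_gluing_def)
  have "R `` {x} \<noteq> {x}" if "x \<in> D" for x using assms(1) that by (auto simp: generic_def)
  then have "D \<subseteq> gluing_points R" using gluing_points_iff[OF e] by blast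
  moreover have "gluing_points R \<subseteq> D" using core_restriction(1)[OF e] .
  ultimately show ?thesis
    using assms by (auto simp: core_def generic_def has_genus_def)
qed

section \<open>Resolution of multiple vertices\<close>

lemma node_next_eq_self:
  assumes R: "coloured_gluing D R" "x \<in> D" and "node_next R x = x"
  shows "R `` {x} = {x}"
proof -
  note cl = class_props[OF R(1), of x]
  have x: "x \<in> R `` {x}" using cl(3) R(2) by simp
  have "\<forall>z\<in>R `` {x}. colour z \<le> colour x \<and> colour x \<le> colour z"
    using iffD1[OF cyclic_next_eq_iff[OF cl(1,2) x] assms(3)[unfolded node_next_def]] by simp
  then have "z = x" if "z \<in> R `` {x}" for z
    using inj_onD[OF cl(2) _ that x] that by (simp add: order_antisym)
  then show ?thesis using x by blast
qed

text \<open>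
  A vertex of multiplicity at least 3 is resolved by detaching the point \<open>x1\<close> from its class and
  gluing it to a new point \<open>z\<close>, placed on the piece of the cyclically next point \<open>x2\<close> right after
  \<open>x2\<close>. The face permutation changes by the 3-cycle \<open>(x1 x2)(x2 z)\<close>, which splits off and
  merges back one cycle.
\<close>

lemma core_resolve:
  fixes D :: "(piece \<times> real) set"
  assumes c: "core I D R g p" and I: "finite I" and x1: "x1 \<in> D" "card (R `` {x1}) \<noteq> 2"
  shows "\<exists>D' R'. core I D' R' g p \<and> D \<subseteq> D' \<and> card D' = card D + 1"
proof -
  have R: "coloured_gluing D R" and DI: "fst ` D \<subseteq> I" and con: "connected_gluing I R"
    and gen: "has_genus I D R g" and nf: "num_faces I D R = p" and gp: "gluing_points R = D"
    using c by (auto simp: core_def)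
  have e: "equiv D R" and fin: "finite D" and pc: "properly_coloured R" using R by (auto simp: coloured_gluing_def)
  note e' = gluing_equivD[OF e]
  define C where "C = R `` {x1}"
  define x2 where "x2 = node_next R x1"
  have C3: "3 \<le> card C" using core_class_card[OF c x1(1)] x1(2) by (simp add: C_def)
  have x1C: "x1 \<in> C" using class_props(3)[OF R x1(1)] by (simp add: C_def)
  have R12: "(x1, x2) \<in> R" and x2D: "x2 \<in> D" using node_next_in[OF R x1(1)] by (auto simp: x2_def)
  have x12: "x2 \<noteq> x1"
  proof
    assume "x2 = x1"
    then have "C = {x1}" using node_next_eq_self[OF R x1(1)] by (simp add: x2_def C_def)
    then show False using C3 by simp
  qed
  have col12: "colour x1 \<noteq> colour x2" using pc R12 x12 unfolding properly_coloured_iff by blast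
  obtain z where z: "z \<notin> D" "fst z = fst x2" "edge_end (insert z D) x2 = z"
    using insert_after[OF fin x2D] by metis
  define D' where "D' = insert z D"
  \<comment> \<open>\<open>x1\<close> leaves its class and forms a double point with
    \<open>z\<close>; the rest of the class still has at least two points.\<close>
  define R' where "R' = {(a, b). (a, b) \<in> R \<and> a \<noteq> x1 \<and> b \<noteq> x1} \<union> {x1, z} \<times> {x1, z}"
  define R0 where "R0 = insert (z, z) R"
  have ne: "z \<noteq> x1" "z \<noteq> x2" using z x1 x2D by auto
  have nz: "(z, a) \<notin> R" "(a, z) \<notin> R" for a using e'(1) z(1) by blast+
  have R'_iff: "(a, b) \<in> R' \<longleftrightarrow> (a, b) \<in> R \<and> a \<noteq> x1 \<and> b \<noteq> x1 \<or> a \<in> {x1, z} \<and> b \<in> {x1, z}" for a b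
    unfolding R'_def by blast
  have fin': "finite D'" using fin by (simp add: D'_def)
  have e2: "equiv D' R'"
  proof (intro equivI refl_onI symI transI)
    show "R' \<subseteq> D' \<times> D'" using e'(1) x1(1) unfolding R'_def D'_def by blast
    show "(a, a) \<in> R'" if "a \<in> D'" for a using that e'(2) unfolding R'_iff D'_def by blast
    show "(b, a) \<in> R'" if "(a, b) \<in> R'" for a b using that e'(3) unfolding R'_iff by blast
    show "(a, d) \<in> R'" if "(a, b) \<in> R'" "(b, d) \<in> R'" for a b d
      using that e'(4) nz unfolding R'_iff by blast
  qed
  have col: "colour x1 \<noteq> colour z" using col12 z(2) by (simp add: colour_def)
  have pc2: "properly_coloured R'"
    unfolding properly_coloured_iff
  proof (intro allI impI)
    fix a b assume "(a, b) \<in> R'" "colour a = colour b"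
    then show "a = b" using pc[unfolded properly_coloured_iff] col unfolding R'_iff by fastforce
  qed
  have cg: "coloured_gluing D' R'" using fin' e2 pc2 by (simp add: coloured_gluing_def)
  have cl1: "R' `` {x1} = {x1, z}" using ne nz unfolding R'_def by auto
  have cl2: "R' `` {z} = {x1, z}" using ne nz unfolding R'_def by auto
  have cl3: "R' `` {w} = R `` {w} - {x1}" if "w \<in> D" "w \<noteq> x1" for w
  proof -
    have "w \<noteq> z" using that z(1) by auto
    then show ?thesis using that unfolding R'_def by auto
  qed
  have clC: "R `` {w} = C" if "w \<in> C" for w
    using that equiv_class_eq[OF e, of x1 w] unfolding C_def by blast
  have notC: "x1 \<notin> R `` {w}" if "w \<notin> C" for w
    using that e'(3) unfolding C_def by blast
  have nn1: "node_next R' x1 = z" "node_next R' z = x1"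
    using cl1 cl2 cyclic_next_pair[of colour x1 z] cyclic_next_pair[of colour z x1] col
    by (simp_all add: node_next_def insert_commute)
  have nn3: "node_next R' w = (if node_next R w = x1 then x2 else node_next R w)" if w: "w \<in> D" "w \<noteq> x1" for w
  proof (cases "w \<in> C")
    case True
    then have "node_next R' w = cyclic_next colour (C - {x1}) w" using cl3[OF w] clC by (simp add: node_next_def)
    also have "\<dots> = (if cyclic_next colour C w = x1 then cyclic_next colour C x1 else cyclic_next colour C w)"
      using class_props(1,2)[OF R, of x1] True w(2) x1C unfolding C_def by (intro cyclic_next_remove)
    finally show ?thesis using clC[OF True] clC[OF x1C] by (simp add: node_next_def x2_def)
  next
    case False
    then have "node_next R' w = node_next R w" using cl3[OF w] notC by (simp add: node_next_def)
    moreover have "node_next R w \<noteq> x1" using node_next_in(1)[OF R w(1)] notC[OF False] by auto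
    ultimately show ?thesis by simp
  qed
  have R0: "coloured_gluing D' R0" using coloured_gluing_insert(1)[OF R z(1)] by (simp add: D'_def R0_def)
  have nn0: "node_next R0 w = node_next R w" if "w \<in> D" for w
  proof -
    have "w \<noteq> z" using that z(1) by auto
    then show ?thesis using coloured_gluing_insert(2)[OF R z(1)] by (simp add: R0_def node_next_def)
  qed
  have nn0z: "node_next R0 z = z" using coloured_gluing_insert(3)[OF R z(1)] by (simp add: R0_def node_next_def)
  have injn: "node_next R w \<noteq> x2" if "w \<in> D" "w \<noteq> x1" for w
    using inj_onD[OF bij_betw_imp_inj_on[OF node_next_bij[OF R]], of w x1] that x1(1) by (auto simp: x2_def)
  \<comment> \<open>The predecessor of \<open>x1\<close> is now followed by \<open>x2\<close>, while
    \<open>x1\<close> and \<open>z\<close> are exchanged. Relative to \<open>R0\<close>, where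
    \<open>z\<close> is trivial, this is a product of two transpositions.\<close>
  have tr: "node_next R' w = Transposition.transpose x2 x1 (Transposition.transpose x2 z (node_next R0 w))" if "w \<in> D'" for w
  proof -
    consider "w = z" | "w = x1" | "w \<in> D" "w \<noteq> x1" using \<open>w \<in> D'\<close> by (auto simp: D'_def)
    then show ?thesis
    proof cases
      case 1
      then show ?thesis using nn1 nn0z by simp
    next
      case 2
      then have "node_next R0 w = x2" using nn0[OF x1(1)] by (simp add: x2_def)
      moreover have "node_next R' w = z" using 2 nn1 by simp
      ultimately show ?thesis using ne by (simp add: transpose_apply_other)
    next
      case 3
      have "node_next R w \<noteq> z" using node_next_in(2)[OF R 3(1)] z(1) by auto
      then show ?thesis using nn3[OF 3] nn0[OF 3(1)] injn[OF 3] by (simp add: transpose_apply_other)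
    qed
  qed
  define f1 where "f1 w = Transposition.transpose x2 z (face_step D' R0 w)" for w
  have in': "x1 \<in> D'" "x2 \<in> D'" "z \<in> D'" using x1 x2D by (auto simp: D'_def)
  note b0 = face_step_bij[OF R0]
  \<comment> \<open>\<open>z\<close> was placed directly after \<open>x2\<close> and is trivial in
    \<open>R0\<close>, so the face continues from \<open>x2\<close> to \<open>z\<close> and the
    first transposition splits it.\<close>
  have f0x2: "face_step D' R0 x2 = z" using z(3) nn0z by (simp add: face_step_node_next D'_def)
  have "card (orbit f1 ` D') = card (orbit (face_step D' R0) ` D') + 1"
    using ne f0x2 orbit.base[of "face_step D' R0" x2]
    by (intro card_orbits_transpose_split[OF fin' b0 in'(2,3)]) (auto simp: f1_def)
  moreover have "card (orbit f1 ` D') = card (orbit (face_step D' R') ` D') + 1"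
  proof (rule card_orbits_transpose_merge[OF fin' _ in'(2,1)])
    show "bij_betw f1 D' D'" using bij_betw_transpose_comp[OF b0 in'(2,3)] by (simp add: f1_def)
    \<comment> \<open>After the splitting \<open>x2\<close> is a cycle of its own, so the second
      transposition merges, and the number of faces is restored.\<close>
    have "f1 x2 = x2" using f0x2 by (simp add: f1_def)
    then have "orbit f1 x2 = {x2}" by (simp add: orbit_eq_singleton_iff)
    then show "x1 \<notin> orbit f1 x2" using x12 by auto
    show "face_step D' R' w = Transposition.transpose x2 x1 (f1 w)" if "w \<in> D'" for w
      using tr[OF edge_end_in(1)[OF fin' that]] by (simp add: f1_def face_step_node_next)
  qed
  ultimately have "num_faces I D' R' = num_faces I D' R0" by (simp add: num_faces_def)
  moreover have fI: "fst ` D' \<subseteq> I" using DI z(2) x2D by (auto simp: D'_def)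
  ultimately have nf': "num_faces I D' R' = p"
    using num_faces_insert[OF R z(1) I] nf by (simp add: D'_def R0_def)
  have cD: "card D' = card D + 1" using fin z(1) by (simp add: D'_def)
  have fq: "finite (D // R)" using finite_quotient[OF fin] e'(1) by blast
  have CQ: "C \<in> D // R" using x1(1) by (auto simp: C_def quotient_def)
  have x2C: "x2 \<in> C" using R12 by (simp add: C_def)
  \<comment> \<open>There is one vertex more, which compensates for the additional edge in Euler's
    formula.\<close>
  have Q: "D' // R' = insert {x1, z} (insert (C - {x1}) (D // R - {C}))"
  proof (intro equalityI subsetI)
    fix X assume "X \<in> D' // R'"
    then obtain w where w: "w \<in> D'" "X = R' `` {w}" by (auto simp: quotient_def)
    show "X \<in> insert {x1, z} (insert (C - {x1}) (D // R - {C}))"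
    proof (cases "w \<in> {x1, z}")
      case True
      then have "X = {x1, z}" using cl1 cl2 unfolding w(2) by (elim insertE emptyE) simp_all
      then show ?thesis by blast
    next
      case False
      then have wD: "w \<in> D" "w \<noteq> x1" using w by (auto simp: D'_def)
      show ?thesis
      proof (cases "w \<in> C")
        case True
        then have "X = C - {x1}" using w(2) cl3[OF wD] clC[OF True] by simp
        then show ?thesis by blast
      next
        case F: False
        then have "X = R `` {w}" using w(2) cl3[OF wD] notC[OF F] by blast
        moreover have "R `` {w} \<noteq> C" using F class_props(3)[OF R wD(1)] by auto
        moreover have "R `` {w} \<in> D // R" using wD by (auto simp: quotient_def)
        ultimately show ?thesis by blast
      qed
    qed
  next
    fix X assume "X \<in> insert {x1, z} (insert (C - {x1}) (D // R - {C}))"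
    then consider "X = {x1, z}" | "X = C - {x1}" | "X \<in> D // R" "X \<noteq> C" by blast
    then show "X \<in> D' // R'"
    proof cases
      case 1
      then show ?thesis using cl1 in'(1) unfolding quotient_def by blast
    next
      case 2
      then have "X = R' `` {x2}" using cl3[OF x2D x12] clC[OF x2C] by simp
      then show ?thesis using in'(2) unfolding quotient_def by blast
    next
      case 3
      then obtain w where w: "w \<in> D" "X = R `` {w}" by (auto simp: quotient_def)
      then have wC: "w \<notin> C" using clC[of w] 3 by blast
      then have "w \<noteq> x1" using x1C by blast
      then have "X = R' `` {w}" using cl3[OF w(1)] notC[OF wC] w(2) by blast
      then show ?thesis using w(1) unfolding quotient_def D'_def by blast
    qed
  qed
  have sub: "X \<subseteq> D" if "X \<in> D // R" for X using in_quotient_imp_subset[OF e that] .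
  have "C - {x1} \<notin> D // R - {C}"
  proof
    assume "C - {x1} \<in> D // R - {C}"
    then have "(C - {x1}) \<inter> C = {}" using quotient_disj[OF e _ CQ, of "C - {x1}"] x1C by blast
    then show False using x2C x12 by blast
  qed
  moreover have "{x1, z} \<notin> insert (C - {x1}) (D // R - {C})"
    using sub[of "{x1, z}"] z(1) x1C by blast
  ultimately have "card (D' // R') = card (D // R - {C}) + 2" using fq unfolding Q by simp
  also have "\<dots> = card (D // R) + 1" using card_Suc_Diff1[OF fq CQ] by simp
  finally have cQ: "card (D' // R') = card (D // R) + 1" .
  have gen': "has_genus I D' R' g"
    using gen nf nf' cD cQ unfolding has_genus_def by simp
  have "gluing_points R' = D'"
  proof (rule equalityI)
    show "gluing_points R' \<subseteq> D'" using core_restriction(1)[OF e2] .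
    show "D' \<subseteq> gluing_points R'"
    proof
      fix w assume "w \<in> D'"
      then consider "w \<in> {x1, z}" | "w \<in> D" "w \<noteq> x1" "w \<notin> C" | "w \<in> D" "w \<noteq> x1" "w \<in> C" by (auto simp: D'_def)
      then show "w \<in> gluing_points R'"
      proof cases
        case 1
        have "(x1, z) \<in> R'" "(z, x1) \<in> R'" unfolding R'_iff by blast+
        then show ?thesis using 1 ne gluing_pointsI[of x1 z R'] gluing_pointsI[of z x1 R'] by blast
      next
        case 2
        then have "R' `` {w} = R `` {w}" using cl3[OF 2(1,2)] notC[OF 2(3)] by blast
        moreover have "w \<in> gluing_points R" using gp 2 by simp
        ultimately show ?thesis
          using gluing_points_iff[OF e 2(1)] gluing_points_iff[OF e2] 2(1) by (simp add: D'_def)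
      next
        case 3
        have "C \<noteq> {x1, w}" using C3 3 by (auto simp: card_insert_if)
        then obtain v where "v \<in> C" "v \<noteq> x1" "v \<noteq> w" using x1C 3 by blast
        then have "(w, v) \<in> R'" using clC[OF 3(3)] 3 unfolding R'_iff by blast
        then show ?thesis using \<open>v \<noteq> w\<close> by (metis gluing_pointsI)
      qed
    qed
  qed
  moreover have "connected_gluing I R'"
  proof -
    let ?Q = "((\<lambda>(x, y). (fst x, fst y)) ` R')\<^sup>*"
    have Q1: "(fst a, fst b) \<in> ?Q" if "(a, b) \<in> R'" for a b
      using that by (intro r_into_rtrancl image_eqI[of _ _ "(a, b)"]) simp_all
    \<comment> \<open>The piece of \<open>x1\<close> stays adjacent to that of \<open>x2\<close>,
      since \<open>z\<close> lies on the latter, and \<open>x2\<close> still meets the rest of the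
      old class.\<close>
    have x1x2: "(fst x1, fst x2) \<in> ?Q" "(fst x2, fst x1) \<in> ?Q"
      using Q1[of x1 z] Q1[of z x1] z(2) R'_iff[of x1 z] R'_iff[of z x1] by simp_all
    have x2t: "(fst x2, fst t) \<in> ?Q" "(fst t, fst x2) \<in> ?Q" if "(x1, t) \<in> R" "t \<noteq> x1" for t
    proof -
      have "(x2, t) \<in> R" "(t, x2) \<in> R" using that R12 e'(3,4) by blast+
      then show "(fst x2, fst t) \<in> ?Q" "(fst t, fst x2) \<in> ?Q" using Q1 R'_iff that x12 by blast+
    qed
    have "(fst a, fst b) \<in> ?Q" if ab: "(a, b) \<in> R" for a b
    proof -
      consider "a = b" | "a = x1" "b \<noteq> x1" | "a \<noteq> x1" "b = x1" | "a \<noteq> x1" "b \<noteq> x1" by blast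
      then show ?thesis
      proof cases
        case 2
        have "(x1, b) \<in> R" using ab unfolding 2(1) .
        from rtrancl_trans[OF x1x2(1) x2t(1)[OF this 2(2)]] show ?thesis unfolding 2(1) .
      next
        case 3
        then have "(x1, a) \<in> R" using ab e'(3) by blast
        from rtrancl_trans[OF x2t(2)[OF this 3(1)] x1x2(2)] show ?thesis unfolding 3(2) .
      next
        case 4
        then have "(a, b) \<in> R'" using R'_iff[of a b] ab by blast
        then show ?thesis by (rule Q1)
      qed simp
    qed
    then have "(\<lambda>(x, y). (fst x, fst y)) ` R \<subseteq> ?Q"
      by (intro image_subsetI) (simp only: case_prod_beta prod.collapse)
    then have "((\<lambda>(x, y). (fst x, fst y)) ` R)\<^sup>* \<subseteq> ?Q" by (rule rtrancl_subset_rtrancl)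
    then show ?thesis using con unfolding connected_gluing_def by blast
  qed
  ultimately have "core I D' R' g p" using cg fI gen' nf' by (simp add: core_def)
  then show ?thesis using cD unfolding D'_def by blast
qed

text \<open>Each resolution adds one point while \<open>card D\<close> is bounded by
  \<open>d + card I\<close>; the process can stop only when all classes are pairs, which is when the
  bound is attained.\<close>

lemma core_resolve_all:
  fixes D :: "(piece \<times> real) set"
  assumes "core I D R g p" "finite I" "int d = 4 * int g - 4 + int (card I) + 2 * int p"
  shows "\<exists>D' R'. core I D' R' g p \<and> D \<subseteq> D' \<and> card D' = d + card I"
  using assms(1)
proof (induction "d + card I - card D" arbitrary: D R)
  case 0
  then have "card D = d + card I" using core_card(1)[OF 0(2) assms(3)] by simp
  then show ?case using 0 by blast
next
  case (Suc k)
  have "card D \<noteq> d + card I" using Suc(2) by simp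
  then obtain x where "x \<in> D" "card (R `` {x}) \<noteq> 2" using core_card(2)[OF Suc(3) assms(3)] by blast
  from core_resolve[OF Suc(3) assms(2) this] obtain D' R' where D': "core I D' R' g p" "D \<subseteq> D'" "card D' = card D + 1"
    by blast
  have "k = d + card I - card D'" using Suc(2) D'(3) by simp
  from Suc(1)[OF this D'(1)] D'(2) show ?case by blast
qed

section \<open>Resolution and existence in terms of arc numbers\<close>

lemma cores_of_core:
  fixes D :: "(piece \<times> real) set"
  assumes "core I D R g p" "finite I"
  shows "cores I g p (arc_numbers I D) \<noteq> {}" "(\<Sum>c\<in>I. arc_numbers I D c) = card D"
proof -
  have D: "finite D" "fst ` D \<subseteq> I" using assms by (auto simp: core_def coloured_gluing_def)
  show "cores I g p (arc_numbers I D) \<noteq> {}"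
    using bij_betw_imp_surj_on[OF bij_betw_cores[OF assms(2) D, of g p]] assms(1) by blast
  have "card D = card (\<Union>c\<in>I. {y \<in> D. fst y = c})"
    using D(2) by (intro arg_cong[where f = card]) blast
  also have "\<dots> = (\<Sum>c\<in>I. arc_numbers I D c)"
    using D(1) assms(2) by (subst card_UN_disjoint) (auto simp: arc_numbers_def)
  finally show "(\<Sum>c\<in>I. arc_numbers I D c) = card D" by simp
qed

text \<open>Embedding the standard corners into real positions makes room for the resolution. Since
  points are only added, no arc number decreases; the asymptotics need this comparison on each
  piece.\<close>

lemma cores_resolve:
  assumes "cores I g p r \<noteq> {}" "finite I" "int d = 4 * int g - 4 + int (card I) + 2 * int p"
  shows "\<exists>r'\<in>extensional I. cores I g p r' \<noteq> {} \<and> (\<Sum>c\<in>I. r' c) = d + card I \<and> (\<forall>c\<in>I. r c \<le> r' c)"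
proof -
  obtain S where S: "core I (corners I r) S g p" using assms(1) by (auto simp: cores_def)
  define h :: "piece \<times> nat \<Rightarrow> piece \<times> real" where "h x = (fst x, real (snd x))" for x
  have inj: "inj h" by (auto simp: h_def inj_def prod_eq_iff)
  have "cyclic_shift {} (corners I r) h" by (simp add: cyclic_shift_def h_def)
  then have "cyclic_embedding (corners I r) h"
    using inj_on_subset[OF inj, of "corners I r"] unfolding cyclic_embedding_def by (auto simp: h_def)
  moreover have "equiv (corners I r) S" using S by (simp add: core_def coloured_gluing_def)
  ultimately have "core I (h ` corners I r) (map_prod h h ` S) g p"
    using core_image[OF finite_corners[OF assms(2)]] S by blast
  from core_resolve_all[OF this assms(2,3)]
  obtain D R where D: "core I D R g p" "h ` corners I r \<subseteq> D" "card D = d + card I" by blast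
  have fin: "finite D" using D by (simp add: core_def coloured_gluing_def)
  have "r c \<le> arc_numbers I D c" if c: "c \<in> I" for c
  proof -
    have "h (c, t) \<in> D \<and> fst (h (c, t)) = c" if "t < r c" for t
      using subsetD[OF D(2) imageI, of "(c, t)"] c that by (simp add: corners_iff h_def)
    then have "(\<lambda>t. h (c, t)) ` {..<r c} \<subseteq> {y \<in> D. fst y = c}" by blast
    then have "card ((\<lambda>t. h (c, t)) ` {..<r c}) \<le> card {y \<in> D. fst y = c}" using fin by (intro card_mono) auto
    moreover have "card ((\<lambda>t. h (c, t)) ` {..<r c}) = r c" by (subst card_image) (auto simp: inj_on_def h_def)
    ultimately show ?thesis using c by (simp add: arc_numbers_def)
  qed
  moreover have "arc_numbers I D \<in> extensional I" by (simp add: arc_numbers_def)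
  ultimately show ?thesis using cores_of_core[OF D(1) assms(2)] D(3) by metis
qed

text \<open>A tree with \<open>g\<close> handles and \<open>p - 1\<close> further faces has just the
  number of vertices that Euler's formula requires.\<close>

lemma cores_exist:
  assumes I: "finite I" "a \<in> I" "b \<in> I" "fst a \<noteq> fst b" and p: "1 \<le> p"
  shows "\<exists>r. cores I g p r \<noteq> {}"
proof -
  obtain D R where DR: "generic I D R (card I - 1 + 2 * g + (p - 1)) (1 + (p - 1))" "connected_gluing I R"
    using generic_exists[OF I] by blast
  have "card I > 0" using I by (auto simp: card_gt_0_iff)
  then have "core I D R g p" using p DR by (intro generic_core[OF _ DR(2)]) auto
  then show ?thesis using cores_of_core(1) I(1) by blast
qed

section \<open>Charts of the space of circle constellations\<close>

lemma circle_points_iff: "x \<in> circle_points I l \<longleftrightarrow> fst x \<in> I \<and> 0 \<le> snd x \<and> snd x < l (fst x)"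
  by (cases x) (simp add: circle_points_def)

lemma rotate_point_simp: "rotate_point l s x = (fst x, (snd x + s (fst x)) rmod l (fst x))"
  by (cases x) (simp add: rotate_point_def)

lemma rmod_add_left: "((x::real) rmod z + y) rmod z = (x + y) rmod z"
  by (metis rmod_add rmod_rmod)

definition rotate_gluing :: "(piece \<Rightarrow> real) \<Rightarrow> (piece \<Rightarrow> real) \<Rightarrow> real gluing \<Rightarrow> real gluing" where
  "rotate_gluing l s R = map_prod (rotate_point l s) (rotate_point l s) ` R"

lemma circle_iso_class_eq: "circle_iso_class l R = range (\<lambda>s. rotate_gluing l s R)"
  by (simp add: circle_iso_class_def rotate_gluing_def)

lemma rotate_point_add: "rotate_point l t (rotate_point l s x) = rotate_point l (\<lambda>c. s c + t c) x"
  by (simp add: rotate_point_simp rmod_add_left add.assoc)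

lemma rotate_gluing_add: "rotate_gluing l t (rotate_gluing l s R) = rotate_gluing l (\<lambda>c. s c + t c) R"
  unfolding rotate_gluing_def image_image
  by (intro image_cong refl) (simp add: map_prod_def case_prod_beta rotate_point_add)

lemma rotate_gluing_cong:
  assumes "R \<subseteq> circle_points I l \<times> circle_points I l" "\<And>c. c \<in> I \<Longrightarrow> [s c = t c] (rmod l c)"
  shows "rotate_gluing l s R = rotate_gluing l t R"
  unfolding rotate_gluing_def
proof (rule map_prod_image_cong[OF assms(1)])
  fix x assume "x \<in> circle_points I l"
  then have "[snd x + s (fst x) = snd x + t (fst x)] (rmod l (fst x))"
    using assms(2) by (intro rcong_add) (auto simp: circle_points_iff)
  then show "rotate_point l s x = rotate_point l t x" by (simp add: rotate_point_simp rcong_def)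
qed

lemma arc_start_simp: "arc_start a x = (fst x, \<Sum>u<snd x. a (fst x, u))"
  by (cases x) (simp add: arc_start_def)

text \<open>A strictly increasing enumeration is the sorted list of its image, so the image
  determines its length and its values.\<close>

lemma strict_enumeration_unique:
  fixes f f' :: "nat \<Rightarrow> real"
  assumes "\<And>i j. i < j \<Longrightarrow> j < r \<Longrightarrow> f i < f j" "\<And>i j. i < j \<Longrightarrow> j < r' \<Longrightarrow> f' i < f' j"
    and "f ` {..<r} = f' ` {..<r'}"
  shows "r = r'" "i < r \<Longrightarrow> f i = f' i"
proof -
  have list: "sorted_list_of_set (f ` {..<r}) = map f [0..<r]"
    if "\<And>i j. i < j \<Longrightarrow> j < r \<Longrightarrow> f i < f j" for f :: "nat \<Rightarrow> real" and r
  proof -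
    have "sorted_wrt (<) (map f [0..<r])" using that by (auto simp: sorted_wrt_iff_nth_less)
    then have "sorted (map f [0..<r])" "distinct (map f [0..<r])"
      by (auto simp: strict_sorted_iff)
    then have "sorted_list_of_set (set (map f [0..<r])) = map f [0..<r]"
      by (rule sorted_list_of_set.idem_if_sorted_distinct)
    moreover have "set (map f [0..<r]) = f ` {..<r}" by (simp add: lessThan_atLeast0)
    ultimately show ?thesis by simp
  qed
  have eq: "map f [0..<r] = map f' [0..<r']"
    using list[of r f] list[of r' f'] assms by metis
  then have "length (map f [0..<r]) = length (map f' [0..<r'])" by (rule arg_cong)
  then show rr: "r = r'" by simp
  assume "i < r"
  then have "map f [0..<r] ! i = f i" "map f' [0..<r'] ! i = f' i" using rr by simp_all
  then show "f i = f' i" using eq by simp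
qed

context
  fixes I :: "piece set" and l :: "piece \<Rightarrow> real"
  assumes I: "finite I" and l: "\<And>c. c \<in> I \<Longrightarrow> 0 < l c"
begin

lemma rotate_point_embedding:
  shows "cyclic_embedding (circle_points I l) (rotate_point l s)" "rotate_point l s ` circle_points I l = circle_points I l"
proof -
  \<comment> \<open>\<open>W\<close> consists of the points that the rotation carries past the
    origin of their circle.\<close>
  define W where "W = {x. l (fst x) \<le> snd x + s (fst x) rmod l (fst x)}"
  have val: "snd (rotate_point l s x) =
      (if x \<in> W then snd x + s (fst x) rmod l (fst x) - l (fst x) else snd x + s (fst x) rmod l (fst x))"
    if x: "x \<in> circle_points I l" for x
  proof -
    let ?l = "l (fst x)" and ?s = "s (fst x) rmod l (fst x)"
    have l0: "0 < ?l" and *: "0 \<le> snd x" "snd x < ?l" "0 \<le> ?s" "?s < ?l"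
      using x l[of "fst x"] rmod_nonneg[of ?l "s (fst x)"] rmod_less[of ?l "s (fst x)"] by (auto simp: circle_points_iff)
    have "(snd x + s (fst x)) rmod ?l = (snd x + ?s) rmod ?l"
      using rmod_add_left[of "s (fst x)" ?l "snd x"] by (simp add: add.commute)
    also have "\<dots> = (if x \<in> W then snd x + ?s - ?l else snd x + ?s)"
    proof (cases "x \<in> W")
      case True
      have "(snd x + ?s) rmod ?l = snd x + ?s - ?l"
        using * True l0 by (intro rmod_unique[where n = 1]) (auto simp: W_def)
      then show ?thesis using True by simp
    next
      case False
      then show ?thesis using * l0 by (simp add: W_def)
    qed
    finally show ?thesis by (simp add: rotate_point_simp)
  qed
  have lt: "0 \<le> snd x" "snd x < l (fst x)" if "x \<in> circle_points I l" for x using that by (simp_all add: circle_points_iff)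
  have "inj_on (rotate_point l s) (circle_points I l)"
  proof (rule inj_onI)
    fix x y assume *: "x \<in> circle_points I l" "y \<in> circle_points I l" "rotate_point l s x = rotate_point l s y"
    then have f: "fst x = fst y" by (simp add: rotate_point_simp)
    moreover have "snd x = snd y"
      using val[OF *(1)] val[OF *(2)] *(3) f lt[OF *(1)] lt[OF *(2)] by (auto simp: W_def split: if_splits)
    ultimately show "x = y" by (rule prod_eqI)
  qed
  moreover have "cyclic_shift W (circle_points I l) (rotate_point l s)"
    unfolding cyclic_shift_def
  proof (intro ballI impI conjI)
    fix x y assume *: "x \<in> circle_points I l" "y \<in> circle_points I l" "fst x = fst y"
    show "snd (rotate_point l s x) < snd (rotate_point l s y) \<longleftrightarrow> snd x < snd y" if "x \<in> W \<longleftrightarrow> y \<in> W"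
      using that val[OF *(1)] val[OF *(2)] *(3) by auto
    assume xy: "x \<notin> W \<and> y \<in> W"
    then show "snd x < snd y" using *(3) by (auto simp: W_def)
    show "snd (rotate_point l s y) < snd (rotate_point l s x)"
      using xy val[OF *(1)] val[OF *(2)] *(3) lt[OF *(1)] lt[OF *(2)] by auto
  qed
  ultimately show "cyclic_embedding (circle_points I l) (rotate_point l s)"
    unfolding cyclic_embedding_def by (auto simp: rotate_point_simp)
  have sub: "rotate_point l s ` circle_points I l \<subseteq> circle_points I l" for s
  proof (rule image_subsetI)
    fix x assume "x \<in> circle_points I l"
    then show "rotate_point l s x \<in> circle_points I l"
      using l[of "fst x"] rmod_nonneg[of "l (fst x)"] rmod_less[of "l (fst x)"]
      by (auto simp: circle_points_iff rotate_point_simp)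
  qed
  show "rotate_point l s ` circle_points I l = circle_points I l"
  proof (rule equalityI[OF sub subsetI])
    \<comment> \<open>The carrier is infinite, so surjectivity does not follow from injectivity; the
      opposite rotation supplies preimages.\<close>
    fix x assume x: "x \<in> circle_points I l"
    have "rotate_point l s (rotate_point l (\<lambda>c. - s c) x) = x"
      unfolding rotate_point_add using lt[OF x] by (simp add: rotate_point_simp)
    moreover have "rotate_point l (\<lambda>c. - s c) x \<in> circle_points I l" using sub x by blast
    ultimately show "x \<in> rotate_point l s ` circle_points I l" by (metis imageI)
  qed
qed

lemma rotate_gluing_zero:
  assumes "R \<subseteq> circle_points I l \<times> circle_points I l"
  shows "rotate_gluing l (\<lambda>_. 0) R = R"
proof -
  have "rotate_gluing l (\<lambda>_. 0) R = map_prod (\<lambda>x. x) (\<lambda>x. x) ` R"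
    unfolding rotate_gluing_def
    by (rule map_prod_image_cong[OF assms]) (auto simp: rotate_point_simp circle_points_iff)
  then show ?thesis by (simp add: map_prod_def case_prod_beta)
qed

lemma rotate_gluing_equiv:
  assumes "equiv (circle_points I l) R"
  shows "equiv (circle_points I l) (rotate_gluing l s R)"
  using equiv_image[OF _ assms, of "rotate_point l s"] rotate_point_embedding[of s]
  by (simp add: rotate_gluing_def cyclic_embedding_def)

lemma circle_iso_class_rotate:
  assumes "R \<subseteq> circle_points I l \<times> circle_points I l"
  shows "circle_iso_class l (rotate_gluing l s R) = circle_iso_class l R"
proof -
  have sub: "circle_iso_class l (rotate_gluing l s R) \<subseteq> circle_iso_class l R" for s R
    unfolding circle_iso_class_eq rotate_gluing_add by auto
  have "rotate_gluing l (\<lambda>c. - s c) (rotate_gluing l s R) = R"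
    unfolding rotate_gluing_add using rotate_gluing_zero[OF assms] by simp
  then show ?thesis using sub[of s R] sub[of "\<lambda>c. - s c" "rotate_gluing l s R"] by simp
qed

lemma circle_iso_class_self:
  assumes "R \<subseteq> circle_points I l \<times> circle_points I l"
  shows "R \<in> circle_iso_class l R"
  unfolding circle_iso_class_eq using rotate_gluing_zero[OF assms] by (metis rangeI)

text \<open>Circle constellations are closed under rotation, so whether a class belongs to the space
  can be tested on any of its members.\<close>

lemma circle_space_iff:
  assumes "equiv (circle_points I l) R"
  shows "circle_iso_class l R \<in> circle_space I l g p \<longleftrightarrow> R \<in> gluings I (circle_points I l) g p"
proof
  assume "R \<in> gluings I (circle_points I l) g p"
  then show "circle_iso_class l R \<in> circle_space I l g p"
    by (simp add: circle_space_def circle_constellations_eq_gluings)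
next
  assume "circle_iso_class l R \<in> circle_space I l g p"
  then obtain R' where R': "R' \<in> gluings I (circle_points I l) g p" "circle_iso_class l R = circle_iso_class l R'"
    by (auto simp: circle_space_def circle_constellations_eq_gluings)
  then obtain s where "R = rotate_gluing l s R'"
    using circle_iso_class_self[OF gluing_equivD(1)[OF assms]] by (auto simp: circle_iso_class_eq)
  then show "R \<in> gluings I (circle_points I l) g p"
    using gluings_image[OF rotate_point_embedding R'(1)] by (simp add: rotate_gluing_def)
qed

text \<open>The distinguished representative of the class given by a chart: the first arc of each
  circle starts at position 0. It allows working with gluings instead of classes.\<close>

definition chart_gluing :: "nat gluing \<Rightarrow> (piece \<times> nat \<Rightarrow> real) \<Rightarrow> real gluing" where
  "chart_gluing S a = Id_on (circle_points I l) \<union> map_prod (arc_start a) (arc_start a) ` S"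

lemma chart_map_eq: "chart_map I l S a = circle_iso_class l (chart_gluing S a)"
  by (simp add: chart_map_def chart_gluing_def)

section \<open>Gluings given by a chart\<close>

context
  fixes r :: "piece \<Rightarrow> nat" and S :: "nat gluing" and a :: "piece \<times> nat \<Rightarrow> real"
  assumes chart: "(r, S) \<in> charts I" and dom: "a \<in> chart_domain I l r"
begin

lemma chart_r: "c \<in> I \<Longrightarrow> 1 \<le> r c"
  using chart unfolding charts_def by (auto dest: PiE_mem)

lemma arc_pos: "c \<in> I \<Longrightarrow> u < r c - 1 \<Longrightarrow> 0 < a (c, u)"
  using dom unfolding chart_domain_def arc_coords_def by (auto dest!: PiE_mem)

lemma arc_start_less:
  assumes "c \<in> I" "i < j" "j < r c"
  shows "(\<Sum>u<i. a (c, u)) < (\<Sum>u<j. a (c, u))"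
  using assms arc_pos[OF assms(1)] by (intro sum_strict_mono2[of "{..<j}" "{..<i}" i]) (auto intro: less_imp_le)

lemma arc_start_bounds:
  assumes "c \<in> I" "j < r c"
  shows "0 \<le> (\<Sum>u<j. a (c, u))" "(\<Sum>u<j. a (c, u)) < l c"
proof -
  show "0 \<le> (\<Sum>u<j. a (c, u))" using assms arc_pos[OF assms(1)] by (intro sum_nonneg) (auto intro: less_imp_le)
  have "(\<Sum>u<j. a (c, u)) \<le> (\<Sum>u<r c - 1. a (c, u))"
    using assms arc_pos[OF assms(1)] by (intro sum_mono2) (auto intro: less_imp_le)
  also have "\<dots> < l c" using dom assms(1) unfolding chart_domain_def by blast
  finally show "(\<Sum>u<j. a (c, u)) < l c" .
qed

lemma arc_start_embedding:
  shows "cyclic_embedding (corners I r) (arc_start a)" "arc_start a ` corners I r \<subseteq> circle_points I l"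
proof -
  have less: "snd (arc_start a x) < snd (arc_start a y) \<longleftrightarrow> snd x < snd y"
    if "x \<in> corners I r" "y \<in> corners I r" "fst x = fst y" for x y
  proof -
    have "fst y \<in> I" "snd x < r (fst y)" "snd y < r (fst y)" using that by (auto simp: corners_iff)
    then show ?thesis
      using arc_start_less[of "fst y" "snd x" "snd y"] arc_start_less[of "fst y" "snd y" "snd x"] that(3)
      by (cases "snd x" "snd y" rule: linorder_cases) (auto simp: arc_start_simp)
  qed
  have "inj_on (arc_start a) (corners I r)"
  proof (rule inj_onI)
    fix x y assume *: "x \<in> corners I r" "y \<in> corners I r" "arc_start a x = arc_start a y"
    then have f: "fst x = fst y" by (simp add: arc_start_simp)
    then have "snd x = snd y" using less[OF *(1,2)] less[OF *(2,1)] *(3) by simp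
    with f show "x = y" by (rule prod_eqI)
  qed
  then show "cyclic_embedding (corners I r) (arc_start a)"
    unfolding cyclic_embedding_def cyclic_shift_def using less
    by (intro conjI exI[of _ "{}"]) (auto simp: arc_start_simp)
  show "arc_start a ` corners I r \<subseteq> circle_points I l"
  proof (rule image_subsetI)
    fix x assume "x \<in> corners I r"
    then show "arc_start a x \<in> circle_points I l"
      using arc_start_bounds[of "fst x" "snd x"] by (simp add: corners_iff circle_points_iff arc_start_simp)
  qed
qed

lemma chart_equiv: "equiv (corners I r) S" and chart_two: "x \<in> corners I r \<Longrightarrow> card (S `` {x}) = 2"
  using chart by (auto simp: charts_def)

lemma chart_gluing_points: "gluing_points S = corners I r"
proof (rule equalityI)
  show "gluing_points S \<subseteq> corners I r" using core_restriction(1)[OF chart_equiv] .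
  have "S `` {x} \<noteq> {x}" if "x \<in> corners I r" for x using chart_two[OF that] by auto
  then show "corners I r \<subseteq> gluing_points S" using gluing_points_iff[OF chart_equiv] by blast
qed

lemma chart_gluing_props:
  shows "equiv (circle_points I l) (chart_gluing S a)" "gluing_points (chart_gluing S a) = arc_start a ` corners I r"
    "chart_gluing S a \<inter> (arc_start a ` corners I r) \<times> (arc_start a ` corners I r) = map_prod (arc_start a) (arc_start a) ` S"
proof -
  have inj: "inj_on (arc_start a) (corners I r)" using arc_start_embedding(1) by (simp add: cyclic_embedding_def)
  have e: "equiv (arc_start a ` corners I r) (map_prod (arc_start a) (arc_start a) ` S)"
    using equiv_image[OF inj chart_equiv] .
  have gp: "gluing_points (map_prod (arc_start a) (arc_start a) ` S) = arc_start a ` corners I r"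
    using gluing_points_image[OF inj gluing_equivD(1)[OF chart_equiv]] chart_gluing_points by simp
  show "equiv (circle_points I l) (chart_gluing S a)" "gluing_points (chart_gluing S a) = arc_start a ` corners I r"
    "chart_gluing S a \<inter> (arc_start a ` corners I r) \<times> (arc_start a ` corners I r) = map_prod (arc_start a) (arc_start a) ` S"
    using core_extension[OF e arc_start_embedding(2) gp] unfolding chart_gluing_def by auto
qed

lemma chart_gluing_class:
  assumes "x \<in> corners I r"
  shows "card (chart_gluing S a `` {arc_start a x}) = 2"
proof -
  have inj: "inj_on (arc_start a) (corners I r)" using arc_start_embedding(1) by (simp add: cyclic_embedding_def)
  have sub: "S \<subseteq> corners I r \<times> corners I r" using gluing_equivD(1)[OF chart_equiv] .
  have x: "x \<in> S `` {x}" using gluing_equivD(2)[OF chart_equiv assms] by simp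
  have "chart_gluing S a `` {arc_start a x} = insert (arc_start a x) ((map_prod (arc_start a) (arc_start a) ` S) `` {arc_start a x})"
  proof -
    have "arc_start a x \<in> circle_points I l" using assms arc_start_embedding(2) by blast
    then have "Id_on (circle_points I l) `` {arc_start a x} = {arc_start a x}" by blast
    then show ?thesis unfolding chart_gluing_def Un_Image by simp
  qed
  also have "\<dots> = arc_start a ` (S `` {x})" unfolding relation_image_class[OF inj sub assms] using x by blast
  finally have "card (chart_gluing S a `` {arc_start a x}) = card (arc_start a ` (S `` {x}))" by simp
  also have "\<dots> = card (S `` {x})" using sub by (intro card_image inj_on_subset[OF inj]) blast
  finally show ?thesis using chart_two[OF assms] by simp
qed

text \<open>The condition does not involve \<open>a\<close>, so a chart contributes either with its
  whole domain or not at all.\<close>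

lemma chart_map_in_circle_space: "chart_map I l S a \<in> circle_space I l g p \<longleftrightarrow> S \<in> cores I g p r"
proof -
  have "chart_map I l S a \<in> circle_space I l g p \<longleftrightarrow> chart_gluing S a \<in> gluings I (circle_points I l) g p"
    unfolding chart_map_eq by (rule circle_space_iff[OF chart_gluing_props(1)])
  also have "\<dots> \<longleftrightarrow> core I (arc_start a ` corners I r) (map_prod (arc_start a) (arc_start a) ` S) g p"
    unfolding gluings_def using chart_gluing_props by simp
  also have "\<dots> \<longleftrightarrow> S \<in> cores I g p r"
    unfolding cores_def using core_image[OF finite_corners[OF I] chart_equiv arc_start_embedding(1)] by simp
  finally show ?thesis .
qed

end

text \<open>The gluing points on a circle, in increasing order, are the partial sums of the arc
  lengths, so they determine \<open>r\<close> and, by differences, \<open>a\<close>; then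
  \<open>S\<close> is recovered from the classes.\<close>

lemma chart_gluing_inj:
  assumes "(r, S) \<in> charts I" "a \<in> chart_domain I l r" "(r', S') \<in> charts I" "a' \<in> chart_domain I l r'"
    and eq: "chart_gluing S a = chart_gluing S' a'"
  shows "r = r'" "S = S'" "a = a'"
proof -
  let ?st = "\<lambda>a c j. \<Sum>u<j. a (c, u)"
  have D: "arc_start a ` corners I r = arc_start a' ` corners I r'"
    using chart_gluing_props(2)[OF assms(1,2)] chart_gluing_props(2)[OF assms(3,4)] eq by simp
  have im: "?st a c ` {..<r c} = {t. (c, t) \<in> arc_start a ` corners I r}" if "c \<in> I" for a :: "piece \<times> nat \<Rightarrow> real" and r c
  proof (intro equalityI subsetI)
    fix t assume "t \<in> ?st a c ` {..<r c}"
    then obtain j where "j < r c" "t = ?st a c j" by blast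
    then have "(c, t) = arc_start a (c, j)" "(c, j) \<in> corners I r" using that by (simp_all add: arc_start_simp corners_iff)
    then show "t \<in> {t. (c, t) \<in> arc_start a ` corners I r}" by blast
  next
    fix t assume "t \<in> {t. (c, t) \<in> arc_start a ` corners I r}"
    then obtain x where "x \<in> corners I r" "(c, t) = arc_start a x" by blast
    then have "snd x < r c" "t = ?st a c (snd x)" by (auto simp: arc_start_simp corners_iff)
    then show "t \<in> ?st a c ` {..<r c}" by blast
  qed
  have u: "r c = r' c" "i < r c \<Longrightarrow> ?st a c i = ?st a' c i" if c: "c \<in> I" for c i
  proof -
    have "?st a c ` {..<r c} = ?st a' c ` {..<r' c}" using im[OF c, of a r] im[OF c, of a' r'] D by simp
    note q = strict_enumeration_unique[OF arc_start_less[OF assms(1,2) c] arc_start_less[OF assms(3,4) c] this]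
    show "r c = r' c" by (rule q(1))
    show "i < r c \<Longrightarrow> ?st a c i = ?st a' c i" by (rule q(2))
  qed
  show r: "r = r'"
    using assms(1,3) u(1) by (intro extensionalityI[of _ I]) (auto simp: charts_def PiE_def)
  show "a = a'"
  proof (rule extensionalityI[of _ "arc_coords I r"])
    show "a \<in> extensional (arc_coords I r)" "a' \<in> extensional (arc_coords I r)"
      using assms(2,4) r by (auto simp: chart_domain_def PiE_def)
    fix x assume "x \<in> arc_coords I r"
    then have x: "fst x \<in> I" "Suc (snd x) < r (fst x)" by (auto simp: arc_coords_def)
    have "?st a (fst x) (Suc (snd x)) - ?st a (fst x) (snd x) = ?st a' (fst x) (Suc (snd x)) - ?st a' (fst x) (snd x)"
      using u(2)[OF x(1), of "Suc (snd x)"] u(2)[OF x(1), of "snd x"] x(2) by simp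
    then show "a x = a' x" by simp
  qed
  then have "map_prod (arc_start a) (arc_start a) ` S = map_prod (arc_start a) (arc_start a) ` S'"
    using chart_gluing_props(3)[OF assms(1,2)] chart_gluing_props(3)[OF assms(3,4)] eq r by simp
  moreover have "inj_on (map_prod (arc_start a) (arc_start a)) (corners I r \<times> corners I r)"
    using arc_start_embedding(1)[OF assms(1,2)] by (intro map_prod_inj_on) (auto simp: cyclic_embedding_def)
  moreover have "S \<subseteq> corners I r \<times> corners I r" "S' \<subseteq> corners I r \<times> corners I r"
    using gluing_equivD(1)[OF chart_equiv[OF assms(1,2)]] gluing_equivD(1)[OF chart_equiv[OF assms(3,4)]] r by auto
  ultimately show "S = S'" by (simp only: inj_on_image_eq_iff)
qed

text \<open>The gluing points are numbered in increasing order, and the arc lengths are the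
  consecutive differences. A point at position 0 must be present on each circle since the first arc
  starts there.\<close>

lemma chart_of_gluing:
  assumes G: "equiv (circle_points I l) G" "finite (gluing_points G)" and two: "\<And>x. x \<in> gluing_points G \<Longrightarrow> card (G `` {x}) = 2"
    and zero: "\<And>c. c \<in> I \<Longrightarrow> (c, 0) \<in> gluing_points G"
  shows "\<exists>r S a. (r, S) \<in> charts I \<and> a \<in> chart_domain I l r \<and> chart_gluing S a = G"
proof -
  define D where "D = gluing_points G"
  have DX: "D \<subseteq> circle_points I l" using core_restriction(1)[OF G(1)] by (simp add: D_def)
  have D: "finite D" "fst ` D \<subseteq> I" using G(2) DX by (auto simp: D_def circle_points_iff)
  define r where "r = arc_numbers I D"
  define h where "h = enum_points D"
  note enum = enum_points[OF D, folded r_def h_def]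
  have inj: "inj_on h (corners I r)" using enum(2) by (simp add: cyclic_embedding_def)
  have fsth: "fst (h x) = fst x" for x by (simp add: h_def enum_points_def)
  have r1: "1 \<le> r c" if "c \<in> I" for c
  proof -
    have "{y \<in> D. fst y = c} \<noteq> {}" using zero[OF that] by (auto simp: D_def)
    then show ?thesis using that D(1) by (simp add: r_def arc_numbers_def card_gt_0_iff Suc_leI)
  qed
  define S where "S = {(x, y). x \<in> corners I r \<and> y \<in> corners I r \<and> (h x, h y) \<in> G}"
  define a where "a = (\<lambda>x\<in>arc_coords I r. snd (h (fst x, Suc (snd x))) - snd (h x))"
  note e = gluing_equivD[OF G(1)]
  have hD: "h x \<in> D" if "x \<in> corners I r" for x using that enum(1) by blast
  \<comment> \<open>0 is the smallest possible position and it occurs by assumption, so it gets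
    number 0.\<close>
  have e0: "snd (h (c, 0)) = 0" if c: "c \<in> I" for c
  proof -
    obtain x where x: "x \<in> corners I r" "h x = (c, 0)" using zero[OF c] enum(1) unfolding D_def by (metis imageE)
    have fx: "fst x = c" using fsth[of x] x(2) by simp
    have "0 \<le> snd (h (c, 0))"
      using hD[of "(c, 0)"] r1[OF c] c DX by (auto simp: corners_iff circle_points_iff)
    moreover have "snd (h (c, 0)) \<le> snd (h x)"
    proof (cases "snd x = 0")
      case True
      then have "x = (c, 0)" using fx by (simp add: prod_eq_iff)
      then show ?thesis by simp
    next
      case False
      have "x = (c, snd x)" using fx by (simp add: prod_eq_iff)
      moreover have "snd x < r c" using x(1) fx by (simp add: corners_iff)
      ultimately show ?thesis using enum(3)[OF c, of 0 "snd x"] False by simp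
    qed
    ultimately show ?thesis using x(2) by simp
  qed
  have tel: "(\<Sum>u<j. a (c, u)) = snd (h (c, j))" if c: "c \<in> I" and j: "j < r c" for c j
    using j
  proof (induction j)
    case 0
    then show ?case using e0[OF c] by simp
  next
    case (Suc j)
    have "(c, j) \<in> arc_coords I r" using c Suc.prems by (auto simp: arc_coords_def)
    then show ?case using Suc by (simp add: a_def)
  qed
  have start: "arc_start a x = h x" if "x \<in> corners I r" for x
    using tel[of "fst x" "snd x"] that fsth[of x] by (simp add: arc_start_simp corners_iff prod_eq_iff)
  have Siff: "(x, y) \<in> S \<longleftrightarrow> x \<in> corners I r \<and> y \<in> corners I r \<and> (h x, h y) \<in> G" for x y by (simp add: S_def)
  have SG: "map_prod h h ` S = G \<inter> D \<times> D"
  proof (intro equalityI subsetI)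
    fix u assume "u \<in> map_prod h h ` S"
    then obtain w where w: "u = map_prod h h w" "w \<in> S" by (rule imageE)
    have u: "u = (h (fst w), h (snd w))" unfolding w(1) by (simp add: map_prod_def case_prod_beta)
    have "(fst w, snd w) \<in> S" using w(2) by simp
    then have "fst w \<in> corners I r" "snd w \<in> corners I r" "(h (fst w), h (snd w)) \<in> G"
      unfolding Siff by blast+
    then show "u \<in> G \<inter> D \<times> D" using hD unfolding u by blast
  next
    fix u assume u: "u \<in> G \<inter> D \<times> D"
    then obtain v w where "u = (v, w)" "v \<in> D" "w \<in> D" by blast
    moreover obtain x where "x \<in> corners I r" "v = h x" using \<open>v \<in> D\<close> enum(1) by (metis imageE)
    moreover obtain y where "y \<in> corners I r" "w = h y" using \<open>w \<in> D\<close> enum(1) by (metis imageE)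
    ultimately have "u = (h x, h y)" "x \<in> corners I r" "y \<in> corners I r" by simp_all
    then show "u \<in> map_prod h h ` S" using u by (intro image_eqI[of _ _ "(x, y)"]) (simp_all add: S_def)
  qed
  have eS: "equiv (corners I r) S"
  proof (intro equivI refl_onI symI transI)
    show "S \<subseteq> corners I r \<times> corners I r" unfolding S_def by blast
    show "(x, x) \<in> S" if "x \<in> corners I r" for x
      unfolding Siff using that hD[OF that] DX e(2)[of "h x"] by blast
    show "(y, x) \<in> S" if "(x, y) \<in> S" for x y using that e(3) unfolding Siff by blast
    show "(x, z) \<in> S" if "(x, y) \<in> S" "(y, z) \<in> S" for x y z using that e(4) unfolding Siff by blast
  qed
  have "card (S `` {x}) = 2" if x: "x \<in> corners I r" for x
  proof -
    have "h ` (S `` {x}) = (G \<inter> D \<times> D) `` {h x}"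
      using relation_image_class[OF inj gluing_equivD(1)[OF eS] x] SG by simp
    also have "\<dots> = G `` {h x}"
    proof -
      have "y \<in> D" if "(h x, y) \<in> G" for y
        using that e(3)[OF that] hD[OF x] gluing_pointsI[of y "h x" G] unfolding D_def by (cases "y = h x") auto
      then show ?thesis using hD[OF x] by blast
    qed
    finally have "card (h ` (S `` {x})) = 2" using two[of "h x"] hD[OF x] by (simp add: D_def)
    moreover have "S `` {x} \<subseteq> corners I r" using gluing_equivD(1)[OF eS] by blast
    ultimately show ?thesis by (simp only: card_image[OF inj_on_subset[OF inj]])
  qed
  moreover have "r \<in> (\<Pi>\<^sub>E c\<in>I. {1..})" using r1 by (auto simp: r_def arc_numbers_def)
  ultimately have chart: "(r, S) \<in> charts I" using eS by (auto simp: charts_def)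
  have dom: "a \<in> chart_domain I l r"
    unfolding chart_domain_def
  proof (intro CollectI conjI ballI)
    show "a \<in> (\<Pi>\<^sub>E x\<in>arc_coords I r. {0<..})"
    proof (rule PiE_I)
      fix x assume x: "x \<in> arc_coords I r"
      then have "fst x \<in> I" "Suc (snd x) < r (fst x)" by (auto simp: arc_coords_def)
      from enum(3)[OF this(1) lessI this(2)] show "a x \<in> {0<..}" using x by (simp add: a_def)
    qed (simp add: a_def)
    fix c assume c: "c \<in> I"
    have "(c, r c - 1) \<in> corners I r" using c r1[OF c] by (simp add: corners_iff)
    from hD[OF this] DX have "snd (h (c, r c - 1)) < l c" using fsth[of "(c, r c - 1)"] by (auto simp: circle_points_iff)
    then show "(\<Sum>t<r c - 1. a (c, t)) < l c" using tel[OF c, of "r c - 1"] r1[OF c] by simp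
  qed
  have "map_prod (arc_start a) (arc_start a) ` S = map_prod h h ` S"
    using gluing_equivD(1)[OF eS] start by (rule map_prod_image_cong)
  then have "chart_gluing S a = Id_on (circle_points I l) \<union> (G \<inter> D \<times> D)" using SG by (simp add: chart_gluing_def)
  also have "\<dots> = G" using core_restriction(4)[OF G(1)] by (simp add: D_def)
  finally show ?thesis using chart dom by blast
qed

text \<open>
  The hypothesis excludes rotational symmetries: if rotating a circle by the distance of two of its
  gluing points permutes its \<open>r c\<close> gluing points, then the sum of their positions shows that
  \<open>r c\<close> times this distance is a multiple of the length \<open>l c\<close>.
\<close>

lemma card_chart_fibre:
  assumes chart: "(r, S) \<in> charts I" and dom: "a \<in> chart_domain I l r"
    and gen: "\<And>c i j z. c \<in> I \<Longrightarrow> i < r c \<Longrightarrow> j < r c \<Longrightarrow> i \<noteq> j \<Longrightarrow>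
      real (r c) * ((\<Sum>u<j. a (c, u)) - (\<Sum>u<i. a (c, u))) \<noteq> of_int z * l c"
  shows "card (chart_fibre I l (chart_map I l S a)) = (\<Prod>c\<in>I. r c)"
proof -
  let ?st = "\<lambda>c j. \<Sum>u<j. a (c, u)"
  define G where "G = chart_gluing S a"
  define D where "D = arc_start a ` corners I r"
  define K where "K = (\<Pi>\<^sub>E c\<in>I. {..<r c})"
  \<comment> \<open>Rotates every circle so that its gluing point with number \<open>k c\<close>
    comes to position 0.\<close>
  define \<Phi> where "\<Phi> k = rotate_gluing l (\<lambda>c. - ?st c (k c)) G" for k
  let ?\<Psi> = "\<lambda>(r', S', a'). chart_gluing S' a'"
  let ?F = "chart_fibre I l (chart_map I l S a)"
  note props = chart_gluing_props[OF chart dom, folded G_def D_def]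
  have GX: "G \<subseteq> circle_points I l \<times> circle_points I l" using gluing_equivD(1)[OF props(1)] .
  have DX: "D \<subseteq> circle_points I l" using arc_start_embedding(2)[OF chart dom] by (simp add: D_def)
  have finD: "finite D" using I by (simp add: D_def)
  have gp: "gluing_points (rotate_gluing l s G) = rotate_point l s ` D" for s
    using gluing_points_image[OF _ GX, of "rotate_point l s"] rotate_point_embedding(1)[of s] props(2)
    by (simp add: rotate_gluing_def cyclic_embedding_def)
  have injr: "inj_on (rotate_point l s) (circle_points I l)" for s using rotate_point_embedding(1)[of s] by (simp add: cyclic_embedding_def)
  have inj\<Psi>: "inj_on ?\<Psi> ?F"
  proof (rule inj_onI)
    fix x y assume *: "x \<in> ?F" "y \<in> ?F" "?\<Psi> x = ?\<Psi> y"
    obtain r1 S1 a1 r2 S2 a2 where xy: "x = (r1, S1, a1)" "y = (r2, S2, a2)" by (metis prod.collapse)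
    have "(r1, S1) \<in> charts I" "a1 \<in> chart_domain I l r1" "(r2, S2) \<in> charts I" "a2 \<in> chart_domain I l r2"
      using * unfolding chart_fibre_def xy by auto
    from chart_gluing_inj[OF this] *(3) show "x = y" unfolding xy by simp
  qed
  \<comment> \<open>Elements of the fibre correspond to the members of the class that have a gluing
    point at position 0 on every circle.\<close>
  have "?\<Psi> ` ?F = \<Phi> ` K"
  proof (intro equalityI subsetI)
    fix G' assume "G' \<in> ?\<Psi> ` ?F"
    then obtain r' S' a' where chart': "(r', S') \<in> charts I" and dom': "a' \<in> chart_domain I l r'"
      and cl: "circle_iso_class l (chart_gluing S' a') = circle_iso_class l G" and G': "G' = chart_gluing S' a'"
      unfolding chart_fibre_def chart_map_eq G_def by auto
    note props' = chart_gluing_props[OF chart' dom', folded G']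
    obtain s where s: "G' = rotate_gluing l s G"
      using circle_iso_class_self[OF gluing_equivD(1)[OF props'(1)]] cl unfolding G' circle_iso_class_eq by auto
    have "\<exists>k<r c. [s c = - ?st c k] (rmod l c)" if c: "c \<in> I" for c
    proof -
      have "(c, 0) \<in> corners I r'" using c chart_r[OF chart' dom' c] by (simp add: corners_iff)
      then have "arc_start a' (c, 0) \<in> gluing_points G'" unfolding props'(2) by blast
      then have "(c, 0) \<in> rotate_point l s ` D" unfolding s gp by (simp add: arc_start_simp)
      then obtain x where "x \<in> corners I r" "(c, 0) = rotate_point l s (arc_start a x)" unfolding D_def by blast
      then have "snd x < r c" "(?st c (snd x) + s c) rmod l c = 0"
        by (auto simp: corners_iff rotate_point_simp arc_start_simp)
      then have "[s c - (- ?st c (snd x)) = 0] (rmod l c)" by (simp add: rcong_0_iff add.commute)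
      then have "[s c = - ?st c (snd x)] (rmod l c)" by (simp add: rcong_conv_diff_rmod_eq_0 rcong_0_iff)
      with \<open>snd x < r c\<close> show ?thesis by blast
    qed
    then obtain k where k: "\<And>c. c \<in> I \<Longrightarrow> k c < r c \<and> [s c = - ?st c (k c)] (rmod l c)" by metis
    have "G' = \<Phi> (restrict k I)"
      unfolding s \<Phi>_def by (rule rotate_gluing_cong[OF GX]) (use k in auto)
    moreover have "restrict k I \<in> K" using k by (auto simp: K_def)
    ultimately show "G' \<in> \<Phi> ` K" by blast
  next
    fix G' assume "G' \<in> \<Phi> ` K"
    then obtain k where k: "k \<in> K" and G': "G' = \<Phi> k" by blast
    let ?s = "\<lambda>c. - ?st c (k c)"
    have "equiv (circle_points I l) G'" unfolding G' \<Phi>_def by (rule rotate_gluing_equiv[OF props(1)])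
    moreover have gp': "gluing_points G' = rotate_point l ?s ` D" unfolding G' \<Phi>_def gp ..
    moreover have "finite (gluing_points G')" unfolding gp' using finD by simp
    moreover have "card (G' `` {x}) = 2" if "x \<in> gluing_points G'" for x
    proof -
      obtain y where y: "y \<in> corners I r" "x = rotate_point l ?s (arc_start a y)" using \<open>x \<in> gluing_points G'\<close> unfolding gp' D_def by blast
      then have yX: "arc_start a y \<in> circle_points I l" using DX unfolding D_def by blast
      have "G' `` {x} = rotate_point l ?s ` (G `` {arc_start a y})"
        unfolding G' \<Phi>_def y(2) rotate_gluing_def by (rule relation_image_class[OF injr GX yX])
      moreover have "G `` {arc_start a y} \<subseteq> circle_points I l" using GX by blast
      ultimately have "card (G' `` {x}) = card (G `` {arc_start a y})"
        by (simp only: card_image[OF inj_on_subset[OF injr]])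
      then show ?thesis using chart_gluing_class[OF chart dom y(1)] by (simp add: G_def)
    qed
    moreover have "(c, 0) \<in> gluing_points G'" if c: "c \<in> I" for c
    proof -
      have "(c, k c) \<in> corners I r" using k c by (auto simp: K_def corners_iff dest: PiE_mem)
      then have "rotate_point l ?s (arc_start a (c, k c)) \<in> gluing_points G'" unfolding gp' D_def by blast
      then show ?thesis by (simp add: rotate_point_simp arc_start_simp)
    qed
    ultimately obtain r' S' a' where c': "(r', S') \<in> charts I" "a' \<in> chart_domain I l r'" "chart_gluing S' a' = G'"
      using chart_of_gluing[of G'] by blast
    moreover have "chart_map I l S' a' = chart_map I l S a"
      unfolding chart_map_eq c'(3) G' \<Phi>_def G_def[symmetric] by (rule circle_iso_class_rotate[OF GX])
    ultimately have "(r', S', a') \<in> ?F" by (simp add: chart_fibre_def)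
    then show "G' \<in> ?\<Psi> ` ?F" using c'(3) by (intro image_eqI[of _ _ "(r', S', a')"]) simp_all
  qed
  then have "card ?F = card (\<Phi> ` K)" using card_image[OF inj\<Psi>] by simp
  also have "\<dots> = card K"
  proof (rule card_image, rule inj_onI)
    fix k k' assume k: "k \<in> K" "k' \<in> K" "\<Phi> k = \<Phi> k'"
    have im: "rotate_point l (\<lambda>c. - ?st c (k c)) ` D = rotate_point l (\<lambda>c. - ?st c (k' c)) ` D"
    proof -
      have "gluing_points (\<Phi> k) = gluing_points (\<Phi> k')" using k(3) by simp
      then show ?thesis unfolding \<Phi>_def gp .
    qed
    show "k = k'"
    proof (rule extensionalityI[of _ I])
      show "k \<in> extensional I" "k' \<in> extensional I" using k by (auto simp: K_def PiE_def)
      fix c assume c: "c \<in> I"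
      have kc: "k c < r c" "k' c < r c" using k c by (auto simp: K_def dest: PiE_mem)
      \<comment> \<open>Positions of the gluing points on \<open>c\<close> after the point with
        number \<open>m\<close> has been moved to 0. For \<open>k\<close> and \<open>k'\<close> they
        form the same set, hence have the same sum.\<close>
      define f where "f m i = (?st c i - ?st c m) rmod l c" for m i
      have img: "f (k c) ` {..<r c} = {t. (c, t) \<in> rotate_point l (\<lambda>c. - ?st c (k c)) ` D}" for k
      proof (intro equalityI subsetI)
        fix t assume "t \<in> f (k c) ` {..<r c}"
        then obtain i where "i < r c" "t = f (k c) i" by blast
        then have "(c, t) = rotate_point l (\<lambda>c. - ?st c (k c)) (arc_start a (c, i))" "(c, i) \<in> corners I r"
          using c by (simp_all add: rotate_point_simp arc_start_simp corners_iff f_def)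
        then show "t \<in> {t. (c, t) \<in> rotate_point l (\<lambda>c. - ?st c (k c)) ` D}" unfolding D_def by blast
      next
        fix t assume "t \<in> {t. (c, t) \<in> rotate_point l (\<lambda>c. - ?st c (k c)) ` D}"
        then obtain x where "x \<in> corners I r" "(c, t) = rotate_point l (\<lambda>c. - ?st c (k c)) (arc_start a x)"
          unfolding D_def by blast
        then have "snd x < r c" "t = f (k c) (snd x)"
          by (auto simp: rotate_point_simp arc_start_simp corners_iff f_def)
        then show "t \<in> f (k c) ` {..<r c}" by blast
      qed
      have injf: "inj_on (f (k c)) {..<r c}" for k
      proof (rule inj_onI)
        fix i j assume ij: "i \<in> {..<r c}" "j \<in> {..<r c}" "f (k c) i = f (k c) j"
        have "rotate_point l (\<lambda>c. - ?st c (k c)) (arc_start a (c, i)) = rotate_point l (\<lambda>c. - ?st c (k c)) (arc_start a (c, j))"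
          using ij(3) by (simp add: rotate_point_simp arc_start_simp f_def)
        moreover have ijc: "(c, i) \<in> corners I r" "(c, j) \<in> corners I r" using ij c by (auto simp: corners_iff)
        ultimately have "arc_start a (c, i) = arc_start a (c, j)"
          using inj_onD[OF injr] DX unfolding D_def by blast
        then show "i = j"
          using arc_start_embedding(1)[OF chart dom] ijc unfolding cyclic_embedding_def by (auto dest: inj_onD)
      qed
      have "(\<Sum>i<r c. f (k c) i) = (\<Sum>t\<in>f (k c) ` {..<r c}. t)" by (simp add: sum.reindex[OF injf])
      also have "\<dots> = (\<Sum>t\<in>f (k' c) ` {..<r c}. t)" unfolding img im ..
      also have "\<dots> = (\<Sum>i<r c. f (k' c) i)" by (simp add: sum.reindex[OF injf])
      finally have sums: "(\<Sum>i<r c. f (k c) i) = (\<Sum>i<r c. f (k' c) i)" .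
      \<comment> \<open>\<open>z m\<close> counts the wrap-arounds: modulo \<open>l c\<close> the
        sum of the rotated positions differs from the original sum by \<open>r c\<close> times the
        shift.\<close>
      define z where "z m = (\<Sum>i<r c. \<lfloor>(?st c i - ?st c m) / \<bar>l c\<bar>\<rfloor>)" for m
      have fz: "(\<Sum>i<r c. f m i) = (\<Sum>i<r c. ?st c i) - real (r c) * ?st c m - l c * of_int (z m)" for m
        unfolding f_def z_def rmod_def using l[OF c] by (simp add: sum_subtractf sum_distrib_left)
      have "real (r c) * (?st c (k' c) - ?st c (k c)) = of_int (z (k c) - z (k' c)) * l c"
        using sums unfolding fz by (simp add: algebra_simps)
      then show "k c = k' c" using gen[OF c kc] by blast
    qed
  qed
  also have "\<dots> = (\<Prod>c\<in>I. r c)" using I by (simp add: K_def card_PiE)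
  finally show ?thesis .
qed

end

section \<open>Volumes\<close>

text \<open>The exceptional set is a hyperplane: when all coordinates but one in \<open>S\<close>
  are fixed, the remaining one is confined to a single value, so integrating over it first gives
  0.\<close>

lemma AE_PiM_sum_neq:
  fixes q :: real
  assumes "finite J" "S \<subseteq> J" "S \<noteq> {}"
  shows "AE a in PiM J (\<lambda>_. lborel). (\<Sum>x\<in>S. a x) \<noteq> q"
proof -
  interpret product_sigma_finite "\<lambda>_. lborel :: real measure" by standard
  obtain i where i: "i \<in> S" using assms by blast
  define J' where "J' = J - {i}"
  have J: "J = insert i J'" "i \<notin> J'" "finite J'" using i assms by (auto simp: J'_def)
  have finS: "finite S" using assms finite_subset by blast
  let ?M = "PiM J (\<lambda>_. lborel :: real measure)"
  have meas [measurable]: "(\<lambda>a. \<Sum>x\<in>S. a x) \<in> borel_measurable ?M"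
    using assms(2) by (intro borel_measurable_sum) auto
  define N where "N = {a \<in> space ?M. (\<Sum>x\<in>S. a x) = q}"
  have N: "N \<in> sets ?M" unfolding N_def by measurable
  have "emeasure ?M N = (\<integral>\<^sup>+ a. indicator N a \<partial>PiM (insert i J') (\<lambda>_. lborel))"
    using N J(1) by simp
  also have "\<dots> = (\<integral>\<^sup>+ a. (\<integral>\<^sup>+ t. indicator N (a(i := t)) \<partial>lborel) \<partial>PiM J' (\<lambda>_. lborel))"
    using J N by (intro product_nn_integral_insert) auto
  also have "\<dots> = (\<integral>\<^sup>+ a. 0 \<partial>PiM J' (\<lambda>_. lborel :: real measure))"
  proof (rule nn_integral_cong)
    fix a :: "'a \<Rightarrow> real"
    have "(\<integral>\<^sup>+ t. indicator N (a(i := t)) \<partial>lborel) \<le> (\<integral>\<^sup>+ t. indicator {q - (\<Sum>x\<in>S - {i}. a x)} t \<partial>lborel)"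
    proof (rule nn_integral_mono)
      fix t :: real
      have "(\<Sum>x\<in>S. (a(i := t)) x) = t + (\<Sum>x\<in>S - {i}. a x)"
        using finS i by (simp add: sum.remove[of S i])
      then show "indicator N (a(i := t)) \<le> (indicator {q - (\<Sum>x\<in>S - {i}. a x)} t :: ennreal)"
        by (auto simp: indicator_def N_def)
    qed
    also have "\<dots> = 0" by simp
    finally show "(\<integral>\<^sup>+ t. indicator N (a(i := t)) \<partial>lborel) = 0" by simp
  qed
  finally have "emeasure ?M N = 0" by simp
  then show ?thesis using N by (intro AE_I[where N = N]) (auto simp: N_def)
qed

text \<open>A product of open simplices, with \<open>\<pi>\<close> telling to which factor a
  coordinate belongs. Compared with \<open>chart_domain\<close> the index set is arbitrary, which
  permits induction on it.\<close>

definition simplices :: "'c set \<Rightarrow> ('i \<Rightarrow> 'c) \<Rightarrow> 'i set \<Rightarrow> ('c \<Rightarrow> real) \<Rightarrow> ('i \<Rightarrow> real) set" where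
  "simplices I \<pi> J L = {a \<in> (\<Pi>\<^sub>E x\<in>J. {0<..}). \<forall>c\<in>I. (\<Sum>x | x \<in> J \<and> \<pi> x = c. a x) < L c}"

lemma simplices_measurable:
  assumes "finite I" "finite J"
  shows "simplices I \<pi> J L \<in> sets (PiM J (\<lambda>_. lborel))"
proof -
  let ?M = "PiM J (\<lambda>_. lborel :: real measure)"
  have 1: "(\<lambda>a. a x) \<in> borel_measurable ?M" if "x \<in> J" for x using that by simp
  have 2: "(\<lambda>a. \<Sum>x | x \<in> J \<and> \<pi> x = c. a x) \<in> borel_measurable ?M" for c
    by (intro borel_measurable_sum) auto
  have "simplices I \<pi> J L = {a \<in> space ?M. (\<forall>x\<in>J. 0 < a x) \<and> (\<forall>c\<in>I. (\<Sum>x | x \<in> J \<and> \<pi> x = c. a x) < L c)}"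
    by (auto simp: simplices_def space_PiM PiE_def Pi_def)
  also have "\<dots> \<in> sets ?M"
    using assms 1 2 by (intro sets.sets_Collect_conj sets.sets_Collect_finite_All borel_measurable_less) auto
  finally show ?thesis .
qed

text \<open>Integrates the slices of a simplex: at height \<open>y\<close> the slice has side
  \<open>L - y\<close> and one dimension less, and \<open>C\<close> stands for the volume of the
  other factors.\<close>

lemma nn_integral_power_simplex:
  fixes L C :: real
  assumes "0 < L" "0 \<le> C"
  shows "(\<integral>\<^sup>+ y. ennreal (C * (L - y) ^ n / fact n) * indicator {0<..<L} y \<partial>lborel) = ennreal (C * L ^ Suc n / fact (Suc n))"
proof -
  have "(\<integral>\<^sup>+ y. ennreal (C * (L - y) ^ n / fact n) * indicator {0<..<L} y \<partial>lborel) =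
      (\<integral>\<^sup>+ y. ennreal (C * (L - y) ^ n / fact n) * indicator {0..L} y \<partial>lborel)"
  proof (rule nn_integral_cong_AE)
    show "AE y in lborel. ennreal (C * (L - y) ^ n / fact n) * indicator {0<..<L} y =
        ennreal (C * (L - y) ^ n / fact n) * indicator {0..L} y"
      using AE_lborel_singleton[of 0] AE_lborel_singleton[of L]
      by eventually_elim (auto simp: indicator_def)
  qed
  also have "\<dots> = ennreal (- (C * (L - L) ^ Suc n / fact (Suc n)) - (- (C * (L - 0) ^ Suc n / fact (Suc n))))"
  proof (rule nn_integral_FTC_Icc)
    show "((\<lambda>y. - (C * (L - y) ^ Suc n / fact (Suc n))) has_real_derivative C * (L - y) ^ n / fact n) (at y)"
      for y
      by (rule derivative_eq_intros refl | simp add: field_simps del: of_nat_Suc)+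
  qed (use assms in auto)
  finally show ?thesis by simp
qed

text \<open>The coordinate \<open>b\<close> is integrated last: fixing it at \<open>y\<close> leaves
  a product of the same form with the bound \<open>L c0\<close> lowered to \<open>L c0 - y\<close>.
  Therefore \<open>L\<close> is arbitrary in the induction.\<close>

lemma emeasure_simplices:
  assumes "finite J" "finite I" "\<pi> ` J \<subseteq> I" "\<And>c. c \<in> I \<Longrightarrow> 0 < L c"
  shows "emeasure (PiM J (\<lambda>_. lborel)) (simplices I \<pi> J L) =
    ennreal (\<Prod>c\<in>I. L c ^ card {x \<in> J. \<pi> x = c} / fact (card {x \<in> J. \<pi> x = c}))"
  using assms(1,3,4)
proof (induction J arbitrary: L rule: finite_induct)
  case empty
  then have "simplices I \<pi> {} L = {\<lambda>_. undefined}" by (auto simp: simplices_def)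
  then show ?case by (simp add: PiM_empty)
next
  case (insert b J L)
  interpret product_sigma_finite "\<lambda>_. lborel :: real measure" by standard
  let ?M = "\<lambda>J. PiM J (\<lambda>_. lborel :: real measure)"
  let ?n = "\<lambda>J c. card {x \<in> J. \<pi> x = c}"
  define c0 where "c0 = \<pi> b"
  have c0: "c0 \<in> I" using insert by (simp add: c0_def)
  have n1: "?n (insert b J) c0 = Suc (?n J c0)"
  proof -
    have "{x \<in> insert b J. \<pi> x = c0} = insert b {x \<in> J. \<pi> x = c0}" by (auto simp: c0_def)
    then show ?thesis using insert.hyps by simp
  qed
  have n2: "?n (insert b J) c = ?n J c" if "c \<noteq> c0" for c
    using that by (intro arg_cong[where f = card]) (auto simp: c0_def)
  define C where "C = (\<Prod>c\<in>I - {c0}. L c ^ ?n J c / fact (?n J c))"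
  have C: "0 \<le> C" unfolding C_def using insert.prems(2) by (intro prod_nonneg) (auto intro: less_imp_le)
  \<comment> \<open>The bound \<open>y < L c0\<close> comes from the nonnegative sum of the other
    coordinates; it keeps the lowered bound positive, as the induction hypothesis requires.\<close>
  have mem: "x(b := y) \<in> simplices I \<pi> (insert b J) L \<longleftrightarrow> y \<in> {0<..<L c0} \<and> x \<in> simplices I \<pi> J (L(c0 := L c0 - y))"
    if x: "x \<in> space (?M J)" for x y
  proof -
    have s0: "(\<Sum>i | i \<in> insert b J \<and> \<pi> i = c0. (x(b := y)) i) = y + (\<Sum>i | i \<in> J \<and> \<pi> i = c0. x i)"
    proof -
      have eq: "{i. i \<in> insert b J \<and> \<pi> i = c0} = insert b {i. i \<in> J \<and> \<pi> i = c0}" by (auto simp: c0_def)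
      have "(\<Sum>i | i \<in> insert b J \<and> \<pi> i = c0. (x(b := y)) i) = y + (\<Sum>i | i \<in> J \<and> \<pi> i = c0. (x(b := y)) i)"
        unfolding eq using insert.hyps by (subst sum.insert) auto
      also have "(\<Sum>i | i \<in> J \<and> \<pi> i = c0. (x(b := y)) i) = (\<Sum>i | i \<in> J \<and> \<pi> i = c0. x i)"
        using insert.hyps by (intro sum.cong) auto
      finally show ?thesis .
    qed
    have s1: "(\<Sum>i | i \<in> insert b J \<and> \<pi> i = c. (x(b := y)) i) = (\<Sum>i | i \<in> J \<and> \<pi> i = c. x i)" if "c \<noteq> c0" for c
      using that insert.hyps by (intro sum.cong) (auto simp: c0_def)
    have ext: "x(b := y) \<in> (\<Pi>\<^sub>E i\<in>insert b J. {0<..}) \<longleftrightarrow> 0 < y \<and> x \<in> (\<Pi>\<^sub>E i\<in>J. {0<..})"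
      using x insert.hyps by (auto simp: space_PiM PiE_iff extensional_def)
    have nonneg: "0 \<le> (\<Sum>i | i \<in> J \<and> \<pi> i = c0. x i)" if "x \<in> (\<Pi>\<^sub>E i\<in>J. {0<..})"
      using that by (intro sum_nonneg) (auto simp: PiE_iff intro: less_imp_le)
    have all: "(\<forall>c\<in>I. (\<Sum>i | i \<in> insert b J \<and> \<pi> i = c. (x(b := y)) i) < L c) \<longleftrightarrow>
        (\<forall>c\<in>I. (\<Sum>i | i \<in> J \<and> \<pi> i = c. x i) < (L(c0 := L c0 - y)) c)"
    proof (rule ball_cong[OF refl])
      fix c
      show "(\<Sum>i | i \<in> insert b J \<and> \<pi> i = c. (x(b := y)) i) < L c \<longleftrightarrow>
          (\<Sum>i | i \<in> J \<and> \<pi> i = c. x i) < (L(c0 := L c0 - y)) c"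
      proof (cases "c = c0")
        case True
        then show ?thesis using s0 by auto
      next
        case False
        then show ?thesis using s1[OF False] by simp
      qed
    qed
    show ?thesis
      unfolding simplices_def mem_Collect_eq all ext using nonneg c0 by fastforce
  qed
  have "emeasure (?M (insert b J)) (simplices I \<pi> (insert b J) L) =
      (\<integral>\<^sup>+ a. indicator (simplices I \<pi> (insert b J) L) a \<partial>?M (insert b J))"
    using simplices_measurable[OF assms(2), of "insert b J" \<pi> L] insert.hyps by simp
  also have "\<dots> = (\<integral>\<^sup>+ y. \<integral>\<^sup>+ x. indicator (simplices I \<pi> (insert b J) L) (x(b := y)) \<partial>?M J \<partial>lborel)"
    using simplices_measurable[OF assms(2), of "insert b J" \<pi> L] insert.hyps
    by (intro product_nn_integral_insert_rev) auto
  also have "\<dots> = (\<integral>\<^sup>+ y. \<integral>\<^sup>+ x. indicator {0<..<L c0} y * indicator (simplices I \<pi> J (L(c0 := L c0 - y))) x \<partial>?M J \<partial>lborel)"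
    by (intro nn_integral_cong) (simp add: indicator_def mem)
  also have "\<dots> = (\<integral>\<^sup>+ y. ennreal (C * (L c0 - y) ^ ?n J c0 / fact (?n J c0)) * indicator {0<..<L c0} y \<partial>lborel)"
  proof (rule nn_integral_cong)
    fix y
    show "(\<integral>\<^sup>+ x. indicator {0<..<L c0} y * indicator (simplices I \<pi> J (L(c0 := L c0 - y))) x \<partial>?M J) =
        ennreal (C * (L c0 - y) ^ ?n J c0 / fact (?n J c0)) * indicator {0<..<L c0} y"
    proof (cases "y \<in> {0<..<L c0}")
      case True
      define L' where "L' = L(c0 := L c0 - y)"
      have "emeasure (?M J) (simplices I \<pi> J L') = ennreal (\<Prod>c\<in>I. L' c ^ ?n J c / fact (?n J c))"
        using insert.prems True by (intro insert.IH) (auto simp: L'_def)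
      also have "(\<Prod>c\<in>I. L' c ^ ?n J c / fact (?n J c)) = (L c0 - y) ^ ?n J c0 / fact (?n J c0) * C"
        unfolding C_def L'_def by (subst prod.remove[OF assms(2) c0]) (auto intro!: prod.cong)
      also have "\<dots> = C * (L c0 - y) ^ ?n J c0 / fact (?n J c0)" by simp
      finally have "emeasure (?M J) (simplices I \<pi> J L') = ennreal (C * (L c0 - y) ^ ?n J c0 / fact (?n J c0))" .
      then show ?thesis
        using True nn_integral_indicator[OF simplices_measurable[OF assms(2) insert.hyps(1), of \<pi> L']]
        unfolding L'_def[symmetric] by simp
    qed simp
  qed
  also have "\<dots> = ennreal (C * L c0 ^ Suc (?n J c0) / fact (Suc (?n J c0)))"
    using insert.prems(2)[OF c0] C by (rule nn_integral_power_simplex)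
  also have "C * L c0 ^ Suc (?n J c0) / fact (Suc (?n J c0)) =
      (\<Prod>c\<in>I. L c ^ ?n (insert b J) c / fact (?n (insert b J) c))"
  proof -
    have "C = (\<Prod>c\<in>I - {c0}. L c ^ ?n (insert b J) c / fact (?n (insert b J) c))"
      unfolding C_def using n2 by (intro prod.cong) auto
    then show ?thesis by (subst prod.remove[OF assms(2) c0]) (simp only: n1, simp)
  qed
  finally show ?case .
qed

section \<open>The volume as a sum over generic cores\<close>

lemma arc_coords_fibre:
  assumes "c \<in> I"
  shows "{x \<in> arc_coords I r. fst x = c} = Pair c ` {..<r c - 1}"
  using assms by (auto simp: arc_coords_def)

lemma chart_domain_simplices: "chart_domain I l r = simplices I fst (arc_coords I r) l"
proof -
  have "(\<Sum>t<r c - 1. a (c, t)) = (\<Sum>x | x \<in> arc_coords I r \<and> fst x = c. a x)" if "c \<in> I" for c and a :: "piece \<times> nat \<Rightarrow> real"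
    unfolding arc_coords_fibre[OF that] by (subst sum.reindex) (auto simp: inj_on_def)
  then show ?thesis unfolding chart_domain_def simplices_def by (intro Collect_cong conj_cong refl ball_cong) auto
qed

lemma finite_arc_coords: "finite I \<Longrightarrow> finite (arc_coords I r)"
  by (simp add: arc_coords_def)

lemma emeasure_chart_domain:
  assumes "finite I" "\<And>c. c \<in> I \<Longrightarrow> 0 < l c"
  shows "emeasure (PiM (arc_coords I r) (\<lambda>_. lborel)) (chart_domain I l r) =
    ennreal (\<Prod>c\<in>I. l c ^ (r c - 1) / fact (r c - 1))"
proof -
  have "card {x \<in> arc_coords I r. fst x = c} = r c - 1" if "c \<in> I" for c
    unfolding arc_coords_fibre[OF that] by (simp add: card_image inj_on_def)
  moreover have "fst ` arc_coords I r \<subseteq> I" by (auto simp: arc_coords_def)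
  ultimately show ?thesis
    unfolding chart_domain_simplices using emeasure_simplices[OF finite_arc_coords[OF assms(1)] assms(1) _ assms(2)]
    by simp
qed

text \<open>For fixed \<open>c\<close>, \<open>i\<close>, \<open>j\<close> and \<open>z\<close> the
  forbidden equation confines a sum of consecutive arc lengths to one value, a null set; only
  countably many such conditions occur.\<close>

lemma AE_no_symmetry:
  assumes I: "finite I" and l: "\<And>c. c \<in> I \<Longrightarrow> 0 < l c"
  shows "AE a in PiM (arc_coords I r) (\<lambda>_. lborel). \<forall>c\<in>I. \<forall>i\<in>{..<r c}. \<forall>j\<in>{..<r c}. \<forall>z::int. i \<noteq> j \<longrightarrow>
    real (r c) * ((\<Sum>u<j. a (c, u)) - (\<Sum>u<i. a (c, u))) \<noteq> of_int z * l c"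
proof -
  let ?M = "PiM (arc_coords I r) (\<lambda>_. lborel :: real measure)"
  have lt: "AE a in ?M. real (r c) * ((\<Sum>u<j. a (c, u)) - (\<Sum>u<i. a (c, u))) \<noteq> q" if c: "c \<in> I" "i < j" "j < r c" for c i j q
  proof -
    have "AE a in ?M. (\<Sum>x\<in>Pair c ` {i..<j}. a x) \<noteq> q / real (r c)"
      using c I by (intro AE_PiM_sum_neq) (auto simp: finite_arc_coords arc_coords_def)
    then show ?thesis
    proof eventually_elim
      case (elim a)
      have "(\<Sum>x\<in>Pair c ` {i..<j}. a x) = (\<Sum>u\<in>{i..<j}. a (c, u))" by (subst sum.reindex) (auto simp: inj_on_def)
      also have "{i..<j} = {..<j} - {..<i}" by auto
      also have "(\<Sum>u\<in>{..<j} - {..<i}. a (c, u)) = (\<Sum>u<j. a (c, u)) - (\<Sum>u<i. a (c, u))"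
        using c(2) by (intro sum_diff) auto
      finally have "(\<Sum>u<j. a (c, u)) - (\<Sum>u<i. a (c, u)) \<noteq> q / real (r c)" using elim by simp
      then show ?case using c(3) by (simp add: eq_divide_eq mult.commute)
    qed
  qed
  have "AE a in ?M. i \<noteq> j \<longrightarrow> real (r c) * ((\<Sum>u<j. a (c, u)) - (\<Sum>u<i. a (c, u))) \<noteq> of_int z * l c"
    if "c \<in> I" "i < r c" "j < r c" for c i j and z :: int
  proof (cases i j rule: linorder_cases)
    case less
    then show ?thesis using lt[OF that(1) less that(3)] by simp
  next
    case greater
    from lt[OF that(1) greater that(2), of "- (of_int z * l c)"] show ?thesis
      by eventually_elim (auto simp: algebra_simps)
  qed simp
  then show ?thesis using I by (simp add: AE_ball_countable AE_all_countable countable_finite)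
qed

text \<open>Away from a null set the weight is constant on the chart, one over the product of the
  \<open>r c\<close>. Together with \<open>fact (r c - 1)\<close> from the simplices it yields
  \<open>fact (r c)\<close>.\<close>

lemma chart_integral:
  assumes I: "finite I" and l: "\<And>c. c \<in> I \<Longrightarrow> 0 < l c" and chart: "(r, S) \<in> charts I"
  shows "(\<integral>\<^sup>+ a. (if a \<in> chart_domain I l r \<and> chart_map I l S a \<in> circle_space I l g p
      then 1 / of_nat (card (chart_fibre I l (chart_map I l S a))) else 0) \<partial>PiM (arc_coords I r) (\<lambda>_. lborel)) =
    (if S \<in> cores I g p r then ennreal (\<Prod>c\<in>I. l c ^ (r c - 1) / fact (r c)) else 0)" (is "integral\<^sup>N ?M _ = _")
proof (cases "S \<in> cores I g p r")
  case True
  have r1: "1 \<le> r c" if "c \<in> I" for c using chart that unfolding charts_def by (auto dest: PiE_mem)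
  have ae: "AE a in ?M. \<forall>c\<in>I. \<forall>i\<in>{..<r c}. \<forall>j\<in>{..<r c}. \<forall>z::int. i \<noteq> j \<longrightarrow>
      real (r c) * ((\<Sum>u<j. a (c, u)) - (\<Sum>u<i. a (c, u))) \<noteq> of_int z * l c"
    by (rule AE_no_symmetry[OF I]) (rule l)
  have vol: "emeasure ?M (chart_domain I l r) = ennreal (\<Prod>c\<in>I. l c ^ (r c - 1) / fact (r c - 1))"
    by (rule emeasure_chart_domain[OF I]) (rule l)
  let ?N = "\<Prod>c\<in>I. r c"
  have N: "0 < ?N" using r1 by (intro prod_pos) force
  have "integral\<^sup>N ?M (\<lambda>a. if a \<in> chart_domain I l r \<and> chart_map I l S a \<in> circle_space I l g p
      then 1 / of_nat (card (chart_fibre I l (chart_map I l S a))) else 0) =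
      (\<integral>\<^sup>+ a. ennreal (1 / real ?N) * indicator (chart_domain I l r) a \<partial>?M)"
  proof (rule nn_integral_cong_AE)
    show "AE a in ?M. (if a \<in> chart_domain I l r \<and> chart_map I l S a \<in> circle_space I l g p
      then 1 / of_nat (card (chart_fibre I l (chart_map I l S a))) else 0) =
      ennreal (1 / real ?N) * indicator (chart_domain I l r) a"
      using ae
    proof eventually_elim
      case (elim a)
      show ?case
      proof (cases "a \<in> chart_domain I l r")
        case dom: True
        have "chart_map I l S a \<in> circle_space I l g p"
          using chart_map_in_circle_space[where l = l, OF I l chart dom] True by simp
        moreover have "card (chart_fibre I l (chart_map I l S a)) = ?N"
          using elim by (intro card_chart_fibre[where l = l, OF I l chart dom]) auto
        moreover have "1 / of_nat ?N = ennreal (1 / real ?N)"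
          using N divide_ennreal[of 1 "real ?N"] by (simp add: ennreal_of_nat_eq_real_of_nat del: of_nat_prod)
        ultimately show ?thesis using dom by simp
      qed simp
    qed
  qed
  also have "\<dots> = ennreal (1 / real ?N) * emeasure ?M (chart_domain I l r)"
    using simplices_measurable[OF I finite_arc_coords[OF I], where \<pi> = fst and L = l] unfolding chart_domain_simplices
    by (intro nn_integral_cmult_indicator)
  also have "\<dots> = ennreal (1 / real ?N * (\<Prod>c\<in>I. l c ^ (r c - 1) / fact (r c - 1)))"
    unfolding vol by (rule ennreal_mult'[symmetric]) (simp del: of_nat_prod)
  also have "1 / real ?N * (\<Prod>c\<in>I. l c ^ (r c - 1) / fact (r c - 1)) = (\<Prod>c\<in>I. 1 / real (r c) * (l c ^ (r c - 1) / fact (r c - 1)))"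
    by (simp add: prod.distrib prod_dividef)
  also have "\<dots> = (\<Prod>c\<in>I. l c ^ (r c - 1) / fact (r c))"
  proof (rule prod.cong[OF refl])
    fix c assume "c \<in> I"
    then show "1 / real (r c) * (l c ^ (r c - 1) / fact (r c - 1)) = l c ^ (r c - 1) / fact (r c)"
      using r1[of c] by (subst fact_reduce[of "r c"]) auto
  qed
  finally show ?thesis using True by simp
next
  case False
  then have "(if a \<in> chart_domain I l r \<and> chart_map I l S a \<in> circle_space I l g p
      then 1 / of_nat (card (chart_fibre I l (chart_map I l S a))) else 0) = (0::ennreal)" for a
    using chart_map_in_circle_space[where l = l, OF I l chart] by auto
  then show ?thesis using False by simp
qed

lemma finite_cores: "finite I \<Longrightarrow> finite (cores I g p r)"
  unfolding cores_def by (intro finite_core) simp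

text \<open>Charts whose pairing is a core are exactly the cores with \<open>d + card I\<close>
  points, because that number is reached only if every class is a pair. The integral over all charts
  is thus a finite sum.\<close>

lemma circle_volume_eq:
  assumes I: "finite I" "2 \<le> card I" and l: "\<And>c. c \<in> I \<Longrightarrow> 0 < l c"
    and d: "int d = 4 * int g - 4 + int (card I) + 2 * int p"
    and F: "F = (\<Pi>\<^sub>E c\<in>I. {1..d + card I})"
  shows "circle_volume I l (circle_space I l g p) = ennreal (\<Sum>r\<in>F. real (card (cores I g p r)) *
     (if (\<Sum>c\<in>I. r c) = d + card I then \<Prod>c\<in>I. l c ^ (r c - 1) / fact (r c) else 0))"
proof -
  let ?w = "\<lambda>r. \<Prod>c\<in>I. l c ^ (r c - 1) / fact (r c)"
  let ?T = "{r \<in> F. (\<Sum>c\<in>I. r c) = d + card I}"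
  let ?Z = "SIGMA r:?T. cores I g p r"
  have finF: "finite F" using I(1) by (simp add: F finite_PiE)
  have finZ: "finite ?Z" using finF finite_cores[OF I(1)] by auto
  have w: "0 \<le> ?w r" for r using l by (intro prod_nonneg) (auto intro: less_imp_le)
  have Z: "(r, S) \<in> ?Z \<longleftrightarrow> (r, S) \<in> charts I \<and> S \<in> cores I g p r" for r S
  proof
    assume "(r, S) \<in> ?Z"
    then have r: "r \<in> F" "(\<Sum>c\<in>I. r c) = d + card I" and S: "S \<in> cores I g p r" by auto
    have "\<forall>x\<in>corners I r. card (S `` {x}) = 2" using cores_bounds(4)[OF I(1) S d I(2)] r(2) by simp
    moreover have "equiv (corners I r) S" using S by (simp add: cores_def core_def coloured_gluing_def)
    moreover have "r \<in> (\<Pi>\<^sub>E c\<in>I. {1..})" using r(1) unfolding F by (auto simp: PiE_iff)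
    ultimately show "(r, S) \<in> charts I \<and> S \<in> cores I g p r" using S by (simp add: charts_def)
  next
    assume *: "(r, S) \<in> charts I \<and> S \<in> cores I g p r"
    then have S: "S \<in> cores I g p r" and "r \<in> extensional I" "\<forall>x\<in>corners I r. card (S `` {x}) = 2"
      by (auto simp: charts_def PiE_iff)
    moreover have "r \<in> F" unfolding F using cores_bounds(2,3)[OF I(1) S d I(2)] calculation(2) by (auto simp: PiE_iff)
    ultimately show "(r, S) \<in> ?Z" using cores_bounds(4)[OF I(1) S d I(2)] by simp
  qed
  have "circle_volume I l (circle_space I l g p) =
      (\<integral>\<^sup>+ x. (if snd x \<in> cores I g p (fst x) then ennreal (?w (fst x)) else 0) \<partial>count_space (charts I))"
    unfolding circle_volume_def
  proof (rule nn_integral_cong)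
    fix x assume "x \<in> space (count_space (charts I))"
    then have "(fst x, snd x) \<in> charts I" by simp
    from chart_integral[where l = l, OF I(1) l this, of g p]
    show "(case x of (r, S) \<Rightarrow> \<integral>\<^sup>+ a. (if a \<in> chart_domain I l r \<and> chart_map I l S a \<in> circle_space I l g p
        then 1 / of_nat (card (chart_fibre I l (chart_map I l S a))) else 0) \<partial>PiM (arc_coords I r) (\<lambda>_. lborel)) =
      (if snd x \<in> cores I g p (fst x) then ennreal (?w (fst x)) else 0)"
      by (simp add: case_prod_beta)
  qed
  also have "\<dots> = (\<Sum>x\<in>?Z. if snd x \<in> cores I g p (fst x) then ennreal (?w (fst x)) else 0)"
  proof (rule nn_integral_count_space')
    show "?Z \<subseteq> charts I" using Z by auto
    fix x assume "x \<in> charts I" "x \<notin> ?Z"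
    then show "(if snd x \<in> cores I g p (fst x) then ennreal (?w (fst x)) else 0) = 0"
      using Z[of "fst x" "snd x"] by auto
  qed (rule finZ)
  also have "\<dots> = (\<Sum>(r, S)\<in>?Z. ennreal (?w r))" by (intro sum.cong) auto
  also have "\<dots> = (\<Sum>r\<in>?T. \<Sum>S\<in>cores I g p r. ennreal (?w r))"
    using finF finite_cores[OF I(1)] by (intro sum.Sigma[symmetric]) auto
  also have "\<dots> = (\<Sum>r\<in>?T. ennreal (real (card (cores I g p r)) * ?w r))"
    by (simp add: ennreal_mult' ennreal_of_nat_eq_real_of_nat)
  also have "\<dots> = ennreal (\<Sum>r\<in>?T. real (card (cores I g p r)) * ?w r)"
    using w by (intro sum_ennreal) auto
  also have "(\<Sum>r\<in>?T. real (card (cores I g p r)) * ?w r) = (\<Sum>r\<in>F. real (card (cores I g p r)) *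
     (if (\<Sum>c\<in>I. r c) = d + card I then ?w r else 0))"
    using finF by (intro sum.mono_neutral_cong_left) auto
  finally show ?thesis .
qed

section \<open>Polynomials and asymptotics\<close>

definition monom_of :: "'v set \<Rightarrow> ('v \<Rightarrow> nat) \<Rightarrow> ('v \<Rightarrow>\<^sub>0 nat)" where
  "monom_of I e = Abs_poly_mapping (\<lambda>c. if c \<in> I then e c else 0)"

text \<open>Exponents will be functions that are \<open>undefined\<close> outside \<open>I\<close>,
  so that different elements of \<open>E\<close> give different monomials and the coefficients can
  be read off.\<close>

definition mpoly_of :: "'v set \<Rightarrow> ('v \<Rightarrow> nat) set \<Rightarrow> (('v \<Rightarrow> nat) \<Rightarrow> real) \<Rightarrow> 'v mpoly" where
  "mpoly_of I E b = (\<Sum>e\<in>E. Poly_Mapping.single (monom_of I e) (b e))"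

context
  fixes I :: "'v set" and E :: "('v \<Rightarrow> nat) set" and b :: "('v \<Rightarrow> nat) \<Rightarrow> real"
  assumes I: "finite I" and E: "finite E" "E \<subseteq> extensional I"
begin

lemma lookup_monom_of: "Poly_Mapping.lookup (monom_of I e) c = (if c \<in> I then e c else 0)"
proof -
  have "finite {c. (if c \<in> I then e c else 0) \<noteq> 0}" by (rule finite_subset[OF _ I]) auto
  then show ?thesis by (simp add: monom_of_def)
qed

lemma keys_monom_of: "Poly_Mapping.keys (monom_of I e) = {c \<in> I. e c \<noteq> 0}"
  by (auto simp: in_keys_iff lookup_monom_of split: if_splits)

lemma inj_on_monom_of: "inj_on (monom_of I) E"
proof (rule inj_onI)
  fix e e' assume *: "e \<in> E" "e' \<in> E" "monom_of I e = monom_of I e'"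
  have "e c = e' c" if "c \<in> I" for c
    using *(3) lookup_monom_of[of e c] lookup_monom_of[of e' c] that by simp
  then show "e = e'" using * E(2) by (intro extensionalityI[of _ I]) auto
qed

lemma lookup_mpoly_of:
  shows "e \<in> E \<Longrightarrow> Poly_Mapping.lookup (mpoly_of I E b) (monom_of I e) = b e"
    and "M \<notin> monom_of I ` E \<Longrightarrow> Poly_Mapping.lookup (mpoly_of I E b) M = 0"
proof -
  assume e: "e \<in> E"
  have "Poly_Mapping.lookup (mpoly_of I E b) (monom_of I e) = (\<Sum>e'\<in>E. if e' = e then b e' else 0)"
    unfolding mpoly_of_def lookup_sum lookup_single
    using inj_on_monom_of e by (intro sum.cong) (auto simp: when_def dest: inj_onD)
  then show "Poly_Mapping.lookup (mpoly_of I E b) (monom_of I e) = b e" using E(1) e by simp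
next
  assume "M \<notin> monom_of I ` E"
  then show "Poly_Mapping.lookup (mpoly_of I E b) M = 0"
    unfolding mpoly_of_def lookup_sum lookup_single by (intro sum.neutral) (auto simp: when_def)
qed

lemma keys_mpoly_of: "Poly_Mapping.keys (mpoly_of I E b) = monom_of I ` {e \<in> E. b e \<noteq> 0}"
proof -
  have "M \<in> Poly_Mapping.keys (mpoly_of I E b) \<longleftrightarrow> M \<in> monom_of I ` {e \<in> E. b e \<noteq> 0}" for M
    using lookup_mpoly_of by (cases "M \<in> monom_of I ` E") (auto simp: in_keys_iff)
  then show ?thesis by blast
qed

lemma mpoly_vars_mpoly_of: "mpoly_vars (mpoly_of I E b) \<subseteq> I"
  by (auto simp: mpoly_vars_def keys_mpoly_of keys_monom_of)

lemma monom_degree_monom_of: "monom_degree (monom_of I e) = (\<Sum>c\<in>I. e c)"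
  unfolding monom_degree_def keys_monom_of lookup_monom_of using I by (intro sum.mono_neutral_cong_left) auto

lemma mpoly_eval_mpoly_of: "mpoly_eval x (mpoly_of I E b) = (\<Sum>e\<in>E. b e * (\<Prod>c\<in>I. x c ^ e c))"
proof -
  have inj: "inj_on (monom_of I) {e \<in> E. b e \<noteq> 0}" using inj_on_monom_of by (rule inj_on_subset) auto
  have "mpoly_eval x (mpoly_of I E b) = (\<Sum>e\<in>{e \<in> E. b e \<noteq> 0}. b e *
      (\<Prod>c\<in>{c \<in> I. e c \<noteq> 0}. x c ^ (if c \<in> I then e c else 0)))"
    unfolding mpoly_eval_def keys_mpoly_of
    by (subst sum.reindex[OF inj]) (simp add: lookup_mpoly_of keys_monom_of lookup_monom_of)
  also have "\<dots> = (\<Sum>e\<in>{e \<in> E. b e \<noteq> 0}. b e * (\<Prod>c\<in>I. x c ^ e c))"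
    using I by (intro sum.cong arg_cong2[where f = "(*)"] prod.mono_neutral_cong_left refl) auto
  also have "\<dots> = (\<Sum>e\<in>E. b e * (\<Prod>c\<in>I. x c ^ e c))"
    using E(1) by (intro sum.mono_neutral_left) auto
  finally show ?thesis .
qed

lemma total_degree_mpoly_of:
  assumes "\<And>e. e \<in> E \<Longrightarrow> b e \<noteq> 0 \<Longrightarrow> (\<Sum>c\<in>I. e c) \<le> d" "e \<in> E" "b e \<noteq> 0" "(\<Sum>c\<in>I. e c) = d"
  shows "total_degree (mpoly_of I E b) = d"
  unfolding total_degree_def keys_mpoly_of image_image monom_degree_monom_of
  using assms E(1) by (intro Max_eqI) (auto intro!: image_eqI[of _ _ e])

lemma top_degree_part_mpoly_of:
  assumes "total_degree (mpoly_of I E b) = d"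
  shows "top_degree_part (mpoly_of I E b) = mpoly_of I E (\<lambda>e. if (\<Sum>c\<in>I. e c) = d then b e else 0)"
proof -
  let ?S = "{e \<in> E. b e \<noteq> 0 \<and> (\<Sum>c\<in>I. e c) = d}"
  have inj: "inj_on (monom_of I) ?S" using inj_on_monom_of by (rule inj_on_subset) auto
  have "{M \<in> Poly_Mapping.keys (mpoly_of I E b). monom_degree M = d} = monom_of I ` ?S"
    by (auto simp: keys_mpoly_of monom_degree_monom_of)
  then have "top_degree_part (mpoly_of I E b) = (\<Sum>e\<in>?S. Poly_Mapping.single (monom_of I e) (b e))"
    unfolding top_degree_part_def assms
    by (simp add: sum.reindex[OF inj] lookup_mpoly_of)
  also have "\<dots> = mpoly_of I E (\<lambda>e. if (\<Sum>c\<in>I. e c) = d then b e else 0)"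
    unfolding mpoly_of_def using E(1) by (intro sum.mono_neutral_cong_left) auto
  finally show ?thesis .
qed

end

text \<open>For \<open>1 \<le> r\<close> this is \<open>(x choose r) / x\<close>, that is
  \<open>(x - 1) * ... * (x - r + 1) / fact r\<close>. The division by \<open>x\<close> accounts for
  the rotations of one polygon.\<close>

definition arc_poly :: "nat \<Rightarrow> real poly" where
  "arc_poly r = smult (1 / fact r) (\<Prod>i=1..<r. [:- real i, 1:])"

lemma poly_arc_poly: "poly (arc_poly r) x = (\<Prod>i=1..<r. x - real i) / fact r"
  by (simp add: arc_poly_def poly_prod)

lemma binomial_eq_arc_poly:
  assumes "1 \<le> r"
  shows "real (n choose r) = real n * poly (arc_poly r) (real n)"
proof -
  have "real (n choose r) = (\<Prod>i=0..<r. real n - real i) / fact r"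
    by (simp add: binomial_gbinomial gbinomial_prod_rev)
  also have "(\<Prod>i=0..<r. real n - real i) = real n * (\<Prod>i=1..<r. real n - real i)"
    using assms by (subst prod.atLeast_Suc_lessThan) auto
  finally show ?thesis by (simp add: poly_arc_poly)
qed

lemma degree_arc_poly: "degree (arc_poly r) = r - 1"
  by (simp add: arc_poly_def degree_prod_sum_eq)

lemma coeff_arc_poly_top: "coeff (arc_poly r) (r - 1) = 1 / fact r"
proof -
  have "lead_coeff (arc_poly r) = 1 / fact r" by (simp add: arc_poly_def lead_coeff_prod)
  then show ?thesis by (simp add: degree_arc_poly)
qed

lemma coeff_arc_poly_eq_0: "r - 1 < j \<Longrightarrow> coeff (arc_poly r) j = 0"
  by (rule coeff_eq_0) (simp add: degree_arc_poly)

lemma asymp_equiv_prod: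
  fixes f g :: "'a \<Rightarrow> 'b \<Rightarrow> real"
  assumes "\<And>i. i \<in> S \<Longrightarrow> f i \<sim>[F] g i"
  shows "(\<lambda>x. \<Prod>i\<in>S. f i x) \<sim>[F] (\<lambda>x. \<Prod>i\<in>S. g i x)"
  using assms by (induction S rule: infinite_finite_induct) (auto intro: asymp_equiv_mult)

lemma arc_poly_asymp_equiv:
  "(\<lambda>n. poly (arc_poly r) (real n)) \<sim>[at_top] (\<lambda>n. real n ^ (r - 1) / fact r)"
proof -
  have "(\<lambda>n. real n - real i) \<sim>[at_top] (\<lambda>n. real n)" for i
    by (rule asymp_equivI') real_asymp
  then have "(\<lambda>n. \<Prod>i=1..<r. real n - real i) \<sim>[at_top] (\<lambda>n. \<Prod>i=1..<r. real n)"
    by (rule asymp_equiv_prod)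
  then have "(\<lambda>n. (\<Prod>i=1..<r. real n - real i) / fact r) \<sim>[at_top] (\<lambda>n. real n ^ (r - 1) / fact r)"
    by (intro asymp_equiv_divide) auto
  then show ?thesis by (simp add: poly_arc_poly)
qed

lemma filterlim_all_to_infinity:
  assumes "c \<in> I"
  shows "filterlim (\<lambda>n. n c) at_top (all_to_infinity I)"
  unfolding all_to_infinity_def filterlim_iff_le_filtercomap using assms by (intro INF_lower)

lemma eventually_all_to_infinity_ge:
  assumes "finite I"
  shows "eventually (\<lambda>n. \<forall>c\<in>I. k \<le> n c) (all_to_infinity I)"
  using assms
  by (intro eventually_ball_finite ballI)
     (auto intro: filterlim_all_to_infinity[unfolded filterlim_at_top, rule_format])

text \<open>\<open>A r\<close> is the number of gluing patterns with \<open>r c\<close> gluing points on the piece \<open>c\<close>.\<close>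

locale arc_pattern_count =
  fixes I :: "piece set" and d :: nat and A :: "(piece \<Rightarrow> nat) \<Rightarrow> nat" and F
  assumes I: "finite I"
    and F_def: "F = (\<Pi>\<^sub>E c\<in>I. {1..d + card I})"
    and bound: "\<And>r. r \<in> F \<Longrightarrow> A r \<noteq> 0 \<Longrightarrow> (\<Sum>c\<in>I. r c) \<le> d + card I"
    and resolve: "\<And>r. r \<in> F \<Longrightarrow> A r \<noteq> 0 \<Longrightarrow>
        \<exists>r'\<in>F. A r' \<noteq> 0 \<and> (\<Sum>c\<in>I. r' c) = d + card I \<and> (\<forall>c\<in>I. r c \<le> r' c)"
    and exists: "\<exists>r\<in>F. A r \<noteq> 0"
begin

text \<open>A box large enough for all exponents, since the factor belonging to \<open>r c\<close>
  has degree \<open>r c - 1\<close>, below \<open>d + card I\<close>.\<close>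

definition E :: "(piece \<Rightarrow> nat) set" where "E = (\<Pi>\<^sub>E c\<in>I. {..d + card I})"

text \<open>The coefficients obtained by multiplying out the products of arc polynomials, one
  variable for each piece.\<close>

definition coef :: "(piece \<Rightarrow> nat) \<Rightarrow> real" where
  "coef e = (\<Sum>r\<in>F. real (A r) * (\<Prod>c\<in>I. coeff (arc_poly (r c)) (e c)))"

definition P :: "piece mpoly" where "P = mpoly_of I E coef"

definition Q :: "piece mpoly" where
  "Q = mpoly_of I E (\<lambda>e. if (\<Sum>c\<in>I. e c) = d then coef e else 0)"

lemma finite_E: "finite E" and finite_F: "finite F" and E_ext: "E \<subseteq> extensional I"
  using I by (auto simp: E_def F_def PiE_def intro!: finite_PiE[unfolded PiE_def])

lemma F_ge_1: "r \<in> F \<Longrightarrow> c \<in> I \<Longrightarrow> 1 \<le> r c"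
  and F_le: "r \<in> F \<Longrightarrow> c \<in> I \<Longrightarrow> r c \<le> d + card I"
  unfolding F_def by (auto dest: PiE_mem)

lemma sum_pred: "r \<in> F \<Longrightarrow> (\<Sum>c\<in>I. r c - 1) + card I = (\<Sum>c\<in>I. r c)"
proof -
  assume r: "r \<in> F"
  have "(\<Sum>c\<in>I. r c - 1) + card I = (\<Sum>c\<in>I. (r c - 1) + 1)" by (simp only: sum.distrib) simp
  also have "\<dots> = (\<Sum>c\<in>I. r c)" 
  proof (rule sum.cong[OF refl])
    show "r c - 1 + 1 = r c" if "c \<in> I" for c using F_ge_1[OF r that] by simp
  qed
  finally show ?thesis .
qed

lemma coeff_prod_nonzero:
  assumes "(\<Prod>c\<in>I. coeff (arc_poly (r c)) (e c)) \<noteq> 0" "c \<in> I"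
  shows "e c \<le> r c - 1"
proof (rule ccontr)
  assume "\<not> e c \<le> r c - 1"
  then have "coeff (arc_poly (r c)) (e c) = 0" by (intro coeff_arc_poly_eq_0) simp
  then show False using assms prod_zero[OF I, of "\<lambda>c. coeff (arc_poly (r c)) (e c)"] by blast
qed

lemma coef_degree:
  assumes "coef e \<noteq> 0"
  shows "(\<Sum>c\<in>I. e c) \<le> d"
proof -
  obtain r where "r \<in> F" "real (A r) * (\<Prod>c\<in>I. coeff (arc_poly (r c)) (e c)) \<noteq> 0"
    using sum.not_neutral_contains_not_neutral[OF assms[unfolded coef_def]] by blast
  then have r: "r \<in> F" "A r \<noteq> 0" "(\<Prod>c\<in>I. coeff (arc_poly (r c)) (e c)) \<noteq> 0" by simp_all
  have "(\<Sum>c\<in>I. e c) \<le> (\<Sum>c\<in>I. r c - 1)" using coeff_prod_nonzero[OF r(3)] by (intro sum_mono)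
  then show ?thesis using sum_pred[OF r(1)] bound[OF r(1,2)] by linarith
qed

text \<open>Nonzero coefficients need \<open>e c \<le> r c - 1\<close> for all \<open>c\<close>.
  Summation shows that total degree \<open>d\<close> is reached only with equality everywhere, that
  is, by the leading monomial of an \<open>r\<close> with \<open>d + card I\<close> points.\<close>

lemma sum_top_coeffs:
  assumes r: "r \<in> F" "A r \<noteq> 0"
  shows "(\<Sum>e | e \<in> E \<and> (\<Sum>c\<in>I. e c) = d. (\<Prod>c\<in>I. coeff (arc_poly (r c)) (e c)) * (\<Prod>c\<in>I. x c ^ e c)) =
    (if (\<Sum>c\<in>I. r c) = d + card I then \<Prod>c\<in>I. x c ^ (r c - 1) / fact (r c) else (0::real))"
proof -
  let ?S = "{e \<in> E. (\<Sum>c\<in>I. e c) = d}"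
  let ?t = "\<lambda>e. (\<Prod>c\<in>I. coeff (arc_poly (r c)) (e c)) * (\<Prod>c\<in>I. x c ^ e c)"
  define e0 where "e0 = (\<lambda>c\<in>I. r c - 1)"
  have only: "(\<Sum>c\<in>I. r c) = d + card I \<and> e = e0" if e: "e \<in> ?S" and nz: "?t e \<noteq> 0" for e
  proof -
    have le: "e c \<le> r c - 1" if "c \<in> I" for c using coeff_prod_nonzero[OF _ that] nz by auto
    then have "(\<Sum>c\<in>I. e c) \<le> (\<Sum>c\<in>I. r c - 1)" by (intro sum_mono)
    then have eq: "(\<Sum>c\<in>I. e c) = (\<Sum>c\<in>I. r c - 1)" "(\<Sum>c\<in>I. r c) = d + card I"
      using e sum_pred[OF r(1)] bound[OF r] by auto
    have "e c = r c - 1" if "c \<in> I" for c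
      by (rule sum_mono_inv[OF eq(1) le that I])
    then have "e = e0" using e E_ext by (intro extensionalityI[of _ I]) (auto simp: e0_def)
    with eq show ?thesis by simp
  qed
  show ?thesis
  proof (cases "(\<Sum>c\<in>I. r c) = d + card I")
    case True
    have "r c - 1 \<le> d + card I" if "c \<in> I" for c using F_le[OF r(1) that] by linarith
    then have "e0 \<in> E" unfolding e0_def E_def by auto
    moreover have "(\<Sum>c\<in>I. e0 c) = d" using sum_pred[OF r(1)] True by (simp add: e0_def)
    ultimately have "sum ?t ?S = sum ?t {e0}"
      using finite_E only by (intro sum.mono_neutral_right) (simp, blast, blast)
    also have "\<dots> = (\<Prod>c\<in>I. x c ^ (r c - 1) / fact (r c))"
      by (simp add: e0_def coeff_arc_poly_top[simplified] prod_dividef)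
    finally show ?thesis using True by simp
  next
    case False
    then have "sum ?t ?S = 0" using only by (intro sum.neutral) blast
    then show ?thesis using False by simp
  qed
qed

lemma eval_P: "mpoly_eval x P = (\<Sum>r\<in>F. real (A r) * (\<Prod>c\<in>I. poly (arc_poly (r c)) (x c)))"
proof -
  have "mpoly_eval x P = (\<Sum>e\<in>E. \<Sum>r\<in>F. real (A r) * (\<Prod>c\<in>I. coeff (arc_poly (r c)) (e c) * x c ^ e c))"
    unfolding P_def mpoly_eval_mpoly_of[OF I finite_E E_ext] coef_def
    by (simp add: sum_distrib_right prod.distrib mult.assoc)
  also have "\<dots> = (\<Sum>r\<in>F. real (A r) * (\<Sum>e\<in>E. \<Prod>c\<in>I. coeff (arc_poly (r c)) (e c) * x c ^ e c))"
    by (subst sum.swap) (simp add: sum_distrib_left)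
  also have "\<dots> = (\<Sum>r\<in>F. real (A r) * (\<Prod>c\<in>I. poly (arc_poly (r c)) (x c)))"
  proof (intro sum.cong refl arg_cong2[where f = "(*)"])
    fix r assume r: "r \<in> F"
    have "poly (arc_poly (r c)) (x c) = (\<Sum>j\<le>d + card I. coeff (arc_poly (r c)) j * x c ^ j)" if "c \<in> I" for c
      unfolding poly_altdef degree_arc_poly
      using F_le[OF r that] coeff_arc_poly_eq_0 by (intro sum.mono_neutral_left) auto
    then have "(\<Prod>c\<in>I. poly (arc_poly (r c)) (x c)) = (\<Prod>c\<in>I. \<Sum>j\<le>d + card I. coeff (arc_poly (r c)) j * x c ^ j)"
      by (intro prod.cong) auto
    also have "\<dots> = (\<Sum>e\<in>E. \<Prod>c\<in>I. coeff (arc_poly (r c)) (e c) * x c ^ e c)"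
      unfolding E_def using I by (intro prod_sum_PiE) auto
    finally show "(\<Sum>e\<in>E. \<Prod>c\<in>I. coeff (arc_poly (r c)) (e c) * x c ^ e c) = (\<Prod>c\<in>I. poly (arc_poly (r c)) (x c))"
      by simp
  qed
  finally show ?thesis .
qed

lemma eval_Q:
  "mpoly_eval x Q = (\<Sum>r\<in>F. real (A r) *
     (if (\<Sum>c\<in>I. r c) = d + card I then \<Prod>c\<in>I. x c ^ (r c - 1) / fact (r c) else 0))"
proof -
  let ?S = "{e \<in> E. (\<Sum>c\<in>I. e c) = d}"
  have "mpoly_eval x Q = (\<Sum>e\<in>E. (if (\<Sum>c\<in>I. e c) = d then coef e else 0) * (\<Prod>c\<in>I. x c ^ e c))"
    unfolding Q_def by (rule mpoly_eval_mpoly_of[OF I finite_E E_ext])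
  also have "\<dots> = (\<Sum>e\<in>?S. coef e * (\<Prod>c\<in>I. x c ^ e c))"
    using finite_E by (intro sum.mono_neutral_cong_right) auto
  also have "\<dots> = (\<Sum>e\<in>?S. \<Sum>r\<in>F. real (A r) * ((\<Prod>c\<in>I. coeff (arc_poly (r c)) (e c)) * (\<Prod>c\<in>I. x c ^ e c)))"
    unfolding coef_def by (simp add: sum_distrib_right mult.assoc)
  also have "\<dots> = (\<Sum>r\<in>F. real (A r) * (\<Sum>e\<in>?S. (\<Prod>c\<in>I. coeff (arc_poly (r c)) (e c)) * (\<Prod>c\<in>I. x c ^ e c)))"
    by (subst sum.swap) (simp add: sum_distrib_left)
  also have "\<dots> = (\<Sum>r\<in>F. real (A r) *
     (if (\<Sum>c\<in>I. r c) = d + card I then \<Prod>c\<in>I. x c ^ (r c - 1) / fact (r c) else 0))"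
  proof (rule sum.cong[OF refl])
    fix r assume "r \<in> F"
    then show "real (A r) * (\<Sum>e\<in>?S. (\<Prod>c\<in>I. coeff (arc_poly (r c)) (e c)) * (\<Prod>c\<in>I. x c ^ e c)) =
      real (A r) * (if (\<Sum>c\<in>I. r c) = d + card I then \<Prod>c\<in>I. x c ^ (r c - 1) / fact (r c) else 0)"
      using sum_top_coeffs[of r x] by (cases "A r = 0") auto
  qed
  finally show ?thesis .
qed

text \<open>All summands in the value of \<open>Q\<close> at the all-ones point are nonnegative, so
  nothing cancels: the value is positive, hence some coefficient of degree \<open>d\<close> is
  nonzero.\<close>

lemma coef_top_nonzero: "\<exists>e\<in>E. coef e \<noteq> 0 \<and> (\<Sum>c\<in>I. e c) = d"
proof (rule ccontr)
  assume "\<not> (\<exists>e\<in>E. coef e \<noteq> 0 \<and> (\<Sum>c\<in>I. e c) = d)"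
  then have "mpoly_eval (\<lambda>_. 1) Q = 0"
    unfolding Q_def mpoly_eval_mpoly_of[OF I finite_E E_ext] by (intro sum.neutral) auto
  moreover have "mpoly_eval (\<lambda>_. 1) Q > 0"
  proof -
    obtain r where r: "r \<in> F" "A r \<noteq> 0" "(\<Sum>c\<in>I. r c) = d + card I" using exists resolve by blast
    then have "0 < real (A r) * (if (\<Sum>c\<in>I. r c) = d + card I then \<Prod>c\<in>I. 1 ^ (r c - 1) / fact (r c) else 0)"
      by (simp add: prod_pos)
    then show ?thesis
      unfolding eval_Q using r(1) by (intro sum_pos2[OF finite_F r(1)]) (auto intro!: mult_nonneg_nonneg prod_nonneg)
  qed
  ultimately show False by simp
qed

lemma total_degree_P: "total_degree P = d"
proof -
  obtain e where "e \<in> E" "coef e \<noteq> 0" "(\<Sum>c\<in>I. e c) = d" using coef_top_nonzero by blast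
  then show ?thesis unfolding P_def using coef_degree
    by (intro total_degree_mpoly_of[OF I finite_E E_ext]) auto
qed

lemma P_nonzero: "P \<noteq> 0"
proof
  assume "P = 0"
  then have "Poly_Mapping.keys P = {}" by simp
  then show False unfolding P_def keys_mpoly_of[OF I finite_E E_ext] using coef_top_nonzero by blast
qed

lemma top_degree_part_P: "top_degree_part P = Q"
  using top_degree_part_mpoly_of[OF I finite_E E_ext, of coef d] total_degree_P by (simp add: P_def Q_def)

lemma homogeneous_Q: "homogeneous_of_degree d Q"
  unfolding homogeneous_of_degree_def Q_def keys_mpoly_of[OF I finite_E E_ext]
  by (auto simp: monom_degree_monom_of[OF I finite_E E_ext] split: if_splits)

lemma vars_P: "mpoly_vars P \<subseteq> I"
  unfolding P_def by (rule mpoly_vars_mpoly_of[OF I finite_E E_ext])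

text \<open>The difference is compared with \<open>G\<close>, the value of \<open>Q\<close>, summand
  by summand. Each generic summand is bounded by \<open>G\<close> because all summands are
  nonnegative, and each other one is dominated by the generic summand that its resolution
  provides.\<close>

lemma asymp_equiv_P_Q:
  "(\<lambda>n. mpoly_eval (\<lambda>c. real (n c)) P) \<sim>[all_to_infinity I] (\<lambda>n. mpoly_eval (\<lambda>c. real (n c)) Q)"
proof -
  let ?\<Phi> = "all_to_infinity I"
  define T where "T r n = (\<Prod>c\<in>I. poly (arc_poly (r c)) (real (n c)))" for r n :: "piece \<Rightarrow> nat"
  define U where "U r n = (\<Prod>c\<in>I. real (n c) ^ (r c - 1) / fact (r c))" for r n :: "piece \<Rightarrow> nat"
  define G where "G n = mpoly_eval (\<lambda>c. real (n c)) Q" for n :: "piece \<Rightarrow> nat"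
  let ?top = "\<lambda>r. (\<Sum>c\<in>I. r c) = d + card I"
  have U_nonneg: "0 \<le> U r n" for r n unfolding U_def by (intro prod_nonneg) auto
  have G: "G n = (\<Sum>r\<in>F. real (A r) * (if ?top r then U r n else 0))" for n
    unfolding G_def eval_Q U_def ..
  have TU: "T r \<sim>[?\<Phi>] U r" for r
    unfolding T_def[abs_def] U_def[abs_def]
    using asymp_equiv_compose'[OF arc_poly_asymp_equiv filterlim_all_to_infinity] by (intro asymp_equiv_prod)
  have UG: "U r \<in> O[?\<Phi>](G)" if r: "r \<in> F" "A r \<noteq> 0" "?top r" for r
  proof (rule bigoI[where c = 1], rule always_eventually, rule allI)
    fix n
    have "U r n \<le> real (A r) * U r n" using r(2) U_nonneg[of r n] by (simp add: mult_le_cancel_right1 Suc_leI)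
    also have "\<dots> = real (A r) * (if ?top r then U r n else 0)" using r(3) by simp
    also have "\<dots> \<le> G n"
      unfolding G using U_nonneg r(1) by (intro member_le_sum finite_F) auto
    finally show "norm (U r n) \<le> 1 * norm (G n)" using U_nonneg[of r n] by simp
  qed
  have small: "U r \<in> o[?\<Phi>](U r')" if r: "r \<in> F" "r' \<in> F" "\<forall>c\<in>I. r c \<le> r' c" "c0 \<in> I" "r c0 < r' c0" for r r' c0
  proof (rule landau_o.smallI)
    fix \<epsilon> :: real assume \<epsilon>: "\<epsilon> > 0"
    \<comment> \<open>\<open>K\<close> clears the denominators of \<open>U r'\<close>; the
      factorials under \<open>U r\<close> are at least 1 and may be dropped.\<close>
    define K :: real where "K = (\<Prod>c\<in>I. fact (r' c))"
    have K: "0 < K" unfolding K_def by (intro prod_pos) auto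
    \<comment> \<open>Beyond this threshold the surplus factor \<open>n c0\<close> is at least
      \<open>K / \<epsilon>\<close>; the other \<open>n c\<close> only have to be at least
      1.\<close>
    have "eventually (\<lambda>n. nat \<lceil>K / \<epsilon>\<rceil> \<le> n c0) ?\<Phi>"
      using filterlim_all_to_infinity[OF r(4)] unfolding filterlim_at_top by blast
    moreover have "eventually (\<lambda>n. \<forall>c\<in>I. 1 \<le> n c) ?\<Phi>" using eventually_all_to_infinity_ge[OF I] .
    ultimately show "eventually (\<lambda>n. norm (U r n) \<le> \<epsilon> * norm (U r' n)) ?\<Phi>"
    proof eventually_elim
      case (elim n)
      have n1: "1 \<le> real (n c)" if "c \<in> I" for c using elim(2) that by auto
      have "real (n c0) * (\<Prod>c\<in>I. real (n c) ^ (r c - 1)) \<le> (\<Prod>c\<in>I. real (n c) ^ (r' c - 1))"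
      proof -
        have "real (n c0) * (\<Prod>c\<in>I. real (n c) ^ (r c - 1)) =
            (real (n c0) * real (n c0) ^ (r c0 - 1)) * (\<Prod>c\<in>I - {c0}. real (n c) ^ (r c - 1))"
          using I r(4) by (subst prod.remove[of I c0]) auto
        also have "\<dots> \<le> real (n c0) ^ (r' c0 - 1) * (\<Prod>c\<in>I - {c0}. real (n c) ^ (r' c - 1))"
        proof (intro mult_mono prod_mono conjI prod_nonneg)
          have "real (n c0) * real (n c0) ^ (r c0 - 1) = real (n c0) ^ (Suc (r c0 - 1))" by simp
          also have "\<dots> \<le> real (n c0) ^ (r' c0 - 1)"
            using n1[OF r(4)] r(5) F_ge_1[OF r(1,4)] by (intro power_increasing) auto
          finally show "real (n c0) * real (n c0) ^ (r c0 - 1) \<le> real (n c0) ^ (r' c0 - 1)" .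
          fix c assume "c \<in> I - {c0}"
          then show "real (n c) ^ (r c - 1) \<le> real (n c) ^ (r' c - 1)"
            using n1[of c] r(3) by (intro power_increasing diff_le_mono) auto
        qed auto
        also have "\<dots> = (\<Prod>c\<in>I. real (n c) ^ (r' c - 1))"
          by (rule prod.remove[OF I r(4), symmetric])
        finally show ?thesis .
      qed
      also have "\<dots> = K * U r' n" using K by (simp add: U_def K_def prod_dividef)
      finally have 1: "real (n c0) * (\<Prod>c\<in>I. real (n c) ^ (r c - 1)) \<le> K * U r' n" .
      have "U r n \<le> (\<Prod>c\<in>I. real (n c) ^ (r c - 1))"
        unfolding U_def by (intro prod_mono) (auto simp: divide_le_eq mult_le_cancel_left1)
      then have "real (n c0) * U r n \<le> K * U r' n"
        using 1 mult_left_mono[of "U r n" "\<Prod>c\<in>I. real (n c) ^ (r c - 1)" "real (n c0)"] by simp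
      moreover have "K / \<epsilon> * U r n \<le> real (n c0) * U r n"
        using elim(1) U_nonneg by (intro mult_right_mono) linarith+
      ultimately have "K * (U r n / \<epsilon>) \<le> K * U r' n" by simp
      then have "U r n / \<epsilon> \<le> U r' n" using K by (rule mult_left_le_imp_le)
      then show ?case using \<epsilon> U_nonneg by (simp add: field_simps)
    qed
  qed
  have "(\<lambda>n. \<Sum>r\<in>F. real (A r) * (T r n - (if ?top r then U r n else 0))) \<in> o[?\<Phi>](G)"
  proof (rule big_sum_in_smallo)
    fix r assume r: "r \<in> F"
    show "(\<lambda>n. real (A r) * (T r n - (if ?top r then U r n else 0))) \<in> o[?\<Phi>](G)"
    proof (cases "A r = 0")
      case False
      have "(\<lambda>n. T r n - (if ?top r then U r n else 0)) \<in> o[?\<Phi>](G)"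
      proof (cases "?top r")
        case True
        then show ?thesis
          using landau_o.small_big_trans[OF asymp_equiv_imp_diff_smallo[OF TU] UG[OF r False True]] by simp
      next
        case nt: False
        obtain r' where r': "r' \<in> F" "A r' \<noteq> 0" "?top r'" "\<forall>c\<in>I. r c \<le> r' c" using resolve[OF r False] by blast
        \<comment> \<open>The totals differ while \<open>r\<close> is nowhere above
          \<open>r'\<close>, so \<open>r'\<close> has strictly more points on some piece.\<close>
        have "\<exists>c\<in>I. r c \<noteq> r' c" using nt r'(3) by (metis sum.cong)
        then obtain c0 where "c0 \<in> I" "r c0 < r' c0" using r'(4) by (metis le_neq_implies_less)
        from landau_o.small_big_trans[OF small[OF r r'(1,4) this] UG[OF r'(1-3)]]
        have "U r \<in> o[?\<Phi>](G)" .
        then have "T r \<in> o[?\<Phi>](G)"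
          using landau_o.big_small_trans[OF asymp_equiv_imp_bigo[OF TU]] by blast
        then show ?thesis using nt by simp
      qed
      then show ?thesis by (simp add: landau_o.small.cmult_in_iff)
    qed simp
  qed
  moreover have "mpoly_eval (\<lambda>c. real (n c)) P - G n =
      (\<Sum>r\<in>F. real (A r) * (T r n - (if ?top r then U r n else 0)))" for n
    unfolding eval_P G T_def by (simp add: sum_subtractf right_diff_distrib)
  ultimately show ?thesis
    unfolding G_def[symmetric] by (intro smallo_imp_asymp_equiv) simp
qed

end

text \<open>Points of one colour cannot be glued, so the core is empty and connectedness leaves one
  uncut piece: a sphere with one face. There \<open>4 * g - 4 + card I + 2 * p\<close> is -1, which
  is not a natural number.\<close>

lemma gluings_one_colour:
  assumes "\<And>a b. a \<in> I \<Longrightarrow> b \<in> I \<Longrightarrow> fst a = fst b"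
    and d: "int d = 4 * int g - 4 + int (card I) + 2 * int p"
  shows "gluings I X g p = {}"
proof (rule ccontr)
  assume "gluings I X g p \<noteq> {}"
  then obtain D and R :: "'a gluing" where c: "core I D R g p" unfolding gluings_def by blast
  have e: "equiv D R" and pc: "properly_coloured R" and DI: "fst ` D \<subseteq> I" and gp: "gluing_points R = D"
    using c by (auto simp: core_def coloured_gluing_def)
  have eq: "x = y" if "(x, y) \<in> R" for x y
  proof -
    have "fst x \<in> I" "fst y \<in> I" using that gluing_equivD(1)[OF e] DI by blast+
    then have "colour x = colour y" unfolding colour_def by (rule assms(1))
    then show ?thesis using pc that unfolding properly_coloured_iff by blast
  qed
  have "x \<notin> D" for x
  proof
    assume "x \<in> D"
    then have "x \<in> gluing_points R" using gp by simp
    then obtain y where "(x, y) \<in> R" "x \<noteq> y" by (rule gluing_pointsE)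
    then show False using eq by blast
  qed
  then have D: "D = {}" by blast
  then have R: "R = {}" using gluing_equivD(1)[OF e] by blast
  have "I \<noteq> {}" "\<forall>a\<in>I. \<forall>b\<in>I. (a, b) \<in> {}\<^sup>*"
    using c unfolding core_def connected_gluing_def R by auto
  then obtain a where a: "I = {a}" by auto
  then have "num_faces I D R = 1" by (simp add: D num_faces_def)
  then have "p = 1" "g = 0" using c a by (auto simp: core_def has_genus_def D R)
  then show False using d a by simp
qed

text \<open>If all pieces have the same colour there are no constellations at all, which is why the
  degree is asserted only when two colours occur.\<close>

theorem theorem1:
  fixes k g p d :: nat and m :: "nat \<Rightarrow> nat" and I :: "piece set"
  assumes k: "1 \<le> k" and p: "1 \<le> p"
    and I: "I = pieces k m"
    and d: "int d = 4 * int g - 4 + int (\<Sum>i=1..k. m i) + 2 * int p"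
  shows "\<exists>P Q :: piece mpoly.
      mpoly_vars P \<subseteq> I \<and>
      (\<forall>n. (\<forall>c\<in>I. 2 \<le> n c) \<longrightarrow>
         num_constellations I n g p = mpoly_eval (\<lambda>c. real (n c)) P) \<and>
      (if \<exists>i\<in>{1..k}. \<exists>j\<in>{1..k}. i \<noteq> j \<and> 0 < m i \<and> 0 < m j
       then P \<noteq> 0 \<and> total_degree P = d else P = 0) \<and>
      (\<forall>l. (\<forall>c\<in>I. 0 < l c) \<longrightarrow>
         circle_volume I l (circle_space I l g p) = ennreal (mpoly_eval l Q)) \<and>
      homogeneous_of_degree d Q \<and>
      Q = top_degree_part P \<and>
      (\<lambda>n. num_constellations I n g p) \<sim>[all_to_infinity I]
      (\<lambda>n. mpoly_eval (\<lambda>c. real (n c)) Q)"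
proof -
  have fin: "finite I" by (simp add: I pieces_def)
  have d': "int d = 4 * int g - 4 + int (card I) + 2 * int p"
    using d by (simp add: I pieces_def)
  have large: "eventually (\<lambda>n. \<forall>c\<in>I. 2 \<le> n c) (all_to_infinity I)"
    by (rule eventually_all_to_infinity_ge[OF fin])
  show ?thesis
  proof (cases "\<exists>i\<in>{1..k}. \<exists>j\<in>{1..k}. i \<noteq> j \<and> 0 < m i \<and> 0 < m j")
    case True
    then obtain i j where ij: "i \<in> {1..k}" "j \<in> {1..k}" "i \<noteq> j" "0 < m i" "0 < m j" by blast
    \<comment> \<open>Two pieces of different colours, from which a tree can be built.\<close>
    define a b :: piece where "a = (i, 1)" and "b = (j, 1)"
    have ab: "a \<in> I" "b \<in> I" "fst a \<noteq> fst b" using ij by (auto simp: a_def b_def I pieces_def)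
    have "card {a, b} \<le> card I" using ab fin by (intro card_mono) auto
    then have two: "2 \<le> card I" using ab by (cases "a = b") auto
    define F where "F = (\<Pi>\<^sub>E c\<in>I. {1..d + card I})"
    let ?A = "\<lambda>r. card (cores I g p r)"
    have A: "?A r \<noteq> 0 \<longleftrightarrow> cores I g p r \<noteq> {}" for r using finite_cores[OF fin] by simp
    have inF: "r \<in> F" if r: "r \<in> extensional I" "cores I g p r \<noteq> {}" for r
    proof -
      obtain S where "S \<in> cores I g p r" using r(2) by blast
      from cores_bounds(2,3)[OF fin this d' two] show ?thesis unfolding F_def using r(1) by (auto simp: PiE_iff)
    qed
    have res: "\<exists>r'\<in>F. ?A r' \<noteq> 0 \<and> (\<Sum>c\<in>I. r' c) = d + card I \<and> (\<forall>c\<in>I. r c \<le> r' c)" if "?A r \<noteq> 0" for r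
      using cores_resolve[OF that[unfolded A] fin d'] inF A by metis
    interpret arc_pattern_count I d ?A F
    proof
      show "(\<Sum>c\<in>I. r c) \<le> d + card I" if "?A r \<noteq> 0" for r
        using that cores_bounds(1)[OF fin _ d' two] unfolding A by blast
      show "\<exists>r\<in>F. ?A r \<noteq> 0" using cores_exist[OF fin ab p, of g] res A by metis
    qed (use fin F_def res in auto)
    have count: "num_constellations I n g p = mpoly_eval (\<lambda>c. real (n c)) P" if n: "\<forall>c\<in>I. 2 \<le> n c" for n
    proof -
      have n0: "0 < n c" if "c \<in> I" for c using n that by force
      have "card (constellations I n g p) = (\<Sum>r\<in>F. ?A r * (\<Prod>c\<in>I. n c choose r c))"
        using finite_F inF by (intro card_constellations[OF fin]) (auto simp: F_def PiE_def)
      then have "num_constellations I n g p = (\<Sum>r\<in>F. real (?A r) * (\<Prod>c\<in>I. real (n c choose r c))) / (\<Prod>c\<in>I. real (n c))"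
        using num_constellations_eq[OF fin, of n g p] n0 by simp
      also have "\<dots> = (\<Sum>r\<in>F. real (?A r) * (\<Prod>c\<in>I. poly (arc_poly (r c)) (real (n c))))"
        unfolding sum_divide_distrib
      proof (rule sum.cong[OF refl])
        fix r assume r: "r \<in> F"
        have "(\<Prod>c\<in>I. real (n c choose r c)) = (\<Prod>c\<in>I. real (n c)) * (\<Prod>c\<in>I. poly (arc_poly (r c)) (real (n c)))"
          unfolding prod.distrib[symmetric] using binomial_eq_arc_poly F_ge_1[OF r] by (intro prod.cong) auto
        moreover have "(\<Prod>c\<in>I. real (n c)) \<noteq> 0" using n0 fin by (auto simp: prod_zero_iff)
        ultimately show "real (?A r) * (\<Prod>c\<in>I. real (n c choose r c)) / (\<Prod>c\<in>I. real (n c)) =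
            real (?A r) * (\<Prod>c\<in>I. poly (arc_poly (r c)) (real (n c)))" by simp
      qed
      also have "\<dots> = mpoly_eval (\<lambda>c. real (n c)) P" by (simp add: eval_P)
      finally show ?thesis .
    qed
    have "(\<lambda>n. num_constellations I n g p) \<sim>[all_to_infinity I] (\<lambda>n. mpoly_eval (\<lambda>c. real (n c)) Q)"
    proof (rule asymp_equiv_transfer[OF asymp_equiv_P_Q])
      show "eventually (\<lambda>n. mpoly_eval (\<lambda>c. real (n c)) P = num_constellations I n g p) (all_to_infinity I)"
        using large by eventually_elim (simp add: count)
    qed simp
    moreover have "circle_volume I l (circle_space I l g p) = ennreal (mpoly_eval l Q)" if "\<forall>c\<in>I. 0 < l c" for l
      using circle_volume_eq[OF fin two _ d' F_def, of l] that by (simp add: eval_Q)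
    ultimately show ?thesis
      using True vars_P count P_nonzero total_degree_P homogeneous_Q top_degree_part_P
      by (intro exI[of _ P] exI[of _ Q]) simp
  next
    case False
    have same: "fst a = fst b" if "a \<in> I" "b \<in> I" for a b
    proof -
      have "fst a \<in> {1..k}" "fst b \<in> {1..k}" "0 < m (fst a)" "0 < m (fst b)"
        using that by (auto simp: I pieces_def)
      then show ?thesis using False by blast
    qed
    have empty: "gluings I (corners I n) g p = {}" "gluings I (circle_points I l) g p = {}" for n l
      using gluings_one_colour[OF _ d'] same by blast+
    have num: "num_constellations I n g p = 0" for n
      unfolding num_constellations_def constellations_eq_gluings[OF fin] empty by simp
    have "circle_space I l g p = {}" for l
      unfolding circle_space_def circle_constellations_eq_gluings empty by simp
    then have "circle_volume I l (circle_space I l g p) = 0" for l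
      by (simp add: circle_volume_def split_def)
    then show ?thesis
      using False num
      by (intro exI[of _ 0])
        (auto simp: mpoly_vars_def mpoly_eval_def homogeneous_of_degree_def top_degree_part_def)
  qed
qed

end
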